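(* The monoid variety $\mathsf{var}_{\mathbb{M}}\{A^1\times B^1\}$ generated by the monoid $A^1\times B^1$ is a limit variety of monoids; that is, it is non-finitely based, but each of its proper monoid subvarieties is finitely based.
   Context: $A=\{0,a,b,c,d,e\}$ is the semigroup with zero $0$ whose nonzero products are exactly $ae=a$, $be=b$, $cb=a$, $cd=c$, $db=b$, $dd=d$, $ea=a$, $eb=a$, $ec=c$, $ed=c$, $ee=e$ (all other products equal $0$). $B$ is the semigroup dual (anti-isomorphic) to $A$. $A^1$ and $B^1$ are the monoids obtained from $A$ and $B$ by adjoining an identity element; $B^1$ is dual to $A^1$. For a class $\mathfrak{C}$ of monoids, $\mathsf{var}_{\mathbb{M}}\{\mathfrak{C}\}$ is the variety of monoids generated by $\mathfrak{C}$. A variety is finitely based if there is a finite set of its identities from which all of its identities can be deduced, and non-finitely based otherwise. A limit variety is a non-finitely based variety all of whose proper subvarieties are finitely based. *)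

theory Defs
  imports "HOL-Algebra.Product_Groups"
begin

section \<open>Varieties of monoids\<close>

text \<open>
  A class of monoids is a set of monoids whose carriers are subsets of one type
  \<open>'u\<close>, the universe.  It is only used for infinite \<open>'u\<close>.

  A variety is a class closed under homomorphic images, submonoids and arbitrary direct
  products.  The three closure conditions cannot be imposed one at a time: \<open>'u\<close> need not
  have room for a full direct product of infinitely many of its monoids, although it has
  room for submonoids and quotients of that product.  Hence every monoid over \<open>'u\<close> that is
  a homomorphic image of a submonoid of a product of members has to be a member.
  The product itself lives outside the universe, over \<open>'u \<Rightarrow> 'u\<close>.

  Index sets are subsets of \<open>'u\<close>.  For infinite \<open>'u\<close> larger index sets would not give more:
  a monoid over \<open>'u\<close> that is obtained from a product of any size is a quotient of a
  relatively free monoid of rank at most the cardinality of \<open>'u\<close>, and at most that many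
  members are needed to separate the elements of the latter.  The empty index set puts the
  trivial monoids into every variety.

  Multiplicative maps (\<^const>\<open>hom\<close>) onto a monoid preserve the identity element.
\<close>

definition HSP :: "'u monoid set \<Rightarrow> 'u monoid set" where
  "HSP K = {N. monoid N \<and>
     (\<exists>(I :: 'u set) (M :: 'u \<Rightarrow> 'u monoid) S h.
        (\<forall>i\<in>I. M i \<in> K) \<and>
        submonoid S (product_group I M) \<and>
        h \<in> epi ((product_group I M)\<lparr>carrier := S\<rparr>) N)}"

definition monoid_variety :: "'u monoid set \<Rightarrow> bool" where
  "monoid_variety V \<longleftrightarrow> (\<forall>M\<in>V. monoid M) \<and> HSP V \<subseteq> V"

text \<open>
  The least variety over \<open>'u\<close> containing the members of \<open>K\<close>.  These may live over a
  different type, so they are represented by their isomorphic copies over \<open>'u\<close>.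
\<close>

definition variety_generated_by :: "'a monoid set \<Rightarrow> 'u monoid set" where
  "variety_generated_by K =
     \<Inter>{V. monoid_variety V \<and> (\<forall>M\<in>K. \<forall>N. monoid N \<and> N \<cong> M \<longrightarrow> N \<in> V)}"


section \<open>Identities and finite bases\<close>

text \<open>
  Monoid words over a countably infinite alphabet, the empty word included; an identity
  \<open>u \<approx> v\<close> is the pair \<open>(u, v)\<close>.
\<close>

type_synonym mword = "nat list"
type_synonym midentity = "mword \<times> mword"

definition word_value :: "'a monoid \<Rightarrow> (nat \<Rightarrow> 'a) \<Rightarrow> mword \<Rightarrow> 'a" where
  "word_value M \<phi> w = foldr (\<lambda>x y. \<phi> x \<otimes>\<^bsub>M\<^esub> y) w \<one>\<^bsub>M\<^esub>"

definition satisfies :: "'a monoid \<Rightarrow> midentity \<Rightarrow> bool" where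
  "satisfies M e \<longleftrightarrow>
     (\<forall>\<phi>. range \<phi> \<subseteq> carrier M \<longrightarrow> word_value M \<phi> (fst e) = word_value M \<phi> (snd e))"

definition identities_of :: "'a monoid set \<Rightarrow> midentity set" where
  "identities_of V = {e. \<forall>M\<in>V. satisfies M e}"

inductive deducible :: "midentity set \<Rightarrow> mword \<Rightarrow> mword \<Rightarrow> bool" for \<Sigma> where
  axiom: "(u, v) \<in> \<Sigma> \<Longrightarrow> deducible \<Sigma> u v"
| refl: "deducible \<Sigma> u u"
| sym: "deducible \<Sigma> u v \<Longrightarrow> deducible \<Sigma> v u"
| trans: "deducible \<Sigma> u v \<Longrightarrow> deducible \<Sigma> v w \<Longrightarrow> deducible \<Sigma> u w"
| mult: "deducible \<Sigma> u v \<Longrightarrow> deducible \<Sigma> u' v' \<Longrightarrow> deducible \<Sigma> (u @ u') (v @ v')"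
| subst: "deducible \<Sigma> u v \<Longrightarrow>
    deducible \<Sigma> (concat (map \<sigma> u)) (concat (map \<sigma> v))" for \<sigma> :: "nat \<Rightarrow> mword"

definition finitely_based :: "'u monoid set \<Rightarrow> bool" where
  "finitely_based V \<longleftrightarrow>
     (\<exists>\<Sigma>. finite \<Sigma> \<and> \<Sigma> \<subseteq> identities_of V \<and> (\<forall>(u, v)\<in>identities_of V. deducible \<Sigma> u v))"

definition limit_variety :: "'u monoid set \<Rightarrow> bool" where
  "limit_variety V \<longleftrightarrow>
     monoid_variety V \<and> \<not> finitely_based V \<and>
     (\<forall>W. monoid_variety W \<and> W \<subset> V \<longrightarrow> finitely_based W)"


section \<open>The monoids\<close>

datatype A_elt = A_0 | A_a | A_b | A_c | A_d | A_e

fun A_mult :: "A_elt \<Rightarrow> A_elt \<Rightarrow> A_elt" where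
  "A_mult A_a A_e = A_a"
| "A_mult A_b A_e = A_b"
| "A_mult A_c A_b = A_a"
| "A_mult A_c A_d = A_c"
| "A_mult A_d A_b = A_b"
| "A_mult A_d A_d = A_d"
| "A_mult A_e A_a = A_a"
| "A_mult A_e A_b = A_a"
| "A_mult A_e A_c = A_c"
| "A_mult A_e A_d = A_c"
| "A_mult A_e A_e = A_e"
| "A_mult _ _ = A_0"

definition B_mult :: "A_elt \<Rightarrow> A_elt \<Rightarrow> A_elt" where
  "B_mult x y = A_mult y x"

fun adjoin_identity_mult :: "('a \<Rightarrow> 'a \<Rightarrow> 'a) \<Rightarrow> 'a option \<Rightarrow> 'a option \<Rightarrow> 'a option" where
  "adjoin_identity_mult f None y = y"
| "adjoin_identity_mult f x None = x"
| "adjoin_identity_mult f (Some x) (Some y) = Some (f x y)"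

definition adjoin_identity :: "('a \<Rightarrow> 'a \<Rightarrow> 'a) \<Rightarrow> 'a option monoid" where
  "adjoin_identity f = \<lparr>carrier = UNIV, mult = adjoin_identity_mult f, one = None\<rparr>"

definition A1 :: "A_elt option monoid" where
  "A1 = adjoin_identity A_mult"

definition B1 :: "A_elt option monoid" where
  "B1 = adjoin_identity B_mult"

lemma A_mult_assoc: "A_mult (A_mult x y) z = A_mult x (A_mult y z)"
  by (cases x; cases y; cases z; simp)

lemma B_mult_assoc: "B_mult (B_mult x y) z = B_mult x (B_mult y z)"
  by (simp add: B_mult_def A_mult_assoc)

lemma monoid_adjoin_identity:
  assumes "\<And>x y z. f (f x y) z = f x (f y z)"
  shows "monoid (adjoin_identity f)"
proof (rule monoidI)
  fix x y z
  show "x \<otimes>\<^bsub>adjoin_identity f\<^esub> y \<otimes>\<^bsub>adjoin_identity f\<^esub> z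
      = x \<otimes>\<^bsub>adjoin_identity f\<^esub> (y \<otimes>\<^bsub>adjoin_identity f\<^esub> z)"
    by (cases x; cases y; cases z) (simp_all add: adjoin_identity_def assms)
  show "x \<otimes>\<^bsub>adjoin_identity f\<^esub> \<one>\<^bsub>adjoin_identity f\<^esub> = x"
    by (cases x) (simp_all add: adjoin_identity_def)
qed (simp_all add: adjoin_identity_def)

lemma monoid_A1: "monoid A1" and monoid_B1: "monoid B1"
  by (simp_all add: A1_def B1_def monoid_adjoin_identity A_mult_assoc B_mult_assoc)

lemma monoid_variety_generated: "monoid_variety (variety_generated_by K :: 'u monoid set)"
proof -
  have "monoid_variety {M :: 'u monoid. monoid M}"
    by (auto simp: monoid_variety_def HSP_def)
  then have "\<forall>M\<in>variety_generated_by K. monoid (M :: 'u monoid)"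
    unfolding variety_generated_by_def by (auto dest!: InterD)
  moreover
  have mono: "HSP V \<subseteq> HSP W" if "V \<subseteq> W" for V W :: "'u monoid set"
    using that by (fastforce simp: HSP_def)
  have "HSP (variety_generated_by K) \<subseteq> (variety_generated_by K :: 'u monoid set)"
    unfolding variety_generated_by_def
  proof (rule Inter_greatest)
    fix V :: "'u monoid set"
    let ?C = "{V. monoid_variety V \<and> (\<forall>M\<in>K. \<forall>N. monoid N \<and> N \<cong> M \<longrightarrow> N \<in> V)}"
    assume V: "V \<in> ?C"
    have "HSP (\<Inter>?C) \<subseteq> HSP V"
      by (rule mono) (rule Inter_lower[OF V])
    also have "\<dots> \<subseteq> V"
      using V by (simp add: monoid_variety_def)
    finally show "HSP (\<Inter>?C) \<subseteq> V" .
  qed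
  ultimately show ?thesis
    by (simp add: monoid_variety_def)
qed

end

theory Submission
  imports Defs
begin

text \<open>
  In a word, the simple letters (those occurring once) cut out blocks.  An identity holds in
  \<open>A\<^sup>1 \<times> B\<^sup>1\<close> iff it preserves the content of each block, the order of the simple letters,
  and, within a block, the order of the first occurrence of \<open>x\<close> and the last occurrence of \<open>y\<close>
  in that block whenever \<open>x\<close> does not survive until the next block containing \<open>y\<close> (this is
  \<open>A\<^sup>1\<close>), together with the mirror image of the last condition (this is \<open>B\<^sup>1\<close>).

  Non-finite basis: \<open>y z\<^sub>1\<^sup>2 \<dots> z\<^sub>n\<^sup>2 y \<approx> y z\<^sub>1\<^sup>2 y z\<^sub>2\<^sup>2 \<dots> z\<^sub>n\<^sup>2 y\<close> holds, but an identity in few letters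
  cannot move a \<open>y\<close> into the gap: if it is applied across the gap, some \<open>z\<^sub>i\<close> lies in the image
  of a simple letter \<open>t\<close> only, and \<open>t\<close> separates the two outer occurrences of \<open>y\<close>.

  Proper subvarieties: any identity that fails in \<open>A\<^sup>1\<close> yields, modulo the theory of
  \<open>A\<^sup>1 \<times> B\<^sup>1\<close>, the identity \<open>yxxty \<approx> xyxty\<close>; dually for \<open>B\<^sup>1\<close>.  The reverse of this identity
  implies all identities of \<open>A\<^sup>1\<close>.  Finally, every fully invariant congruence containing
  the identities of \<open>A\<^sup>1\<close> is generated by its members among fourteen fixed identities: two
  congruent words, in normal form, are transformed into each other by exchanging adjacent
  letters, and each exchange is an instance of such an identity, obtained by deleting all
  but two or three letters from the given words.
\<close>

section \<open>Fully invariant congruences on words\<close>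

text \<open>A proper subvariety satisfies an identity that fails in \<open>A^1\<close> or in its
  dual: the product is finite, and a variety all of whose identities hold in a finite monoid
  contains the copies of that monoid. The obstacle in the finite basis part is that a derivation
  passes through words other than the two given ones, while each exchange needs an identity known to
  belong to the given theory. Two congruences are therefore kept apart: the given \<open>Th\<close>,
  and \<open>D\<close>, generated by the fixed identities that hold in \<open>Th\<close>. An
  identity is read off in \<open>Th\<close> from the two given words; being one of the fixed ones it
  passes to \<open>D\<close>, where it is applied to the intermediate word. There only the presence
  of the two letters to the left and right of the exchange matters. The main case distinction is on
  \<open>id_mu\<close>, that is \<open>xsxtx \<approx> xstx\<close>. If it holds, only first and
  last occurrences count; if it fails, the content of each block is invariant and words can be
  treated block by block. The identity \<open>yxxty \<approx> xyxty\<close> is critical because,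
  with \<open>e\<close>, \<open>d\<close>, \<open>b\<close> for \<open>y\<close>, \<open>x\<close>,
  \<open>t\<close>, its left side has the value \<open>a\<close> in \<open>A^1\<close>, while its
  right side begins with \<open>de = 0\<close>.\<close>

primrec before :: "'a \<Rightarrow> 'a \<Rightarrow> 'a list \<Rightarrow> bool" where
  "before a b [] = False"
| "before a b (x # xs) = (x = a \<and> b \<in> set xs \<or> before a b xs)"

lemma before_append [simp]:
  "before a b (xs @ ys) \<longleftrightarrow> before a b xs \<or> before a b ys \<or> a \<in> set xs \<and> b \<in> set ys"
  by (induction xs) auto

lemma before_in_set: "before a b xs \<Longrightarrow> a \<in> set xs \<and> b \<in> set xs"
  by (induction xs) auto

lemma before_rev [simp]: "before a b (rev xs) = before b a xs"
  by (induction xs) (auto dest: before_in_set)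

lemma before_map: "before a b xs \<Longrightarrow> before (f a) (f b) (map f xs)"
  by (induction xs) auto

lemma before_filter [simp]: "before a b (filter P xs) \<longleftrightarrow> P a \<and> P b \<and> before a b xs"
  by (induction xs) auto

lemma before_total: "a \<in> set xs \<Longrightarrow> b \<in> set xs \<Longrightarrow> a \<noteq> b \<Longrightarrow> before a b xs \<or> before b a xs"
  by (induction xs) auto

lemma before_asym: "distinct xs \<Longrightarrow> before a b xs \<Longrightarrow> \<not> before b a xs"
  by (induction xs) (auto dest: before_in_set)

lemma before_split: "before a b xs \<Longrightarrow> \<exists>us vs. xs = us @ a # vs \<and> a \<notin> set us \<and> b \<in> set vs"
proof (induction xs)
  case (Cons x xs)
  show ?case
  proof (cases "x = a")
    case True
    then have "b \<in> set xs"
      using Cons.prems by (auto dest: before_in_set)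
    then show ?thesis
      using True by (intro exI[of _ "[]"] exI[of _ xs]) simp
  next
    case False
    then have "before a b xs"
      using Cons.prems by simp
    then obtain us vs where "xs = us @ a # vs" "a \<notin> set us" "b \<in> set vs"
      using Cons.IH by blast
    then show ?thesis
      using False by (intro exI[of _ "x # us"] exI[of _ vs]) simp
  qed
qed simp

text \<open>With equal letters, \<open>before t t w\<close> expresses that \<open>t\<close> is
  repeated in \<open>w\<close>; simple letters are described throughout by occurrence and
  \<open>\<not> before t t w\<close>. For distinct letters, \<open>before x y w\<close> compares the
  first \<open>x\<close> with the last \<open>y\<close>, the kind of order that \<open>A^1\<close>
  detects.\<close>

lemma simple_split:
  assumes "t \<in> set w" "\<not> before t t w"
  obtains a b where "w = a @ t # b" "t \<notin> set a" "t \<notin> set b"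
proof -
  obtain a b where "w = a @ t # b" "t \<notin> set a"
    using assms(1) split_list_first by metis
  moreover have "t \<notin> set b"
    using assms(2) calculation by auto
  ultimately show thesis
    using that by blast
qed

lemma concat_filter: "concat (map (\<lambda>x. if P x then [x] else []) w) = filter P w"
  by (induction w) auto

lemma concat_singleton: "concat (map (\<lambda>x. [f x]) w) = map f w"
  by (induction w) auto

lemma filter_eq_replicate: "filter (\<lambda>z. z = x) w = replicate (length (filter (\<lambda>z. z = x) w)) x"
  by (induction w) auto

text \<open>
  A list is sorted towards \<open>ys\<close> by moving the entries of \<open>ys\<close> to the front one after the
  other; only adjacent entries that \<open>ys\<close> lists in the opposite order are ever exchanged.
\<close>

lemma adjacent_swaps:
  fixes E :: "'s list \<Rightarrow> 's list \<Rightarrow> bool"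
  assumes refl: "\<And>u. E u u" and trans: "\<And>u v w. E u v \<Longrightarrow> E v w \<Longrightarrow> E u w"
    and "distinct xs" "distinct ys" "set xs = set ys"
    and "\<And>P Q a b. \<lbrakk>distinct (P @ a # b # Q); set (P @ a # b # Q) = set xs;
        before a b xs; before b a ys;
        \<And>c d. before c d xs \<Longrightarrow> before c d ys \<Longrightarrow> before c d (P @ a # b # Q)\<rbrakk>
        \<Longrightarrow> E (P @ a # b # Q) (P @ b # a # Q)"
  shows "E xs ys"
  using assms
proof (induction ys arbitrary: xs E)
  case Nil
  then show ?case by simp
next
  case (Cons a ys)
  note swap = Cons.prems(6) and trans = Cons.prems(2)
  have "a \<in> set xs"
    using Cons.prems(5) by simp
  then obtain X Y where xs: "xs = X @ a # Y"
    using split_list by metis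
  have *: "E (X1 @ X2 @ a # Y) (X1 @ a # X2 @ Y)" if "X = X1 @ X2" for X1 X2
    using that
  proof (induction X2 arbitrary: X1)
    case Nil
    then show ?case by (simp add: Cons.prems(1))
  next
    case (Cons z X2)
    have "E ((X1 @ [z]) @ X2 @ a # Y) ((X1 @ [z]) @ a # X2 @ Y)"
      using Cons.prems by (intro Cons.IH) simp
    moreover have "E (X1 @ z # a # (X2 @ Y)) (X1 @ a # z # (X2 @ Y))"
    proof (rule swap)
      show "distinct (X1 @ z # a # X2 @ Y)" "set (X1 @ z # a # X2 @ Y) = set xs"
        using \<open>distinct xs\<close> by (auto simp: xs Cons.prems)
      show "before z a xs"
        by (simp add: xs Cons.prems)
      show "before a z (a # ys)"
        using \<open>distinct xs\<close> \<open>set xs = set (a # ys)\<close> by (auto simp: xs Cons.prems)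
      \<comment> \<open>Pairs ordered alike in both lists keep their order all the time. Later this
        guarantees that in every intermediate list the first occurrence of a letter still precedes
        its last one.\<close>
      show "before c d (X1 @ z # a # X2 @ Y)" if "before c d xs" "before c d (a # ys)" for c d
      proof (cases "d = a")
        case True
        then show ?thesis
          using that \<open>distinct (a # ys)\<close> by (auto dest: before_in_set)
      next
        case False
        then show ?thesis
          using that(1) by (auto simp: xs Cons.prems dest: before_in_set)
      qed
    qed
    ultimately have "E (X1 @ z # X2 @ a # Y) (X1 @ a # z # X2 @ Y)"
      using trans[of "X1 @ z # X2 @ a # Y" "X1 @ z # a # X2 @ Y"] by simp
    then show ?case
      by simp
  qed
  have "E xs (a # X @ Y)"
    using *[of "[]" X] by (simp add: xs)
  moreover have "E (a # X @ Y) (a # ys)"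
  \<comment> \<open>The other entries are sorted behind a fixed \<open>a\<close>, so the induction
    hypothesis is needed for the relation that puts \<open>a\<close> in front of both lists; hence
    \<open>E\<close> is arbitrary in the induction.\<close>
  proof (rule Cons.IH[of "\<lambda>u v. E (a # u) (a # v)"])
    show "E (a # u) (a # u)" for u
      by (rule Cons.prems(1))
    show "E (a # u) (a # w)" if "E (a # u) (a # v)" "E (a # v) (a # w)" for u v w
      using Cons.prems(2) that .
    show "distinct (X @ Y)" "distinct ys"
      using Cons.prems(3,4) by (auto simp: xs)
    have "set (X @ Y) = set xs - {a}" "set ys = set (a # ys) - {a}"
      using Cons.prems(3,4) by (auto simp: xs)
    then show s: "set (X @ Y) = set ys"
      using Cons.prems(5) by (simp only:)
    fix P Q c d
    assume h: "distinct (P @ c # d # Q)" "set (P @ c # d # Q) = set (X @ Y)"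
      "before c d (X @ Y)" "before d c ys"
      "\<And>e f. before e f (X @ Y) \<Longrightarrow> before e f ys \<Longrightarrow> before e f (P @ c # d # Q)"
    have "E ((a # P) @ c # d # Q) ((a # P) @ d # c # Q)"
    proof (rule swap)
      show "distinct ((a # P) @ c # d # Q)"
        using h(1,2) Cons.prems(3,4) s by auto
      show "set ((a # P) @ c # d # Q) = set xs"
        using h(2) by (auto simp: xs)
      show "before c d xs" "before d c (a # ys)"
        using h(3,4) by (auto simp: xs)
      show "before e f ((a # P) @ c # d # Q)" if "before e f xs" "before e f (a # ys)" for e f
      proof (cases "e = a")
        case True
        then show ?thesis
          using that Cons.prems(4) h(2) s by (auto dest: before_in_set)
      next
        case False
        moreover have "f \<noteq> a"
          using that Cons.prems(4) False by (auto dest: before_in_set)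
        ultimately have "before e f (X @ Y)" "before e f ys"
          using that by (auto simp: xs)
        then show ?thesis
          using h(5) by simp
      qed
    qed
    then show "E (a # P @ c # d # Q) (a # P @ d # c # Q)"
      by simp
  qed
  ultimately show ?case
    using Cons.prems(2) by blast
qed


text \<open>Equational theories and \<open>deducible \<Sigma>\<close> have these closure properties.
  Substitutions may erase letters, which is how an identity in few letters is extracted from a long
  one.\<close>

locale fully_invariant_congruence =
  fixes R :: "mword \<Rightarrow> mword \<Rightarrow> bool"
  assumes refl [simp, intro]: "R u u"
    and sym: "R u v \<Longrightarrow> R v u"
    and trans [trans]: "R u v \<Longrightarrow> R v w \<Longrightarrow> R u w"
    and mult: "R u v \<Longrightarrow> R u' v' \<Longrightarrow> R (u @ u') (v @ v')"
    and subst: "R u v \<Longrightarrow> R (concat (map \<sigma> u)) (concat (map \<sigma> v))"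
begin

lemma ctx: "R u v \<Longrightarrow> R (P @ u @ Q) (P @ v @ Q)"
  by (intro mult refl)

lemma left: "R u v \<Longrightarrow> R (P @ u) (P @ v)"
  by (intro mult refl)

lemma right: "R u v \<Longrightarrow> R (u @ Q) (v @ Q)"
  by (intro mult refl)

lemma R_filter: "R u v \<Longrightarrow> R (filter P u) (filter P v)"
  using subst[of u v "\<lambda>x. if P x then [x] else []"] by (simp add: concat_filter)

lemma R_map: "R u v \<Longrightarrow> R (map f u) (map f v)"
  using subst[of u v "\<lambda>x. [f x]"] by (simp add: concat_singleton)

end


text \<open>
  In the identities below \<open>0\<close> and \<open>1\<close> are the letters that get exchanged or copied; \<open>2\<close>, \<open>3\<close>, \<open>4\<close>
  are simple letters, which stand for arbitrary separating words.
\<close>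

definition "id_triv = ([0] :: mword, [] :: mword)"
definition "id_idem = ([0] :: mword, [0, 0] :: mword)"
definition "id_comm = ([0, 1] :: mword, [1, 0] :: mword)"
definition "id_commute = ([0, 2, 1, 3, 0, 1] :: mword, [0, 2, 1, 3, 1, 0] :: mword)"
definition "id_absorb_right = ([0, 2, 0, 0] :: mword, [0, 2, 0] :: mword)"
definition "id_absorb_left = ([0, 0, 2, 0] :: mword, [0, 2, 0] :: mword)"
definition "id_copy = ([0, 2, 1, 0, 3, 1] :: mword, [0, 2, 0, 1, 0, 3, 1] :: mword)"
definition "id_alternate = ([0, 1, 0, 1] :: mword, [1, 0, 1, 0] :: mword)"
definition "id_swap = ([0, 2, 0, 1, 3, 0, 4, 1] :: mword, [0, 2, 1, 0, 3, 0, 4, 1] :: mword)"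
text \<open>The letters \<open>0\<close>, \<open>1\<close>, \<open>2\<close> are \<open>y\<close>,
  \<open>x\<close>, \<open>t\<close> of the critical identity \<open>yxxty \<approx> xyxty\<close>.
  Of the remaining identities, \<open>id_kappa\<close> performs the same exchange without a later
  \<open>y\<close>, \<open>id_mu\<close> deletes a middle occurrence, and \<open>id_E\<close>,
  \<open>id_E'\<close> move a last or a first occurrence across a simple letter.\<close>

definition "id_phi = ([0, 1, 1, 2, 0] :: mword, [1, 0, 1, 2, 0] :: mword)"
definition "id_kappa = ([0, 0, 1, 1] :: mword, [1, 0, 1, 0] :: mword)"
definition "id_mu = ([0, 2, 0, 3, 0] :: mword, [0, 2, 3, 0] :: mword)"
definition "id_E = ([0, 0, 2] :: mword, [0, 2, 0] :: mword)"
definition "id_E' = ([2, 0, 0] :: mword, [0, 2, 0] :: mword)"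

text \<open>The two axioms are mirror images of each other and hold in the product, so the results
  below apply to every congruence above its theory, before it is known on which side an identity
  fails. Erasing \<open>2\<close> gives \<open>xxx \<approx> xx\<close>.\<close>

locale square_congruence = fully_invariant_congruence +
  assumes R_absorb_right: "R (fst id_absorb_right) (snd id_absorb_right)" and R_absorb_left: "R (fst id_absorb_left) (snd id_absorb_left)"
begin

lemma dup_right:
  assumes "x \<in> set P" shows "R (P @ x # x # Q) (P @ x # Q)"
proof -
  obtain A B where P: "P = A @ x # B"
    using assms split_list by metis
  have "R (x # B @ [x, x]) (x # B @ [x])"
    using subst[OF R_absorb_right, of "(!) [[x], [], B]"] by (simp add: id_absorb_right_def)
  from ctx[OF this, of A Q] show ?thesis
    by (simp add: P)
qed

lemma dup_left:
  assumes "x \<in> set Q" shows "R (P @ x # x # Q) (P @ x # Q)"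
proof -
  obtain A B where Q: "Q = A @ x # B"
    using assms split_list by metis
  have "R (x # x # A @ [x]) (x # A @ [x])"
    using subst[OF R_absorb_left, of "(!) [[x], [], A]"] by (simp add: id_absorb_left_def)
  from ctx[OF this, of P B] show ?thesis
    by (simp add: Q)
qed

lemma replicate_in:
  assumes "x \<in> set P \<union> set Q"
  shows "R (P @ replicate (Suc n) x @ Q) (P @ x # Q)"
proof (induction n)
  case (Suc n)
  have "R (P @ x # x # replicate n x @ Q) (P @ x # replicate n x @ Q)"
    using assms by (cases "x \<in> set P") (auto intro: dup_left dup_right)
  moreover have "R (P @ x # replicate n x @ Q) (P @ x # Q)"
    using Suc by simp
  ultimately have "R (P @ x # x # replicate n x @ Q) (P @ x # Q)"
    by (rule trans)
  then show ?case
    by simp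
qed simp

lemma replicate_square: "R (P @ replicate (Suc (Suc n)) x @ Q) (P @ [x, x] @ Q)"
  using replicate_in[of x "P @ [x]" Q n] by simp

text \<open>Otherwise deleting all letters but a missing \<open>x\<close> leaves
  \<open>x^k \<approx> 1\<close> with \<open>k > 0\<close>. As \<open>x^2 \<approx> x^3\<close>,
  multiplication by \<open>x\<close> collapses this to \<open>x \<approx> 1\<close>.\<close>

lemma R_dest_content:
  assumes "\<not> R (fst id_triv) (snd id_triv)" "R u v"
  shows "set u = set v"
proof -
  have "set u \<subseteq> set v" if uv: "R u v" for u v
  proof
    fix x assume x: "x \<in> set u"
    show "x \<in> set v"
    proof (rule ccontr)
      assume "x \<notin> set v"
      then have "filter (\<lambda>z. z = x) v = []"
        by (auto simp: filter_empty_conv)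
      moreover obtain k where "filter (\<lambda>z. z = x) u = replicate (Suc k) x"
      proof -
        have "length (filter (\<lambda>z. z = x) u) \<noteq> 0"
          using x by (auto simp: filter_empty_conv)
        then show thesis
          using that filter_eq_replicate[of x u] not0_implies_Suc by metis
      qed
      ultimately have "R (replicate (Suc k) x) []"
        using R_filter[OF uv, of "\<lambda>z. z = x"] by simp
      from R_map[OF this, of "\<lambda>_. 0"] have *: "R (replicate (Suc k) 0) []"
        by (simp add: map_replicate_const)
      have **: "R (0 # replicate (Suc k) 0) [0]"
        using left[OF *, of "[0]"] by simp
      have "R [0::nat] []"
      proof (cases k)
        case 0
        then show ?thesis using * by simp
      next
        case (Suc n)
        have "R [0] (0 # replicate (Suc k) 0)"
          using ** by (rule sym)
        also have "R \<dots> [0, 0]"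
          using replicate_square[of "[]" k 0 "[]"] by simp
        also have "R \<dots> (replicate (Suc k) 0)"
          using replicate_square[of "[]" n 0 "[]"] by (simp add: Suc sym)
        also note *
        finally show ?thesis .
      qed
      then show False
        using assms(1) by (simp add: id_triv_def)
    qed
  qed
  then show ?thesis
    using assms(2) sym by blast
qed

lemma R_dest_simple:
  assumes "\<not> R (fst id_triv) (snd id_triv)" "\<not> R (fst id_idem) (snd id_idem)" "R u v"
  shows "before x x u = before x x v"
proof -
  have *: "before x x v" if uv: "R u v" "before x x u" for u v
  proof (rule ccontr)
    assume h: "\<not> before x x v"
    have "x \<in> set v"
      using R_dest_content[OF assms(1) uv(1)] uv(2) by (auto dest: before_in_set)
    then obtain a b where ab: "v = a @ x # b" "x \<notin> set a" "x \<notin> set b"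
      using simple_split h by metis
    then have "filter (\<lambda>z. z = x) a = []" "filter (\<lambda>z. z = x) b = []"
      by (auto simp: filter_empty_conv)
    then have v: "filter (\<lambda>z. z = x) v = [x]"
      by (simp add: ab)
    obtain a b where "u = a @ x # b" "x \<in> set b"
      using before_split[OF uv(2)] by blast
    then have "length (filter (\<lambda>z. z = x) u) \<ge> 2"
      by (auto simp: in_set_conv_decomp)
    then obtain k where "length (filter (\<lambda>z. z = x) u) = 2 + k"
      using le_Suc_ex by blast
    then have "length (filter (\<lambda>z. z = x) u) = Suc (Suc k)"
      by simp
    then have "R (replicate (Suc (Suc k)) x) [x]"
      using R_filter[OF uv(1), of "\<lambda>z. z = x"] v filter_eq_replicate by metis
    from R_map[OF this, of "\<lambda>_. 0"] have "R (replicate (Suc (Suc k)) 0) [0]"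
      by (simp add: map_replicate_const)
    moreover have "R (replicate (Suc (Suc k)) 0) [0, 0]"
      using replicate_square[of "[]" k 0 "[]"] by simp
    ultimately have "R [0] [0, 0]"
      using sym trans by blast
    then show False
      using assms(2) by (simp add: id_idem_def)
  qed
  then show ?thesis
    using assms(3) sym by blast
qed

lemma R_dest_order:
  assumes "\<not> R (fst id_comm) (snd id_comm)" "R u v" "s \<noteq> t"
    "before s t u" "\<not> before s s u" "\<not> before t t u"
    "before t s v" "\<not> before s s v" "\<not> before t t v"
  shows False
proof -
  have *: "filter (\<lambda>z. z = s \<or> z = t) w = [s, t]"
    if st: "s \<noteq> t" "before s t w" "\<not> before s s w" "\<not> before t t w" for w and s t :: nat
  proof -
    obtain a b where ab: "w = a @ s # b" "s \<notin> set a" "t \<in> set b"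
      using before_split[OF st(2)] by blast
    have b: "s \<notin> set b" "t \<notin> set a" "\<not> before t t b"
      using st(3,4) unfolding ab(1) using ab(3) by auto
    obtain c d where "b = c @ t # d" "t \<notin> set c" "t \<notin> set d"
      using simple_split[OF ab(3) b(3)] by metis
    moreover have "filter (\<lambda>z. z = s \<or> z = t) l = []" if "s \<notin> set l" "t \<notin> set l" for l
      using that by (auto simp: filter_empty_conv)
    ultimately show ?thesis
      using ab b by simp
  qed
  have "filter (\<lambda>z. z = s \<or> z = t) u = [s, t]"
    using * assms by blast
  moreover have "filter (\<lambda>z. z = s \<or> z = t) v = [t, s]"
    using *[of t s v] assms by (simp add: disj_commute)
  ultimately have "R [s, t] [t, s]"
    using R_filter[OF assms(2), of "\<lambda>z. z = s \<or> z = t"] by simp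
  from R_map[OF this, of "\<lambda>z. if z = s then 0 else 1"] show False
    using assms(1,3) by (simp add: id_comm_def)
qed

text \<open>If \<open>y\<close> occurred between the simple letters \<open>s\<close> and
  \<open>t\<close> on one side only, deleting all other letters would leave powers of
  \<open>y\<close> around \<open>s\<close> and \<open>t\<close>, and these reduce to
  \<open>ysyty \<approx> ysty\<close>.\<close>

lemma R_dest_between:
  assumes mu: "\<not> R (fst id_mu) (snd id_mu)"
    and R: "R (u1 @ s # u2 @ t # u3) (v1 @ s # v2 @ t # v3)"
    and st: "s \<noteq> t" "s \<notin> set (u1 @ u2 @ u3 @ v1 @ v2 @ v3)" "t \<notin> set (u1 @ u2 @ u3 @ v1 @ v2 @ v3)"
  shows "set u2 - {s, t} = set v2 - {s, t}"
proof -
  have *: "y \<in> set v2"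
    if R: "R (u1 @ s # u2 @ t # u3) (v1 @ s # v2 @ t # v3)"
    and st: "s \<noteq> t" "s \<notin> set (u1 @ u2 @ u3 @ v1 @ v2 @ v3)" "t \<notin> set (u1 @ u2 @ u3 @ v1 @ v2 @ v3)"
    and y: "y \<in> set u2" for y s t and u1 u2 u3 v1 v2 v3 :: mword
  proof (rule ccontr)
    assume n: "y \<notin> set v2"
    have yst: "y \<noteq> s" "y \<noteq> t"
      using st y by auto
    let ?F = "filter (\<lambda>z. z = y \<or> z = s \<or> z = t)"
    have F: "?F w = replicate (length (filter (\<lambda>z. z = y) w)) y"
      if "s \<notin> set w" "t \<notin> set w" for w
      using that by (induction w) auto
    obtain b where b: "?F u2 = replicate (Suc b) y"
    proof -
      have "filter (\<lambda>z. z = y) u2 \<noteq> []"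
        using y by (auto simp: filter_empty_conv)
      then obtain b where "length (filter (\<lambda>z. z = y) u2) = Suc b"
        by (metis length_0_conv not0_implies_Suc)
      then show thesis
        using F[of u2] st that by auto
    qed
    have v2: "?F v2 = []"
      using n st by (auto simp: filter_empty_conv)
    obtain a c a' c' where "?F u1 = replicate a y" "?F u3 = replicate c y"
      "?F v1 = replicate a' y" "?F v3 = replicate c' y"
      by (rule that[OF F F F F]) (use st in auto)
    then have "R (replicate a y @ s # replicate (Suc b) y @ t # replicate c y)
        (replicate a' y @ s # t # replicate c' y)"
      using R_filter[OF R, of "\<lambda>z. z = y \<or> z = s \<or> z = t"] b v2 by simp
    \<comment> \<open>The outer powers may be empty; a \<open>y\<close> added at both ends makes
      them positive, so that each power shrinks to a single \<open>y\<close>.\<close>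
    from ctx[OF this, of "[y]" "[y]"]
    have "R (replicate (Suc a) y @ s # replicate (Suc b) y @ t # replicate (Suc c) y)
        (replicate (Suc a') y @ s # t # replicate (Suc c') y)"
      by (simp add: replicate_append_same)
    moreover have "R (replicate (Suc a) y @ s # replicate (Suc b) y @ t # replicate (Suc c) y) [y, s, y, t, y]"
    proof -
      have "R (replicate (Suc a) y @ s # replicate (Suc b) y @ t # replicate (Suc c) y)
          (y # s # replicate (Suc b) y @ t # replicate (Suc c) y)"
        using replicate_in[of y "[]" "s # replicate (Suc b) y @ t # replicate (Suc c) y" a] by simp
      also have "R \<dots> (y # s # y # t # replicate (Suc c) y)"
        using replicate_in[of y "[y, s]" "t # replicate (Suc c) y" b] by simp
      also have "R \<dots> [y, s, y, t, y]"
        using replicate_in[of y "[y, s, y, t]" "[]" c] by simp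
      finally show ?thesis .
    qed
    moreover have "R (replicate (Suc a') y @ s # t # replicate (Suc c') y) [y, s, t, y]"
    proof -
      have "R (replicate (Suc a') y @ s # t # replicate (Suc c') y) (y # s # t # replicate (Suc c') y)"
        using replicate_in[of y "[]" "s # t # replicate (Suc c') y" a'] by simp
      also have "R \<dots> [y, s, t, y]"
        using replicate_in[of y "[y, s, t]" "[]" c'] by simp
      finally show ?thesis .
    qed
    ultimately have "R [y, s, y, t, y] [y, s, t, y]"
      using sym trans by blast
    from R_map[OF this, of "\<lambda>z. if z = y then 0 else if z = s then 2 else 3"] show False
      using mu yst st(1) by (simp add: id_mu_def)
  qed
  have "y \<in> set v2" if "y \<in> set u2" for y
    using *[OF R st that] .
  moreover have "y \<in> set u2" if "y \<in> set v2" for y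
  proof -
    have "s \<notin> set (v1 @ v2 @ v3 @ u1 @ u2 @ u3)" "t \<notin> set (v1 @ v2 @ v3 @ u1 @ u2 @ u3)"
      using st by auto
    from *[OF sym[OF R] st(1) this that] show ?thesis .
  qed
  ultimately show ?thesis
    by blast
qed

end


section \<open>Rewriting modulo the identities of \<open>A\<^sup>1\<close>\<close>

text \<open>
  \<open>(True, x)\<close> marks the first occurrence of \<open>x\<close>, counted from the beginning of the whole word (\<open>C\<close>
  is the content of what precedes the block), \<open>(False, y)\<close> the last occurrence of \<open>y\<close> in the block.
\<close>

primrec block_symbols :: "nat set \<Rightarrow> mword \<Rightarrow> (bool \<times> nat) list" where
  "block_symbols C [] = []"
| "block_symbols C (y # w) = (if y \<in> C then [] else [(True, y)]) @
     (if y \<in> set w then [] else [(False, y)]) @ block_symbols (insert y C) w"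

lemma set_block_symbols:
  "set (block_symbols C w) = {(True, x) |x. x \<in> set w - C} \<union> {(False, y) |y. y \<in> set w}"
  by (induction w arbitrary: C) auto

lemma distinct_block_symbols: "distinct (block_symbols C w)"
  by (induction w arbitrary: C) (auto simp: set_block_symbols)

lemma before_block_symbols:
  "before (True, x) (False, y) (block_symbols C w) \<longleftrightarrow>
     x \<notin> C \<and> (before x y w \<or> x = y \<and> x \<in> set w)"
  by (induction w arbitrary: C) (auto simp: set_block_symbols dest: before_in_set)

text \<open>Together with the two absorption laws these are six identities, chosen so that a
  congruence above the theory of the product satisfies them as soon as it contains the reverse of
  \<open>id_phi\<close>.\<close>

locale A_congruence = square_congruence +
  assumes R_commute: "R (fst id_commute) (snd id_commute)" and R_copy: "R (fst id_copy) (snd id_copy)"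
    and R_alternate: "R (fst id_alternate) (snd id_alternate)" and R_swap: "R (fst id_swap) (snd id_swap)"
begin

lemma swap_nonfirst:
  assumes "x \<in> set P" "y \<in> set P"
  shows "R (P @ x # y # Q) (P @ y # x # Q)"
proof -
  have *: "R (P @ x # y # Q) (P @ y # x # Q)" if xy: "before x y P" for x y
  proof -
    obtain A B where P: "P = A @ x # B" "y \<in> set B"
      using before_split[OF xy] by blast
    then obtain C D where B: "B = C @ y # D"
      using split_list by metis
    have "R (x # C @ y # D @ [x, y]) (x # C @ y # D @ [y, x])"
      using subst[OF R_commute, of "(!) [[x], [y], C, D]"] by (simp add: id_commute_def)
    from ctx[OF this, of A Q] show ?thesis
      by (simp add: P B)
  qed
  show ?thesis
    using assms *[of x y] sym[OF *[of y x]] before_total[of x P y] by (cases "x = y") auto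
qed

lemma copy_over_letter:
  assumes "y \<in> set P" "z \<in> set P \<or> z \<in> set Q \<or> z = y"
  shows "R (P @ z # y # Q) (P @ y # z # y # Q)"
proof (cases "z \<in> set P")
  case True
  have "R (P @ z # y # Q) (P @ z # y # y # Q)"
    using sym[OF dup_right[of y "P @ [z]" Q]] assms by simp
  also have "R \<dots> (P @ y # z # y # Q)"
    using swap_nonfirst[of z P y "y # Q"] True assms by simp
  finally show ?thesis .
next
  case False
  then have "z \<noteq> y" "z \<in> set Q"
    using assms by auto
  obtain A B where P: "P = A @ y # B"
    using assms split_list by metis
  obtain C D where Q: "Q = C @ z # D"
    using \<open>z \<in> set Q\<close> split_list by metis
  have "R (y # B @ z # y # C @ [z]) (y # B @ y # z # y # C @ [z])"
    using subst[OF R_copy, of "(!) [[y], [z], B, C]"] by (simp add: id_copy_def)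
  from ctx[OF this, of A D] show ?thesis
    by (simp add: P Q)
qed

text \<open>Once \<open>y\<close> has occurred, only its last occurrence counts in a stretch
  \<open>A\<close> without simple letters: further copies can be created or absorbed anywhere in
  front of it.\<close>

lemma copy_over_word:
  assumes "y \<in> set P" "\<And>z. z \<in> set A \<Longrightarrow> before z z (P @ A @ y # Q)"
  shows "R (P @ A @ y # Q) (P @ y # A @ y # Q)"
  using assms
proof (induction A arbitrary: P)
  case Nil
  then show ?case
    using dup_right sym by simp
next
  case (Cons a A)
  have "before z z ((P @ [a]) @ A @ y # Q)" if "z \<in> set A" for z
    using Cons.prems(2)[of z] that by simp
  then have "R (P @ a # A @ y # Q) (P @ a # y # A @ y # Q)"
    using Cons.IH[of "P @ [a]"] Cons.prems(1) by simp
  also have "R \<dots> (P @ y # a # y # A @ y # Q)"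
    using copy_over_letter[of y P a "A @ y # Q"] Cons.prems(1) Cons.prems(2)[of a]
    by (auto dest: before_in_set)
  \<comment> \<open>The auxiliary \<open>y\<close> behind \<open>a\<close> has done its work and is
    absorbed by the induction hypothesis, read backwards.\<close>
  also have "R \<dots> (P @ y # a # A @ y # Q)"
  proof -
    have "before z z ((P @ [y, a]) @ A @ y # Q)" if "z \<in> set A" for z
      using Cons.prems(2)[of z] that by auto
    then show ?thesis
      using Cons.IH[of "P @ [y, a]"] sym by simp
  qed
  finally show ?case
    by simp
qed

text \<open>An occurrence that is neither the first in the word nor the last in the block is
  absorbed by \<open>copy_over_word\<close>. A letter whose only occurrence in the block is also its
  first in the word yields two symbols; it may be doubled because it occurs again in
  \<open>S\<close>.\<close>

lemma R_block_symbols: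
  assumes "\<And>z. z \<in> set w \<Longrightarrow> z \<in> set P \<or> z \<in> set S \<or> before z z w"
  shows "R (P @ w @ S) (P @ map snd (block_symbols (set P) w) @ S)"
  using assms
proof (induction w arbitrary: P)
  case (Cons y w)
  have cond: "z \<in> set (P @ [y]) \<or> z \<in> set S \<or> before z z w" if "z \<in> set w" for z
    using Cons.prems[of z] that by auto
  show ?case
  proof (cases "y \<in> set P")
    case y: True
    then have ins: "insert y (set P) = set P"
      by blast
    show ?thesis
    proof (cases "y \<in> set w")
      case True
      then obtain A B where w: "w = A @ y # B"
        using split_list by metis
      have "R (P @ y # w @ S) (P @ w @ S)"
      proof -
        have "before z z (P @ A @ y # B @ S)" if "z \<in> set A" for z
          using cond[of z] that y by (auto simp: w)
        then show ?thesis
          using copy_over_word[of y P A "B @ S"] y sym by (simp add: w)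
      qed
      also have "R (P @ w @ S) (P @ map snd (block_symbols (set P) w) @ S)"
        using cond y by (intro Cons.IH) auto
      finally show ?thesis
        using True y by (simp add: ins)
    next
      case False
      have "R ((P @ [y]) @ w @ S) ((P @ [y]) @ map snd (block_symbols (set (P @ [y])) w) @ S)"
        using cond by (intro Cons.IH)
      then show ?thesis
        using False y by (simp add: ins)
    qed
  next
    case y: False
    show ?thesis
    proof (cases "y \<in> set w")
      case True
      have "R ((P @ [y]) @ w @ S) ((P @ [y]) @ map snd (block_symbols (set (P @ [y])) w) @ S)"
        using cond by (intro Cons.IH)
      then show ?thesis
        using True y by simp
    next
      case False
      then have "y \<in> set S"
        using Cons.prems[of y] y by (auto dest: before_in_set)
      then have "R (P @ y # w @ S) ((P @ [y, y]) @ w @ S)"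
        using dup_left sym by simp
      also have "R ((P @ [y, y]) @ w @ S) ((P @ [y, y]) @ map snd (block_symbols (set (P @ [y, y])) w) @ S)"
        using cond by (intro Cons.IH) auto
      finally show ?thesis
        using False y by simp
    qed
  qed
qed simp

text \<open>The later occurrences in \<open>Q\<close> allow \<open>xy\<close> to be expanded to
  \<open>xyxy\<close>. Then \<open>id_alternate\<close> reverses the first occurrences, and the
  other copies, being non-first, commute and are absorbed.\<close>

lemma swap_first:
  assumes "x \<in> set Q" "y \<in> set Q"
    "\<And>z. z \<in> set Q \<Longrightarrow> before z z (P @ x # y # Q)"
  shows "R (P @ x # y # Q @ S) (P @ y # x # Q @ S)"
proof -
  have ins: "R (P' @ A @ Q @ S) (P' @ A @ x # y # Q @ S)"
    if A: "x \<in> set A" "y \<in> set A" and multi: "\<And>z. z \<in> set Q \<Longrightarrow> before z z (P' @ A @ Q)"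
    for P' A
  proof -
    obtain B C where Q: "Q = B @ y # C"
      using assms(2) split_list by metis
    obtain D E where Q': "Q = D @ x # E"
      using assms(1) split_list by metis
    have "R ((P' @ A) @ B @ y # C @ S) ((P' @ A) @ y # B @ y # C @ S)"
    proof (rule copy_over_word)
      show "before z z ((P' @ A) @ B @ y # C @ S)" if "z \<in> set B" for z
        using multi[of z] that by (auto simp: Q)
    qed (use A in simp)
    then have 1: "R (P' @ A @ Q @ S) (P' @ A @ y # Q @ S)"
      by (simp add: Q)
    have "R ((P' @ A) @ (y # D) @ x # E @ S) ((P' @ A) @ x # (y # D) @ x # E @ S)"
    proof (rule copy_over_word)
      show "before z z ((P' @ A) @ (y # D) @ x # E @ S)" if "z \<in> set (y # D)" for z
        using multi[of z] that A by (auto simp: Q')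
    qed (use A in simp)
    then have "R (P' @ A @ y # Q @ S) (P' @ A @ x # y # Q @ S)"
      by (simp add: Q')
    with 1 show ?thesis
      by (rule trans)
  qed
  have "R (P @ x # y # Q @ S) (P @ [x, y, x, y] @ Q @ S)"
    using ins[of "[x, y]" P] assms(3) by simp
  also have "R \<dots> (P @ [y, x, y, x] @ Q @ S)"
    using subst[OF R_alternate, of "(!) [[x], [y]]"] by (intro ctx) (simp add: id_alternate_def)
  also have "R \<dots> (P @ [y, x] @ [x, y] @ Q @ S)"
    using swap_nonfirst[of y "P @ [y, x]" x "Q @ S"] by simp
  also have "R \<dots> (P @ y # x # Q @ S)"
  proof -
    have "before z z (P @ [y, x] @ Q)" if "z \<in> set Q" for z
      using assms(3)[OF that] assms(1,2) by auto
    then show ?thesis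
      using ins[of "[y, x]" P] sym by simp
  qed
  finally show ?thesis .
qed

text \<open>
  Within a block of repeated letters only the mutual position of the first occurrence of a
  letter and the last occurrence (in the block) of another one matters.
\<close>

lemma block_eq:
  assumes sets: "set v = set w"
    and v: "\<And>z. z \<in> set v \<Longrightarrow> z \<in> set P \<or> z \<in> set S \<or> before z z v"
    and w: "\<And>z. z \<in> set w \<Longrightarrow> z \<in> set P \<or> z \<in> set S \<or> before z z w"
    and swap: "\<And>x y P' Q'. \<lbrakk>x \<in> set w - set P; y \<in> set w; x \<noteq> y; before x y v \<noteq> before x y w;
        y \<in> set P'; x \<in> set Q'\<rbrakk>
        \<Longrightarrow> R (P' @ x # y # Q' @ S) (P' @ y # x # Q' @ S)"
  shows "R (P @ v @ S) (P @ w @ S)"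
proof -
  let ?v = "block_symbols (set P) v" and ?w = "block_symbols (set P) w"
  have set_eq: "set ?v = set ?w"
    by (simp add: set_block_symbols sets)
  have "R (P @ map snd ?v @ S) (P @ map snd ?w @ S)"
  proof (rule adjacent_swaps[of "\<lambda>u u'. R (P @ map snd u @ S) (P @ map snd u' @ S)" ?v ?w])
    show "distinct ?v" "distinct ?w"
      by (simp_all add: distinct_block_symbols)
    fix A B a b
    assume d: "distinct (A @ a # b # B)" and s: "set (A @ a # b # B) = set ?v"
      and ab: "before a b ?v" "before b a ?w"
      and ord: "\<And>c d. before c d ?v \<Longrightarrow> before c d ?w \<Longrightarrow> before c d (A @ a # b # B)"
    \<comment> \<open>For a letter new to the word, the first symbol precedes the last one in both
      lists, hence in every intermediate list. This yields the context conditions of the exchanges: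
      a last symbol of \<open>y\<close> has a \<open>y\<close> on its left, a first symbol of
      \<open>x\<close> has an \<open>x\<close> on its right.\<close>
    have fl: "before (True, z) (False, z) (A @ a # b # B)" if "z \<in> set w" "z \<notin> set P" for z
      using that sets by (intro ord) (auto simp: before_block_symbols)
    have in_ab: "snd a \<in> set w" "snd b \<in> set w"
    proof -
      have "a \<in> set ?v" "b \<in> set ?v"
        unfolding s[symmetric] by simp_all
      then show "snd a \<in> set w" "snd b \<in> set w"
        by (auto simp: set_block_symbols sets)
    qed
    have nonfirst: "y \<in> set (P @ map snd A)"
      if y: "y \<in> set w" "(a = (False, y) \<or> b = (False, y) \<and> a \<noteq> (True, y))" for y
    proof (cases "y \<in> set P")
      case False
      have "(True, y) \<in> set A"
        using fl[OF y(1) False] y(2) d by (auto dest: before_in_set)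
      then show ?thesis
        by force
    qed simp
    have later: "x \<in> set (map snd B)"
      if x: "x \<in> set w" "x \<notin> set P" "(b = (True, x) \<or> a = (True, x) \<and> b \<noteq> (False, x))" for x
    proof -
      have "(False, x) \<in> set B"
        using fl[OF x(1,2)] x(3) d by (auto dest: before_in_set)
      then show ?thesis
        by force
    qed
    have nP: "x \<notin> set P" if "(True, x) \<in> set (A @ a # b # B)" for x
      using that unfolding s by (simp add: set_block_symbols)
    have "R ((P @ map snd A) @ snd a # snd b # map snd B @ S)
        ((P @ map snd A) @ snd b # snd a # map snd B @ S)"
    \<comment> \<open>Two last symbols are non-first occurrences, and two first symbols are covered
      by \<open>swap_first\<close>; mixed pairs are what the hypothesis \<open>swap\<close> is
      for.\<close>
    proof (cases "fst a"; cases "fst b")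
      assume "\<not> fst a" "\<not> fst b"
      then obtain x y where xy: "a = (False, x)" "b = (False, y)"
        by (metis prod.collapse)
      then show ?thesis
        using nonfirst[of x] nonfirst[of y] in_ab by (intro swap_nonfirst) auto
    next
      assume "fst a" "fst b"
      then obtain x y where xy: "a = (True, x)" "b = (True, y)"
        by (metis prod.collapse)
      have n: "x \<notin> set P" "y \<notin> set P"
        using nP xy by auto
      have "R ((P @ map snd A) @ x # y # map snd B @ S) ((P @ map snd A) @ y # x # map snd B @ S)"
      proof (rule swap_first)
        show "x \<in> set (map snd B)" "y \<in> set (map snd B)"
          using later[of x] later[of y] xy n in_ab by auto
        show "before z z ((P @ map snd A) @ x # y # map snd B)" if "z \<in> set (map snd B)" for z
        proof (cases "z \<in> set P")
          case False
          have "\<exists>c. (c, z) \<in> set (A @ a # b # B)"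
            using that \<open>z \<in> set (map snd B)\<close> by fastforce
          then have "z \<in> set w"
            unfolding s by (auto simp: set_block_symbols sets)
          from before_map[OF fl[OF this False], of snd] show ?thesis
            by (simp add: xy)
        qed (use that in simp)
      qed
      then show ?thesis
        by (simp add: xy)
    next
      assume "fst a" "\<not> fst b"
      then obtain x y where xy: "a = (True, x)" "b = (False, y)"
        by (metis prod.collapse)
      have n: "x \<notin> set P"
        using nP xy by auto
      have bw: "\<not> before a b ?w"
        using before_asym[OF distinct_block_symbols ab(2)] .
      have ne: "x \<noteq> y"
        using bw in_ab n unfolding xy before_block_symbols by auto
      moreover have "before x y v \<noteq> before x y w"
        using ab(1) bw n ne unfolding xy before_block_symbols by simp
      ultimately show ?thesis
        using swap[of x y "P @ map snd A" "map snd B"] nonfirst[of y] later[of x] in_ab n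
        unfolding xy by simp
    next
      assume "\<not> fst a" "fst b"
      then obtain x y where xy: "a = (False, y)" "b = (True, x)"
        by (metis prod.collapse)
      have n: "x \<notin> set P"
        using nP xy by auto
      have bv: "\<not> before b a ?v"
        using before_asym[OF distinct_block_symbols ab(1)] .
      have ne: "x \<noteq> y"
        using bv in_ab n sets unfolding xy before_block_symbols by auto
      moreover have "before x y v \<noteq> before x y w"
        using ab(2) bv n ne unfolding xy before_block_symbols by simp
      ultimately show ?thesis
        using sym[OF swap[of x y "P @ map snd A" "map snd B"]] nonfirst[of y] later[of x] in_ab n
        unfolding xy by simp
    qed
    then show "R (P @ map snd (A @ a # b # B) @ S) (P @ map snd (A @ b # a # B) @ S)"
      by simp
  qed (use set_eq trans in auto)
  moreover have "R (P @ v @ S) (P @ map snd ?v @ S)"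
    using v by (rule R_block_symbols)
  moreover have "R (P @ w @ S) (P @ map snd ?w @ S)"
    using w by (rule R_block_symbols)
  ultimately show ?thesis
    using sym trans by blast
qed

text \<open>The padding by \<open>yy\<close> and \<open>xx\<close> makes every order except that of
  \<open>x\<close> before \<open>y\<close> hold on both sides. So \<open>block_eq\<close> turns them
  into \<open>yyxx\<close> and \<open>xyxy\<close>, its exchange hypothesis being vacuous.\<close>

lemma R_dest_kappa:
  assumes R: "R u w" and xy: "set u = {x, y}" "set w = {x, y}" "x \<noteq> y" "\<not> before x y u" "before x y w"
  shows "R (fst id_kappa) (snd id_kappa)"
proof -
  have 1: "R ([] @ ([y, y] @ u @ [x, x]) @ []) ([] @ [y, y, x, x] @ [])"
    by (rule block_eq) (use xy in auto)
  have 2: "R ([] @ ([y, y] @ w @ [x, x]) @ []) ([] @ [x, y, x, y] @ [])"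
    by (rule block_eq) (use xy in auto)
  have "R [y, y, x, x] ([y, y] @ u @ [x, x])"
    using sym[OF 1] by simp
  also have "R \<dots> ([y, y] @ w @ [x, x])"
    using R by (rule ctx)
  also have "R \<dots> [x, y, x, y]"
    using 2 by simp
  finally have "R [y, y, x, x] [x, y, x, y]" .
  from R_map[OF this, of "\<lambda>z. if z = y then 0 else 1"] show ?thesis
    using xy(3) by (simp add: id_kappa_def)
qed

text \<open>The same normalisation in front of a separator \<open>t\<close>, behind which only
  \<open>y\<close> is left: with \<open>yy\<close> added in front, the two blocks become
  \<open>yxx\<close> and \<open>xyx\<close>.\<close>

lemma R_dest_phi:
  assumes R: "R (u @ t # replicate (Suc m) y) (w @ t # replicate (Suc n) y)"
    and xyt: "x \<noteq> y" "t \<noteq> x" "t \<noteq> y"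
    and u: "set u \<subseteq> {x, y}" "\<not> before x y u" "before x x u"
    and w: "set w \<subseteq> {x, y}" "before x y w" "before x x w"
  shows "R (fst id_phi) (snd id_phi)"
proof -
  let ?S = "t # [y]"
  have xw: "x \<in> set u" "x \<in> set w"
    using u w before_in_set by fast+
  have 1: "R ([] @ ([y, y] @ u) @ ?S) ([] @ [y, x, x] @ ?S)"
    by (rule block_eq) (use u xyt xw in auto)
  have 2: "R ([] @ ([y, y] @ w) @ ?S) ([] @ [x, y, x] @ ?S)"
    by (rule block_eq) (use w xyt xw in auto)
  have short: "R (([y, y] @ v) @ t # replicate (Suc k) y) (([y, y] @ v) @ ?S)" for v k
    using replicate_in[of y "[y, y] @ v @ [t]" "[]" k] by simp
  have "R ([y, x, x] @ ?S) (([y, y] @ u) @ ?S)"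
    using sym[OF 1] by simp
  also have "R \<dots> (([y, y] @ u) @ t # replicate (Suc m) y)"
    using short by (rule sym)
  also have "R \<dots> (([y, y] @ w) @ t # replicate (Suc n) y)"
    using left[OF R, of "[y, y]"] by simp
  also note short
  also have "R (([y, y] @ w) @ ?S) ([x, y, x] @ ?S)"
    using 2 by simp
  finally have "R [y, x, x, t, y] [x, y, x, t, y]"
    by simp
  from R_map[OF this, of "\<lambda>z. if z = y then 0 else if z = x then 1 else 2"] show ?thesis
    using xyt by (simp add: id_phi_def)
qed

lemma swap_kappa:
  assumes "R (fst id_kappa) (snd id_kappa)" "y \<in> set P" "x \<in> set Q"
  shows "R (P @ x # y # Q) (P @ y # x # Q)"
proof -
  have "R (P @ y # x # Q) (P @ y # y # x # Q)"
    using sym[OF dup_right[of y P "x # Q"]] assms by simp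
  also have "R \<dots> (P @ y # y # x # x # Q)"
    using sym[OF dup_left[of x Q "P @ [y, y]"]] assms by simp
  also have "R \<dots> (P @ [x, y, x, y] @ Q)"
    using ctx[OF subst[OF assms(1), of "(!) [[y], [x]]"], of P Q] by (simp add: id_kappa_def)
  also have "R \<dots> (P @ x # x # y # y # Q)"
    using swap_nonfirst[of y "P @ [x]" x "y # Q"] assms by simp
  also have "R \<dots> (P @ x # y # y # Q)"
    using dup_left[of x "y # y # Q" P] assms by simp
  also have "R \<dots> (P @ x # y # Q)"
    using dup_right[of y "P @ [x]" Q] assms by simp
  finally show ?thesis
    using sym by blast
qed

lemma swap_phi:
  assumes "R (fst id_phi) (snd id_phi)" "y \<in> set P" "x \<in> set Q" "y \<in> set Q"
  shows "R (P @ x # y # Q) (P @ y # x # Q)"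
proof -
  obtain A B where Q: "Q = A @ y # B"
    using assms split_list by metis
  have "R (P @ y # x # Q) (P @ y # x # x # Q)"
    using sym[OF dup_left[of x Q "P @ [y]"]] assms by simp
  also have "R \<dots> (P @ [x, y, x] @ Q)"
    using ctx[OF subst[OF assms(1), of "(!) [[y], [x], A]"], of P B] by (simp add: id_phi_def Q)
  also have "R \<dots> (P @ x # x # y # Q)"
    using swap_nonfirst[of y "P @ [x]" x Q] assms by simp
  also have "R \<dots> (P @ x # y # Q)"
    using dup_left[of x "y # Q" P] assms by simp
  finally show ?thesis
    using sym by blast
qed

text \<open>An exchange available in every A-congruence: \<open>x\<close> recurs after the next
  \<open>y\<close>, so \<open>A^1\<close> cannot see the order of the two.\<close>

lemma swap_free:
  assumes "y \<in> set P" "x \<in> set B"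
  shows "R (P @ x # y # A @ y # B) (P @ y # x # A @ y # B)"
proof -
  obtain C D where P: "P = C @ y # D"
    using assms split_list by metis
  obtain E F where B: "B = E @ x # F"
    using assms split_list by metis
  have "R (y # D @ y # x # A @ y # E @ [x]) (y # D @ x # y # A @ y # E @ [x])"
    using subst[OF R_swap, of "(!) [[y], [x], D, A, E]"] by (simp add: id_swap_def)
  from sym[OF ctx[OF this, of C F]] show ?thesis
    by (simp add: P B)
qed

end


section \<open>Removing middle occurrences\<close>

datatype occurrence = First | Last | Simple

text \<open>Normal form for the case in which \<open>id_mu\<close> holds. \<open>C\<close> is the
  content of the text already passed, so occurrences are classified relative to the whole word and
  not to \<open>w\<close> alone.\<close>

primrec word_symbols :: "nat set \<Rightarrow> mword \<Rightarrow> (occurrence \<times> nat) list" where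
  "word_symbols C [] = []"
| "word_symbols C (x # w) =
     (if x \<in> set w then (if x \<in> C then [] else [(First, x)]) else [(if x \<in> C then Last else Simple, x)]) @
     word_symbols (insert x C) w"

lemma set_word_symbols:
  "set (word_symbols C w) = {(First, x) |x. x \<notin> C \<and> before x x w} \<union>
     {(Last, x) |x. x \<in> set w \<and> (x \<in> C \<or> before x x w)} \<union>
     {(Simple, x) |x. x \<in> set w \<and> x \<notin> C \<and> \<not> before x x w}"
  by (induction w arbitrary: C) (auto dest: before_in_set)

lemma distinct_word_symbols: "distinct (word_symbols C w)"
  by (induction w arbitrary: C) (auto simp: set_word_symbols)

lemma before_word_symbols_first_last:
  "before (First, x) (Last, y) (word_symbols C w) \<longleftrightarrow>
     x \<notin> C \<and> before x x w \<and> (y \<in> C \<or> before y y w) \<and> before x y w"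
  by (induction w arbitrary: C) (auto simp: set_word_symbols dest: before_in_set)

lemma before_word_symbols_first_simple:
  "before (First, x) (Simple, t) (word_symbols C w) \<longleftrightarrow>
     x \<notin> C \<and> before x x w \<and> t \<notin> C \<and> \<not> before t t w \<and> before x t w"
  by (induction w arbitrary: C) (auto simp: set_word_symbols dest: before_in_set)

lemma before_word_symbols_simple_last:
  "before (Simple, t) (Last, x) (word_symbols C w) \<longleftrightarrow>
     t \<notin> C \<and> \<not> before t t w \<and> (x \<in> C \<or> before x x w) \<and> before t x w"
  by (induction w arbitrary: C) (auto simp: set_word_symbols dest: before_in_set)

lemma before_word_symbols_simple:
  "before (Simple, s) (Simple, t) (word_symbols C w) \<longleftrightarrow>
     s \<notin> C \<and> \<not> before s s w \<and> t \<notin> C \<and> \<not> before t t w \<and> before s t w"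
  by (induction w arbitrary: C) (auto simp: set_word_symbols dest: before_in_set)

context square_congruence
begin

text \<open>The simple letter \<open>t\<close> has \<open>x\<close> only behind it on one side, and
  an \<open>x\<close> in front of it on the other. Deleting all other letters leaves powers of
  \<open>x\<close> around \<open>t\<close>, which reduce to
  \<open>txx \<approx> xtx\<close>.\<close>

lemma R_dest_E':
  assumes R: "R (u1 @ t # u2) (v1 @ t # v2)" and xt: "x \<noteq> t" "t \<notin> set (u1 @ u2 @ v1 @ v2)"
    and x: "x \<notin> set u1" "x \<in> set u2" "x \<in> set v1"
  shows "R (fst id_E') (snd id_E')"
proof -
  let ?F = "filter (\<lambda>z. z = x \<or> z = t)"
  have F: "?F w = replicate (length (filter (\<lambda>z. z = x) w)) x" if "t \<notin> set w" for w
    using that by (induction w) auto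
  have pos: "\<exists>k. length (filter (\<lambda>z. z = x) w) = Suc k" if "x \<in> set w" for w
  proof -
    have "length (filter (\<lambda>z. z = x) w) \<noteq> 0"
      using that by (auto simp: filter_empty_conv)
    then show ?thesis
      using not0_implies_Suc by blast
  qed
  have "?F u1 = []"
    using x xt by (auto simp: filter_empty_conv)
  moreover obtain k where "?F u2 = replicate (Suc k) x"
    using pos[OF x(2)] F[of u2] xt by auto
  moreover obtain a where "?F v1 = replicate (Suc a) x"
    using pos[OF x(3)] F[of v1] xt by auto
  moreover obtain b where "?F v2 = replicate b x"
    using F[of v2] xt by auto
  ultimately have "R (t # replicate (Suc k) x) (replicate (Suc a) x @ t # replicate b x)"
    using R_filter[OF R, of "\<lambda>z. z = x \<or> z = t"] by simp
  \<comment> \<open>\<open>v2\<close> may contain no \<open>x\<close>; the appended one ensures an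
    \<open>x\<close> behind \<open>t\<close> on both sides.\<close>
  from right[OF this, of "[x]"]
  have *: "R (t # replicate (Suc (Suc k)) x) (replicate (Suc a) x @ t # replicate (Suc b) x)"
    by (simp add: replicate_append_same)
  have "R [t, x, x] (t # replicate (Suc (Suc k)) x)"
    using sym[OF replicate_square[of "[t]" k x "[]"]] by simp
  also note *
  also have "R (replicate (Suc a) x @ t # replicate (Suc b) x) (x # t # replicate (Suc b) x)"
    using replicate_in[of x "[]" "t # replicate (Suc b) x" a] by simp
  also have "R \<dots> [x, t, x]"
    using replicate_in[of x "[x, t]" "[]" b] by simp
  finally have "R [t, x, x] [x, t, x]" .
  from R_map[OF this, of "\<lambda>z. if z = x then 0 else 2"] show ?thesis
    using xt by (simp add: id_E'_def)
qed

lemma R_dest_E: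
  assumes R: "R (u1 @ t # u2) (v1 @ t # v2)" and xt: "x \<noteq> t" "t \<notin> set (u1 @ u2 @ v1 @ v2)"
    and x: "x \<notin> set u2" "x \<in> set u1" "x \<in> set v2"
  shows "R (fst id_E) (snd id_E)"
proof -
  let ?F = "filter (\<lambda>z. z = x \<or> z = t)"
  have F: "?F w = replicate (length (filter (\<lambda>z. z = x) w)) x" if "t \<notin> set w" for w
    using that by (induction w) auto
  have pos: "\<exists>k. length (filter (\<lambda>z. z = x) w) = Suc k" if "x \<in> set w" for w
  proof -
    have "length (filter (\<lambda>z. z = x) w) \<noteq> 0"
      using that by (auto simp: filter_empty_conv)
    then show ?thesis
      using not0_implies_Suc by blast
  qed
  have "?F u2 = []"
    using x xt by (auto simp: filter_empty_conv)
  moreover obtain k where "?F u1 = replicate (Suc k) x"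
    using pos[OF x(2)] F[of u1] xt by auto
  moreover obtain a where "?F v2 = replicate (Suc a) x"
    using pos[OF x(3)] F[of v2] xt by auto
  moreover obtain b where "?F v1 = replicate b x"
    using F[of v1] xt by auto
  ultimately have "R (replicate (Suc k) x @ [t]) (replicate b x @ t # replicate (Suc a) x)"
    using R_filter[OF R, of "\<lambda>z. z = x \<or> z = t"] by simp
  from left[OF this, of "[x]"]
  have *: "R (replicate (Suc (Suc k)) x @ [t]) (replicate (Suc b) x @ t # replicate (Suc a) x)"
    by simp
  have "R [x, x, t] (replicate (Suc (Suc k)) x @ [t])"
    using sym[OF replicate_square[of "[]" k x "[t]"]] by simp
  also note *
  also have "R (replicate (Suc b) x @ t # replicate (Suc a) x) (x # t # replicate (Suc a) x)"
    using replicate_in[of x "[]" "t # replicate (Suc a) x" b] by simp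
  also have "R \<dots> [x, t, x]"
    using replicate_in[of x "[x, t]" "[]" a] by simp
  finally have "R [x, x, t] [x, t, x]" .
  from R_map[OF this, of "\<lambda>z. if z = x then 0 else 2"] show ?thesis
    using xt by (simp add: id_E_def)
qed

text \<open>Extends \<open>R_dest_between\<close> to blocks at the beginning or the end of the word:
  a missing border is replaced by a fresh letter, \<open>m\<close> on the left and
  \<open>Suc m\<close> on the right.\<close>

lemma R_dest_block:
  assumes mu: "\<not> R (fst id_mu) (snd id_mu)" and R: "R (P @ a @ S) (P' @ b @ S')"
    and P: "P = [] \<and> P' = [] \<or>
      (\<exists>U U' t. P = U @ [t] \<and> P' = U' @ [t] \<and> t \<notin> set (U @ a @ S @ U' @ b @ S'))"
    and S: "S = [] \<and> S' = [] \<or>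
      (\<exists>U U' t. S = t # U \<and> S' = t # U' \<and> t \<notin> set (P @ a @ U @ P' @ b @ U'))"
  shows "set a = set b"
proof -
  define m where "m = Suc (Max (insert 0 (set (P @ a @ S @ P' @ b @ S'))))"
  have less: "z < m" if "z \<in> set (P @ a @ S @ P' @ b @ S')" for z
    using that by (simp add: m_def le_imp_less_Suc)
  obtain U U' s where U: "R (U @ s # a @ S) (U' @ s # b @ S')" "s \<notin> set (U @ a @ S @ U' @ b @ S')"
    "set (U @ U') \<subseteq> set (P @ P')" "s \<le> m"
  proof (cases "P = [] \<and> P' = []")
    case True
    then have "R ([] @ m # a @ S) ([] @ m # b @ S')"
      using left[OF R, of "[m]"] by simp
    moreover have "m \<notin> set ([] @ a @ S @ [] @ b @ S')"
      using less[of m] True by auto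
    ultimately show ?thesis
      using that[of "[]" m "[]"] by simp
  next
    case False
    then obtain U U' t where *: "P = U @ [t]" "P' = U' @ [t]" "t \<notin> set (U @ a @ S @ U' @ b @ S')"
      using P by blast
    moreover have "t < m"
      using less * by simp
    ultimately show ?thesis
      using that[of U t U'] R by auto
  qed
  obtain W W' t where W: "R (U @ s # a @ t # W) (U' @ s # b @ t # W')"
    "t \<notin> set (U @ s # a @ W @ U' @ s # b @ W')" "set (W @ W') \<subseteq> set (S @ S')"
  proof (cases "S = [] \<and> S' = []")
    case True
    then have "R (U @ s # a @ [Suc m]) (U' @ s # b @ [Suc m])"
      using right[OF U(1), of "[Suc m]"] by simp
    moreover have "Suc m \<notin> set (U @ s # a @ [] @ U' @ s # b @ [])"
    proof
      assume "Suc m \<in> set (U @ s # a @ [] @ U' @ s # b @ [])"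
      then have "Suc m \<in> set (P @ a @ S @ P' @ b @ S') \<or> Suc m = s"
        using U(3) by auto
      then show False
        using less[of "Suc m"] U(4) by auto
    qed
    ultimately show ?thesis
      using that[of "Suc m" "[]" "[]"] by simp
  next
    case False
    then obtain W W' t where *: "S = t # W" "S' = t # W'" "t \<notin> set (P @ a @ W @ P' @ b @ W')"
      using S by blast
    have "t \<noteq> s"
      using U(2) * by auto
    then show ?thesis
      using that[of t W W'] U * by auto
  qed
  have "set a - {s, t} = set b - {s, t}"
  proof (rule R_dest_between[OF mu W(1)])
    show "s \<noteq> t" "t \<notin> set (U @ a @ W @ U' @ b @ W')"
      using W(2) by auto
    show "s \<notin> set (U @ a @ W @ U' @ b @ W')"
      using U(2) W(3) by auto
  qed
  moreover have "s \<notin> set a" "s \<notin> set b" "t \<notin> set a" "t \<notin> set b"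
    using U(2) W(2) by auto
  ultimately show ?thesis
    by blast
qed

end

context A_congruence
begin

lemma delete_middle:
  assumes "R (fst id_mu) (snd id_mu)" "x \<in> set P" "x \<in> set Q"
  shows "R (P @ x # Q) (P @ Q)"
proof -
  obtain A B where P: "P = A @ x # B"
    using assms split_list by metis
  obtain C D where Q: "Q = C @ x # D"
    using assms split_list by metis
  show ?thesis
    using ctx[OF subst[OF assms(1), of "(!) [[x], [], B, C]"], of A D] by (simp add: id_mu_def P Q)
qed

lemma R_word_symbols:
  assumes mu: "R (fst id_mu) (snd id_mu)"
  shows "R (P @ w) (P @ map snd (word_symbols (set P) w))"
proof (induction w arbitrary: P)
  case (Cons x w)
  show ?case
  proof (cases "x \<in> set P \<and> x \<in> set w")
    case True
    then have "insert x (set P) = set P"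
      by blast
    then show ?thesis
      using trans[OF delete_middle[OF mu, of x P w] Cons.IH[of P]] True by simp
  next
    case False
    then show ?thesis
      using Cons.IH[of "P @ [x]"] by auto
  qed
qed simp

lemma swap_first_mu:
  assumes mu: "R (fst id_mu) (snd id_mu)" and "x \<in> set Q" "y \<in> set Q"
  shows "R (P @ x # y # Q) (P @ y # x # Q)"
proof -
  have ins: "R (P @ [a, b] @ Q) (P @ [a, b, a, b] @ Q)" if "a \<in> set Q" "b \<in> set Q" for a b
  proof -
    have "R (P @ [a, b] @ Q) (P @ [a, b] @ b # Q)"
      using sym[OF delete_middle[OF mu, of b "P @ [a, b]" Q]] that by simp
    also have "R \<dots> (P @ [a, b] @ a # b # Q)"
      using sym[OF delete_middle[OF mu, of a "P @ [a, b]" "b # Q"]] that by simp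
    finally show ?thesis
      by simp
  qed
  have "R (P @ x # y # Q) (P @ [x, y, x, y] @ Q)"
    using ins[of x y] assms by simp
  also have "R \<dots> (P @ [y, x, y, x] @ Q)"
    using subst[OF R_alternate, of "(!) [[x], [y]]"] by (intro ctx) (simp add: id_alternate_def)
  also have "R \<dots> (P @ y # x # Q)"
    using sym[OF ins[of y x]] assms by simp
  finally show ?thesis .
qed

lemma swap_E':
  assumes mu: "R (fst id_mu) (snd id_mu)" and E: "R (fst id_E') (snd id_E')" and "x \<in> set Q"
  shows "R (P @ t # x # Q) (P @ x # t # Q)"
proof -
  have "R (P @ t # x # Q) (P @ [t, x, x] @ Q)"
    using sym[OF dup_left[of x Q "P @ [t]"]] assms by simp
  also have "R \<dots> (P @ [x, t, x] @ Q)"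
    using subst[OF E, of "(!) [[x], [], [t]]"] by (intro ctx) (simp add: id_E'_def)
  also have "R \<dots> (P @ x # t # Q)"
    using delete_middle[OF mu, of x "P @ [x, t]" Q] assms by simp
  finally show ?thesis .
qed

lemma swap_E:
  assumes mu: "R (fst id_mu) (snd id_mu)" and E: "R (fst id_E) (snd id_E)" and "x \<in> set P"
  shows "R (P @ x # t # Q) (P @ t # x # Q)"
proof -
  have "R (P @ x # t # Q) (P @ [x, x, t] @ Q)"
    using sym[OF dup_right[of x P "t # Q"]] assms by simp
  also have "R \<dots> (P @ [x, t, x] @ Q)"
    using subst[OF E, of "(!) [[x], [], [t]]"] by (intro ctx) (simp add: id_E_def)
  also have "R \<dots> (P @ t # x # Q)"
    using delete_middle[OF mu, of x P "t # x # Q"] assms by simp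
  finally show ?thesis .
qed

end

text \<open>In the applications \<open>T\<close> consists of the letters that are not repeated.
  After doubling, every other letter is repeated inside its own block, so the repetition conditions
  of \<open>block_eq\<close> hold for a block independently of its surroundings.\<close>

definition dbl :: "nat set \<Rightarrow> mword \<Rightarrow> mword" where
  "dbl T w = concat (map (\<lambda>x. if x \<in> T then [x] else [x, x]) w)"

lemma dbl_simps [simp]:
  "dbl T [] = []"
  "dbl T (x # w) = (if x \<in> T then x # dbl T w else x # x # dbl T w)"
  "dbl T (v @ w) = dbl T v @ dbl T w"
  by (simp_all add: dbl_def)

lemma set_dbl [simp]: "set (dbl T w) = set w"
  by (induction w) auto

lemma before_dbl: "z \<in> set w \<Longrightarrow> z \<notin> T \<Longrightarrow> before z z (dbl T w)"
  by (induction w) auto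

lemma (in square_congruence) R_dbl:
  assumes "\<And>z. z \<in> set w \<Longrightarrow> z \<notin> T \<Longrightarrow> before z z (P @ w)"
  shows "R (P @ w) (P @ dbl T w)"
  using assms
proof (induction w arbitrary: P)
  case (Cons x w)
  show ?case
  proof (cases "x \<in> T")
    case True
    have "R ((P @ [x]) @ w) ((P @ [x]) @ dbl T w)"
    proof (rule Cons.IH)
      show "before z z ((P @ [x]) @ w)" if "z \<in> set w" "z \<notin> T" for z
        using Cons.prems[of z] that by simp
    qed
    then show ?thesis
      using True by simp
  next
    case False
    have "R (P @ x # w) (P @ x # x # w)"
    proof (cases "x \<in> set P")
      case True
      then show ?thesis using dup_right sym by blast
    next
      case xP: False
      then have "x \<in> set w"
        using Cons.prems[of x] False by (auto dest: before_in_set)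
      then show ?thesis using dup_left sym by blast
    qed
    also have "R ((P @ [x, x]) @ w) ((P @ [x, x]) @ dbl T w)"
    proof (rule Cons.IH)
      show "before z z ((P @ [x, x]) @ w)" if "z \<in> set w" "z \<notin> T" for z
        using Cons.prems[of z] that by auto
    qed
    then have "R (P @ x # x # w) (P @ x # x # dbl T w)"
      by simp
    finally show ?thesis
      using False by simp
  qed
qed simp


section \<open>Congruences containing the identities of \<open>A\<^sup>1\<close>\<close>

definition A_basis :: "midentity set" where
  "A_basis = {id_commute, id_absorb_right, id_absorb_left, id_copy, id_alternate, id_swap}"

definition A_extra :: "midentity set" where
  "A_extra = {id_triv, id_idem, id_comm, id_phi, id_kappa, id_mu, id_E, id_E'}"

context A_congruence
begin

text \<open>Commutativity implies \<open>id_mu\<close>, so a word is determined by its set of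
  symbols, that is, by its content and its repeated letters.\<close>

lemma eq_of_comm:
  assumes comm: "R (fst id_comm) (snd id_comm)"
    and sets: "set u = set v" and multi: "\<And>x. before x x u = before x x v"
  shows "R u v"
proof -
  have swap: "R (P @ x # y # Q) (P @ y # x # Q)" for P x y Q
    using ctx[OF R_map[OF comm, of "(!) [x, y]"], of P Q] by (simp add: id_comm_def)
  have "R [0, 2, 0, 3, 0] [0, 2, 0, 0, 3]"
    using swap[of "[0, 2, 0]" 3 0 "[]"] by simp
  also have "R \<dots> [0, 2, 0, 3]"
    using dup_right[of 0 "[0, 2]" "[3]"] by simp
  also have "R \<dots> [0, 2, 3, 0]"
    using swap[of "[0, 2]" 0 3 "[]"] by simp
  finally have mu: "R (fst id_mu) (snd id_mu)"
    by (simp add: id_mu_def)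
  have "R (map snd (word_symbols {} u)) (map snd (word_symbols {} v))"
  proof (rule adjacent_swaps[of "\<lambda>a b. R (map snd a) (map snd b)"])
    show "set (word_symbols {} u) = set (word_symbols {} v)"
      by (simp add: set_word_symbols sets multi)
  qed (use trans swap in \<open>auto simp: distinct_word_symbols\<close>)
  moreover have "R w (map snd (word_symbols {} w))" for w
    using R_word_symbols[OF mu, of "[]" w] by simp
  ultimately show ?thesis
    using trans[OF trans] sym by blast
qed

lemma comm_of_idem:
  assumes idem: "R (fst id_idem) (snd id_idem)"
  shows "R (fst id_comm) (snd id_comm)"
proof -
  have sq: "R w (w @ w)" for w
    using subst[OF idem, of "\<lambda>_. w"] by (simp add: id_idem_def)
  have "R [0, 1] [0, 1, 0, 1]"
    using sq[of "[0, 1]"] by simp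
  also have "R \<dots> [1, 0, 1, 0]"
    using R_alternate by (simp add: id_alternate_def)
  also have "R \<dots> [1, 0]"
    using sym[OF sq[of "[1, 0]"]] by simp
  finally show ?thesis
    by (simp add: id_comm_def)
qed

text \<open>Doubling makes all letters repeated; commutativity follows from \<open>id_idem\<close>,
  and then the content alone decides.\<close>

lemma eq_of_idem:
  assumes idem: "R (fst id_idem) (snd id_idem)" and sets: "set u = set v"
  shows "R u v"
proof -
  have d: "R w (dbl {} w)" for w
  proof (induction w)
    case (Cons x w)
    have "R [x] [x, x]"
      using R_map[OF idem, of "\<lambda>_. x"] by (simp add: id_idem_def)
    then show ?case
      using mult[OF _ Cons, of "[x]" "[x, x]"] by simp
  qed simp
  have "R (dbl {} u) (dbl {} v)"
  proof (rule eq_of_comm[OF comm_of_idem[OF idem]])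
    show "before x x (dbl {} u) = before x x (dbl {} v)" for x
      using before_dbl[of x u "{}"] before_dbl[of x v "{}"] before_in_set[of x x] sets by fastforce
  qed (simp add: sets)
  then show ?thesis
    using d sym trans by meson
qed

lemma eq_of_triv:
  assumes "R (fst id_triv) (snd id_triv)" shows "R u v"
proof -
  have "R w []" for w
  proof (induction w)
    case (Cons x w)
    have "R [x] []"
      using R_map[OF assms, of "\<lambda>_. x"] by (simp add: id_triv_def)
    then show ?case
      using mult[OF _ Cons, of "[x]" "[]"] by simp
  qed simp
  then show ?thesis
    using sym trans by blast
qed

end

text \<open>\<open>Th\<close> is the theory to be axiomatised and \<open>D\<close> the candidate for
  it; the aim is that \<open>D\<close> contains \<open>Th\<close>. Identities obtained in
  \<open>Th\<close> by deleting letters are carried to \<open>D\<close> by \<open>extra\<close>, and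
  \<open>D_Th\<close> reflects every rewriting step back into \<open>Th\<close>.\<close>

locale A_congruence_extension = Th: A_congruence Th + D: A_congruence D
  for Th D :: "mword \<Rightarrow> mword \<Rightarrow> bool" +
  assumes D_Th: "D u v \<Longrightarrow> Th u v"
    and extra: "(u, v) \<in> A_extra \<Longrightarrow> Th u v \<Longrightarrow> D u v"
begin

lemma extraI: "e \<in> A_extra \<Longrightarrow> Th (fst e) (snd e) \<Longrightarrow> D (fst e) (snd e)"
  by (cases e) (auto intro: extra)

text \<open>The lists of symbols are matched by adjacent exchanges. Two first or two last symbols
  always commute. A first and a last one need \<open>id_kappa\<close>, a first and a simple one
  \<open>id_E'\<close>, a last and a simple one \<open>id_E\<close>; in each case the opposite
  orders in \<open>u\<close> and \<open>v\<close> force that identity in \<open>Th\<close>. Simple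
  letters never change their order.\<close>

lemma eq_of_mu:
  assumes nt: "\<not> Th (fst id_triv) (snd id_triv)" and ni: "\<not> Th (fst id_idem) (snd id_idem)"
    and nc: "\<not> Th (fst id_comm) (snd id_comm)" and mu: "Th (fst id_mu) (snd id_mu)"
    and uv: "Th u v"
  shows "D u v"
proof -
  have Dmu: "D (fst id_mu) (snd id_mu)"
    using mu by (intro extraI) (simp add: A_extra_def)
  have sets: "set u = set v"
    using Th.R_dest_content[OF nt uv] .
  have multi: "before x x u = before x x v" for x
    using Th.R_dest_simple[OF nt ni uv] .
  let ?u = "word_symbols {} u" and ?v = "word_symbols {} v"
  have set_eq: "set ?u = set ?v"
    by (simp add: set_word_symbols sets multi)
  have "D (map snd ?u) (map snd ?v)"
  proof (rule adjacent_swaps[of "\<lambda>a b. D (map snd a) (map snd b)" ?u ?v])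
    show "distinct ?u" "distinct ?v"
      by (simp_all add: distinct_word_symbols)
    fix A B a b
    assume d: "distinct (A @ a # b # B)" and s: "set (A @ a # b # B) = set ?u"
      and ab: "before a b ?u" "before b a ?v"
      and ord: "\<And>c d. before c d ?u \<Longrightarrow> before c d ?v \<Longrightarrow> before c d (A @ a # b # B)"
    have ba: "\<not> before b a ?u" "\<not> before a b ?v"
      using before_asym[OF distinct_word_symbols ab(1)] before_asym[OF distinct_word_symbols ab(2)]
      by auto
    have fl: "before (First, x) (Last, x) (A @ a # b # B)" if "before x x u" for x
      using that multi by (intro ord) (auto simp: before_word_symbols_first_last)
    have in_u: "a \<in> set ?u" "b \<in> set ?u"
      unfolding s[symmetric] by simp_all
    have later: "x \<in> set (map snd B)"
      if x: "before x x u" "(b = (First, x) \<or> a = (First, x) \<and> b \<noteq> (Last, x))" for x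
    proof -
      have "(Last, x) \<in> set B"
        using fl[OF x(1)] x(2) d by (auto dest: before_in_set)
      then show ?thesis
        by force
    qed
    have earlier: "x \<in> set (map snd A)"
      if x: "before x x u" "(a = (Last, x) \<or> b = (Last, x) \<and> a \<noteq> (First, x))" for x
    proof -
      have "(First, x) \<in> set A"
        using fl[OF x(1)] x(2) d by (auto dest: before_in_set)
      then show ?thesis
        by force
    qed
    obtain x y where xy: "snd a = x" "snd b = y"
      by blast
    have kinds: "(a = (First, x) \<or> a = (Last, x)) \<and> before x x u \<or> a = (Simple, x) \<and> x \<in> set u \<and> \<not> before x x u"
      "(b = (First, y) \<or> b = (Last, y)) \<and> before y y u \<or> b = (Simple, y) \<and> y \<in> set u \<and> \<not> before y y u"
      using in_u xy by (auto simp: set_word_symbols)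
    have split: thesis if t: "t \<in> set u" "\<not> before t t u" and thesis:
      "\<And>u1 u2 v1 v2. u = u1 @ t # u2 \<Longrightarrow> v = v1 @ t # v2 \<Longrightarrow> t \<notin> set (u1 @ u2 @ v1 @ v2) \<Longrightarrow> thesis"
      for t thesis
    proof -
      obtain u1 u2 where u: "u = u1 @ t # u2" "t \<notin> set u1" "t \<notin> set u2"
        using simple_split[OF t] .
      have "t \<in> set v" "\<not> before t t v"
        using t multi sets by auto
      then obtain v1 v2 where v: "v = v1 @ t # v2" "t \<notin> set v1" "t \<notin> set v2"
        by (rule simple_split)
      show thesis
        using thesis[OF u(1) v(1)] u v by simp
    qed
    have E': "Th (fst id_E') (snd id_E')"
      if t: "t \<in> set u" "\<not> before t t u" and x: "before x x u" "before x t u \<noteq> before x t v" for x t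
    proof (rule split[OF t])
      fix u1 u2 v1 v2
      assume uv': "u = u1 @ t # u2" "v = v1 @ t # v2" "t \<notin> set (u1 @ u2 @ v1 @ v2)"
      have xt: "x \<noteq> t"
        using t x by auto
      have "x \<in> set v"
        using x sets by (auto dest: before_in_set)
      moreover have "x \<in> set u"
        using x by (auto dest: before_in_set)
      moreover have "before x t u \<longleftrightarrow> x \<in> set u1" "before x t v \<longleftrightarrow> x \<in> set v1"
        using uv' xt by (auto dest: before_in_set)
      ultimately have "x \<notin> set u1 \<and> x \<in> set u2 \<and> x \<in> set v1 \<or> x \<notin> set v1 \<and> x \<in> set v2 \<and> x \<in> set u1"
        using x(2) uv' xt by auto
      then show ?thesis
        using Th.R_dest_E'[of u1 t u2 v1 v2 x] Th.R_dest_E'[of v1 t v2 u1 u2 x] Th.sym[OF uv] uv xt uv'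
        by auto
    qed
    have E: "Th (fst id_E) (snd id_E)"
      if t: "t \<in> set u" "\<not> before t t u" and x: "before x x u" "before t x u \<noteq> before t x v" for x t
    proof (rule split[OF t])
      fix u1 u2 v1 v2
      assume uv': "u = u1 @ t # u2" "v = v1 @ t # v2" "t \<notin> set (u1 @ u2 @ v1 @ v2)"
      have xt: "x \<noteq> t"
        using t x by auto
      have "x \<in> set v"
        using x sets by (auto dest: before_in_set)
      moreover have "x \<in> set u"
        using x by (auto dest: before_in_set)
      moreover have "before t x u \<longleftrightarrow> x \<in> set u2" "before t x v \<longleftrightarrow> x \<in> set v2"
        using uv' xt by (auto dest: before_in_set)
      ultimately have "x \<notin> set u2 \<and> x \<in> set u1 \<and> x \<in> set v2 \<or> x \<notin> set v2 \<and> x \<in> set v1 \<and> x \<in> set u2"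
        using x(2) uv' xt by auto
      then show ?thesis
        using Th.R_dest_E[of u1 t u2 v1 v2 x] Th.R_dest_E[of v1 t v2 u1 u2 x] Th.sym[OF uv] uv xt uv'
        by auto
    qed
    have kappa: "Th (fst id_kappa) (snd id_kappa)"
      if xy: "x \<noteq> y" "x \<in> set u" "y \<in> set u" "before x y u \<noteq> before x y v" for x y
    proof -
      let ?F = "filter (\<lambda>z. z = x \<or> z = y)"
      have F: "set (?F u) = {x, y}" "set (?F v) = {x, y}" "Th (?F u) (?F v)"
        using that sets Th.R_filter[OF uv] by auto
      then show ?thesis
        using Th.R_dest_kappa[OF F(3,1,2)] Th.R_dest_kappa[OF Th.sym[OF F(3)] F(2,1)] xy by auto
    qed
    have D_E': "D (fst id_E') (snd id_E')" if "Th (fst id_E') (snd id_E')"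
      using that by (intro extraI) (simp_all add: A_extra_def)
    have D_E: "D (fst id_E) (snd id_E)" if "Th (fst id_E) (snd id_E)"
      using that by (intro extraI) (simp_all add: A_extra_def)
    have D_kappa: "D (fst id_kappa) (snd id_kappa)" if "Th (fst id_kappa) (snd id_kappa)"
      using that by (intro extraI) (simp_all add: A_extra_def)
    have "D (map snd A @ x # y # map snd B) (map snd A @ y # x # map snd B)"
    proof -
      consider (ff) "a = (First, x)" "b = (First, y)" "before x x u" "before y y u"
        | (ll) "a = (Last, x)" "b = (Last, y)" "before x x u" "before y y u"
        | (fl) "a = (First, x)" "b = (Last, y)" "before x x u" "before y y u"
        | (lf) "a = (Last, x)" "b = (First, y)" "before x x u" "before y y u"
        | (fs) "a = (First, x)" "b = (Simple, y)" "before x x u" "y \<in> set u" "\<not> before y y u"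
        | (sf) "a = (Simple, x)" "b = (First, y)" "before y y u" "x \<in> set u" "\<not> before x x u"
        | (ls) "a = (Last, x)" "b = (Simple, y)" "before x x u" "y \<in> set u" "\<not> before y y u"
        | (sl) "a = (Simple, x)" "b = (Last, y)" "before y y u" "x \<in> set u" "\<not> before x x u"
        | (ss) "a = (Simple, x)" "b = (Simple, y)" "x \<in> set u" "y \<in> set u" "\<not> before x x u" "\<not> before y y u"
        using kinds by argo
      then show ?thesis
      proof cases
        case ff
        then show ?thesis
          using D.swap_first_mu[OF Dmu] later[of x] later[of y] by simp
      next
        case ll
        then show ?thesis
          using D.swap_nonfirst earlier[of x] earlier[of y] by simp
      next
        case fl
        have "x \<noteq> y" "before x y u \<noteq> before x y v"
          using ab(1) ba(2) fl multi by (auto simp: before_word_symbols_first_last)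
        then have "D (fst id_kappa) (snd id_kappa)"
          using kappa[of x y] fl by (auto intro: D_kappa dest: before_in_set)
        then show ?thesis
          using D.swap_kappa[of y "map snd A" x "map snd B"] fl later[of x] earlier[of y] \<open>x \<noteq> y\<close> by simp
      next
        case lf
        have "x \<noteq> y" "before y x u \<noteq> before y x v"
          using ab(2) ba(1) lf multi by (auto simp: before_word_symbols_first_last)
        then have "D (fst id_kappa) (snd id_kappa)"
          using kappa[of y x] lf by (auto intro: D_kappa dest: before_in_set)
        then show ?thesis
          using D.sym[OF D.swap_kappa[of x "map snd A" y "map snd B"]] lf later[of y] earlier[of x] \<open>x \<noteq> y\<close>
          by simp
      next
        case fs
        have "before x y u \<noteq> before x y v"
          using ab(1) ba(2) fs multi by (auto simp: before_word_symbols_first_simple)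
        then have "D (fst id_E') (snd id_E')"
          using E'[of y x] fs by (intro D_E') auto
        then show ?thesis
          using D.sym[OF D.swap_E'[OF Dmu, of x "map snd B" "map snd A" y]] fs later[of x] by simp
      next
        case sf
        have "before y x u \<noteq> before y x v"
          using ab(2) ba(1) sf multi by (auto simp: before_word_symbols_first_simple)
        then have "D (fst id_E') (snd id_E')"
          using E'[of x y] sf by (intro D_E') auto
        then show ?thesis
          using D.swap_E'[OF Dmu, of y "map snd B" "map snd A" x] sf later[of y] by simp
      next
        case ls
        have "before y x u \<noteq> before y x v"
          using ab(2) ba(1) ls multi by (auto simp: before_word_symbols_simple_last)
        then have "D (fst id_E) (snd id_E)"
          using E[of y x] ls by (intro D_E) auto
        then show ?thesis
          using D.swap_E[OF Dmu, of x "map snd A" y "map snd B"] ls earlier[of x] by simp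
      next
        case sl
        have "before x y u \<noteq> before x y v"
          using ab(1) ba(2) sl multi by (auto simp: before_word_symbols_simple_last)
        then have "D (fst id_E) (snd id_E)"
          using E[of x y] sl by (intro D_E) auto
        then show ?thesis
          using D.sym[OF D.swap_E[OF Dmu, of y "map snd A" x "map snd B"]] sl earlier[of y] by simp
      next
        case ss
        have "before x y u" "before y x v" "x \<noteq> y"
          using ab ss by (auto simp: before_word_symbols_simple)
        then show ?thesis
          using Th.R_dest_order[OF nc uv, of x y] ss multi by auto
      qed
    qed
    then show "D (map snd (A @ a # b # B)) (map snd (A @ b # a # B))"
      using xy by simp
  qed (use set_eq D.trans in auto)
  moreover have "D w (map snd (word_symbols {} w))" for w
    using D.R_word_symbols[OF Dmu, of "[]" w] by simp
  ultimately show ?thesis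
    using D.trans[OF D.trans] D.sym by blast
qed

end


section \<open>The case in which \<open>id_mu\<close> fails: one block after the other\<close>

context A_congruence_extension
begin

text \<open>Three situations arise. If \<open>y\<close> does not occur in the rest \<open>S\<close>,
  keeping only \<open>x\<close> and \<open>y\<close> gives \<open>id_kappa\<close>. If
  \<open>x\<close> occurs in \<open>S\<close> after the next \<open>y\<close> or in the same block
  just before it, the exchange is free. Otherwise a simple letter \<open>s\<close> lies before the
  next \<open>y\<close> with no \<open>x\<close> after it, and keeping only \<open>x\<close>,
  \<open>y\<close>, \<open>s\<close> gives \<open>id_phi\<close>.\<close>

lemma swap_block:
  assumes nt: "\<not> Th (fst id_triv) (snd id_triv)" and nmu: "\<not> Th (fst id_mu) (snd id_mu)"
    and Th: "Th (P @ dbl T a @ S) (P @ dbl T b @ S')"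
    and S: "S = [] \<and> S' = [] \<or> (\<exists>t U U'. t \<in> T \<and> S = t # dbl T U \<and> S' = t # dbl T U')"
    and a: "set a \<inter> T = {}" "set a = set b"
    and simple: "\<And>z. z \<in> T \<Longrightarrow> \<not> before z z (P @ dbl T a @ S)" "\<And>z. z \<in> T \<Longrightarrow> \<not> before z z (P @ dbl T b @ S')"
    and x: "x \<in> set b - set P" and y: "y \<in> set b" and xy: "x \<noteq> y"
    and diff: "before x y (dbl T a) \<noteq> before x y (dbl T b)"
    and yx: "y \<in> set P'" "x \<in> set Q'"
  shows "D (P' @ x # y # Q' @ S) (P' @ y # x # Q' @ S)"
proof -
  have nT: "x \<notin> T" "y \<notin> T"
    using x y a by auto
  have set_all: "set (P @ dbl T a @ S) = set (P @ dbl T b @ S')"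
    using Th.R_dest_content[OF nt Th] .
  show ?thesis
  proof (cases "y \<in> set S")
    case False
    \<comment> \<open>Nonempty rests start with the same simple letter \<open>t\<close>, and since
      \<open>id_mu\<close> fails, the texts behind it have the same content.\<close>
    have yS': "y \<notin> set S'"
    proof (cases "S = []")
      case True
      then show ?thesis using S by auto
    next
      case nonempty: False
      then obtain t U U' where t: "t \<in> T" "S = t # dbl T U" "S' = t # dbl T U'"
        using S by auto
      have "set (dbl T U) = set (dbl T U')"
      proof (rule Th.R_dest_block[OF nmu, of "P @ dbl T a @ [t]" _ "[]" "P @ dbl T b @ [t]" _ "[]"])
        show "Th ((P @ dbl T a @ [t]) @ dbl T U @ []) ((P @ dbl T b @ [t]) @ dbl T U' @ [])"
          using Th t by simp
        show "P @ dbl T a @ [t] = [] \<and> P @ dbl T b @ [t] = [] \<or>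
          (\<exists>V V' s. P @ dbl T a @ [t] = V @ [s] \<and> P @ dbl T b @ [t] = V' @ [s] \<and>
            s \<notin> set (V @ dbl T U @ [] @ V' @ dbl T U' @ []))"
          using simple[OF t(1)] t by (intro disjI2 exI[of _ "P @ dbl T a"] exI[of _ "P @ dbl T b"] exI[of _ t]) auto
      qed simp
      then show ?thesis
        using False t nT by auto
    qed
    let ?F = "filter (\<lambda>z. z = x \<or> z = y)"
    let ?u = "?F (P @ dbl T a @ S)" and ?v = "?F (P @ dbl T b @ S')"
    have F: "Th ?u ?v" "set ?u = {x, y}" "set ?v = {x, y}"
      using Th.R_filter[OF Th] x y a(2) by auto
    have "before x y ?u = before x y (dbl T a)" "before x y ?v = before x y (dbl T b)"
      using x False yS' by (auto dest: before_in_set)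
    then have "Th (fst id_kappa) (snd id_kappa)"
      using Th.R_dest_kappa[OF F xy] Th.R_dest_kappa[OF Th.sym[OF F(1)] F(3,2) xy] diff by blast
    then have "D (fst id_kappa) (snd id_kappa)"
      by (intro extraI) (simp_all add: A_extra_def)
    then show ?thesis
      using D.swap_kappa[of y P' x "Q' @ S"] yx by simp
  next
    case True
    then obtain t U U' where t: "t \<in> T" "S = t # dbl T U" "S' = t # dbl T U'"
      using S by auto
    obtain S1 S2 where S12: "S = S1 @ y # S2" "y \<notin> set S1"
      using True split_list_first by metis
    show ?thesis
    proof (cases "x \<in> set S2 \<or> (\<exists>E F. S1 = E @ x # F \<and> set F \<inter> T = {})")
      case True
      then obtain A B where AB: "x \<in> set B"
        "D (P' @ x # y # Q' @ S) (P' @ x # y # A @ y # B)" "D (P' @ y # x # Q' @ S) (P' @ y # x # A @ y # B)"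
      proof (elim disjE exE conjE)
        assume "x \<in> set S2"
        then show thesis
          using that[of S2 "Q' @ S1"] S12 by simp
      next
        fix E F
        assume EF: "S1 = E @ x # F" "set F \<inter> T = {}"
        \<comment> \<open>Here \<open>x\<close> precedes the next \<open>y\<close> inside one block,
          so a \<open>y\<close> can be copied in front of this \<open>x\<close>; afterwards
          \<open>swap_free\<close> applies.\<close>
        have "D ((W @ Q' @ E) @ (x # F) @ y # S2) ((W @ Q' @ E) @ y # (x # F) @ y # S2)"
          if W: "x \<in> set W" "y \<in> set W" for W
        proof (rule D.copy_over_word)
          fix z assume z: "z \<in> set (x # F)"
          show "before z z ((W @ Q' @ E) @ (x # F) @ y # S2)"
          proof (cases "z = x")
            case False
            then have "z \<in> set S" "z \<notin> T"
              using z EF S12 by auto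
            then have "before z z S"
              using t before_dbl[of z U T] by auto
            then show ?thesis
              by (simp add: S12 EF)
          qed (use W in simp)
        qed (use W in simp)
        from this[of "P' @ [x, y]"] this[of "P' @ [y, x]"] show thesis
          using that[of "x # F @ y # S2" "Q' @ E"] S12 EF by simp
      qed
      have "D (P' @ x # y # A @ y # B) (P' @ y # x # A @ y # B)"
        using D.swap_free[of y P' x B A] yx AB by simp
      with AB show ?thesis
        using D.trans D.sym by blast
    next
      case no: False
      \<comment> \<open>\<open>s\<close> separates the last \<open>x\<close> of \<open>S\<close>
        from the next \<open>y\<close>. If \<open>S\<close> has no \<open>x\<close> at all in front
        of that \<open>y\<close>, its initial letter \<open>t\<close> serves as
        \<open>s\<close>.\<close>
      obtain F s G where FG: "S1 = F @ s # G" "s \<in> T" "x \<notin> set G" "x \<notin> set S2"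
      proof (cases "x \<in> set S1")
        case True
        then obtain E H where EH: "S1 = E @ x # H" "x \<notin> set H"
          using split_list_last by metis
        then obtain s where "s \<in> set H" "s \<in> T"
          using no by blast
        then obtain H1 H2 where "H = H1 @ s # H2"
          using split_list by metis
        then show thesis
          using that[of "E @ x # H1" s H2] EH \<open>s \<in> T\<close> no by simp
      next
        case False
        have "S1 \<noteq> []"
          using S12 t nT by auto
        then obtain V where "S1 = t # V"
          using S12 t by (cases S1) auto
        then show thesis
          using that[of "[]" t V] t False no by auto
      qed
      define H where "H = G @ y # S2"
      have SF: "S = F @ s # H" "y \<notin> set F" "x \<notin> set H" "y \<in> set H"
        using S12 FG xy by (auto simp: H_def)
      have s: "s \<notin> set P" "s \<notin> set a" "s \<notin> set b" "s \<notin> set F" "s \<notin> set H"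
        using simple(1)[OF FG(2)] SF a FG(2) by auto
      have "s \<in> set S'"
        using set_all SF(1) s by auto
      then obtain F' H' where SF': "S' = F' @ s # H'"
        using split_list by metis
      have s': "s \<notin> set F'" "s \<notin> set H'"
        using simple(2)[OF FG(2)] SF' by auto
      have HH: "set H = set H'"
      proof (rule Th.R_dest_block[OF nmu, of "P @ dbl T a @ F @ [s]" _ "[]" "P @ dbl T b @ F' @ [s]" _ "[]"])
        show "Th ((P @ dbl T a @ F @ [s]) @ H @ []) ((P @ dbl T b @ F' @ [s]) @ H' @ [])"
          using Th SF SF' by simp
        show "P @ dbl T a @ F @ [s] = [] \<and> P @ dbl T b @ F' @ [s] = [] \<or>
          (\<exists>V V' r. P @ dbl T a @ F @ [s] = V @ [r] \<and> P @ dbl T b @ F' @ [s] = V' @ [r] \<and>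
            r \<notin> set (V @ H @ [] @ V' @ H' @ []))"
          using s s' a by (intro disjI2 exI[of _ "P @ dbl T a @ F"] exI[of _ "P @ dbl T b @ F'"] exI[of _ s]) auto
      qed simp
      \<comment> \<open>The text between \<open>t\<close> and \<open>s\<close> has the same content
        in both words, so \<open>y\<close> reappears only after \<open>s\<close> in
        \<open>S'\<close> too.\<close>
      have yF': "y \<notin> set F'"
      proof (cases "F = []")
        case True
        then have "s = t"
          using SF t by simp
        then have "F' = []"
          using SF' t s' by (cases F') auto
        then show ?thesis by simp
      next
        case False
        then obtain F0 where F0: "F = t # F0"
          using SF t by (cases F) auto
        then have "s \<noteq> t"
          using s by auto
        then obtain F0' where F0': "F' = t # F0'"
          using SF' t by (cases F') auto
        have "set F0 = set F0'"
        proof (rule Th.R_dest_block[OF nmu, of "P @ dbl T a @ [t]" _ "s # H" "P @ dbl T b @ [t]" _ "s # H'"])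
          show "Th ((P @ dbl T a @ [t]) @ F0 @ s # H) ((P @ dbl T b @ [t]) @ F0' @ s # H')"
            using Th SF SF' F0 F0' by simp
          show "P @ dbl T a @ [t] = [] \<and> P @ dbl T b @ [t] = [] \<or>
            (\<exists>V V' r. P @ dbl T a @ [t] = V @ [r] \<and> P @ dbl T b @ [t] = V' @ [r] \<and>
              r \<notin> set (V @ F0 @ (s # H) @ V' @ F0' @ (s # H')))"
            using simple[OF t(1)] SF(1) SF' F0 F0' \<open>s \<noteq> t\<close>
            by (intro disjI2 exI[of _ "P @ dbl T a"] exI[of _ "P @ dbl T b"] exI[of _ t]) auto
          show "s # H = [] \<and> s # H' = [] \<or> (\<exists>V V' r. s # H = r # V \<and> s # H' = r # V' \<and>
              r \<notin> set ((P @ dbl T a @ [t]) @ F0 @ V @ (P @ dbl T b @ [t]) @ F0' @ V'))"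
            using s s' F0 F0' by auto
        qed
        then show ?thesis
          using SF(2) F0 F0' by auto
      qed
      let ?F = "filter (\<lambda>z. z = x \<or> z = y \<or> z = s)"
      let ?u = "?F (P @ dbl T a @ F)" and ?v = "?F (P @ dbl T b @ F')"
      have rep: "\<exists>m. ?F W = replicate (Suc m) y" if "x \<notin> set W" "s \<notin> set W" "y \<in> set W" for W
      proof -
        have "?F W = replicate (length (filter (\<lambda>z. z = y) W)) y"
          using that(1,2) by (induction W) auto
        moreover have "length (filter (\<lambda>z. z = y) W) \<noteq> 0"
          using that(3) by (auto simp: filter_empty_conv)
        ultimately show ?thesis
          using not0_implies_Suc by metis
      qed
      obtain m n where mn: "?F H = replicate (Suc m) y" "?F H' = replicate (Suc n) y"
        using rep[of H] rep[of H'] SF HH s s' by auto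
      have R: "Th (?u @ s # replicate (Suc m) y) (?v @ s # replicate (Suc n) y)"
        using Th.R_filter[OF Th, of "\<lambda>z. z = x \<or> z = y \<or> z = s"] mn SF(1) SF' by simp
      have sxy: "s \<noteq> x" "s \<noteq> y"
        using FG(2) nT by auto
      have sub: "set ?u \<subseteq> {x, y}" "set ?v \<subseteq> {x, y}"
        using s s' by auto
      have xx: "before x x ?u" "before x x ?v"
        using before_dbl[of x a T] before_dbl[of x b T] x a(2) nT by auto
      have "before x y ?u = before x y (dbl T a)" "before x y ?v = before x y (dbl T b)"
        using x SF(2) yF' by (auto dest: before_in_set)
      then have "Th (fst id_phi) (snd id_phi)"
        using Th.R_dest_phi[OF R xy sxy sub(1) _ xx(1) sub(2) _ xx(2)]
          Th.R_dest_phi[OF Th.sym[OF R] xy sxy sub(2) _ xx(2) sub(1) _ xx(1)] diff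
        by blast
      then have "D (fst id_phi) (snd id_phi)"
        by (intro extraI) (simp_all add: A_extra_def)
      then show ?thesis
        using D.swap_phi[of y P' x "Q' @ S"] yx \<open>y \<in> set S\<close> by simp
    qed
  qed
qed

text \<open>Only the block is replaced and the rest of the left word stays; the identities for the
  exchanges come from the comparison with the right word, whose rest is \<open>S'\<close>.\<close>

lemma eq_block:
  assumes nt: "\<not> Th (fst id_triv) (snd id_triv)" and nmu: "\<not> Th (fst id_mu) (snd id_mu)"
    and Th: "Th (P @ dbl T a @ S) (P @ dbl T b @ S')"
    and P: "P = [] \<or> last P \<in> T"
    and S: "S = [] \<and> S' = [] \<or> (\<exists>t U U'. t \<in> T \<and> S = t # dbl T U \<and> S' = t # dbl T U')"
    and a: "set a \<inter> T = {}" "set b \<inter> T = {}"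
    and simple: "\<And>z. z \<in> T \<Longrightarrow> \<not> before z z (P @ dbl T a @ S)" "\<And>z. z \<in> T \<Longrightarrow> \<not> before z z (P @ dbl T b @ S')"
  shows "D (P @ dbl T a @ S) (P @ dbl T b @ S)"
proof -
  have "set (dbl T a) = set (dbl T b)"
  proof (rule Th.R_dest_block[OF nmu Th])
    show "P = [] \<and> P = [] \<or>
      (\<exists>U U' t. P = U @ [t] \<and> P = U' @ [t] \<and> t \<notin> set (U @ dbl T a @ S @ U' @ dbl T b @ S'))"
    proof (cases P rule: rev_cases)
      case (snoc U t)
      then have "t \<in> T"
        using P by simp
      from simple[OF this] show ?thesis
        using snoc by (intro disjI2 exI[of _ U] exI[of _ t]) auto
    qed simp
    show "S = [] \<and> S' = [] \<or>
      (\<exists>U U' t. S = t # U \<and> S' = t # U' \<and> t \<notin> set (P @ dbl T a @ U @ P @ dbl T b @ U'))"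
    proof (cases "S = []")
      case True
      then show ?thesis using S by auto
    next
      case False
      then obtain t U U' where t: "t \<in> T" "S = t # dbl T U" "S' = t # dbl T U'"
        using S by auto
      from simple[OF t(1)] show ?thesis
        using t by (intro disjI2 exI[of _ "dbl T U"] exI[of _ "dbl T U'"] exI[of _ t]) auto
    qed
  qed
  then have ab: "set a = set b"
    by simp
  show ?thesis
  proof (rule D.block_eq)
    show "set (dbl T a) = set (dbl T b)"
      using ab by simp
    show "z \<in> set P \<or> z \<in> set S \<or> before z z (dbl T a)" if "z \<in> set (dbl T a)" for z
      using that a before_dbl[of z a T] by auto
    show "z \<in> set P \<or> z \<in> set S \<or> before z z (dbl T b)" if "z \<in> set (dbl T b)" for z
      using that a before_dbl[of z b T] by auto
    show "D (P' @ x # y # Q' @ S) (P' @ y # x # Q' @ S)"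
      if "x \<in> set (dbl T b) - set P" "y \<in> set (dbl T b)" "x \<noteq> y"
        "before x y (dbl T a) \<noteq> before x y (dbl T b)" "y \<in> set P'" "x \<in> set Q'" for x y P' Q'
      using swap_block[OF nt nmu Th S a(1) ab simple, of x y P' Q'] that by simp
  qed
qed

text \<open>\<open>P\<close> is the part already made equal, and it ends at a block border. The next
  simple letters of the two words agree because the order of simple letters is invariant.\<close>

lemma eq_of_not_mu_dbl:
  assumes nt: "\<not> Th (fst id_triv) (snd id_triv)" and ni: "\<not> Th (fst id_idem) (snd id_idem)"
    and nc: "\<not> Th (fst id_comm) (snd id_comm)" and nmu: "\<not> Th (fst id_mu) (snd id_mu)"
  shows "Th (P @ dbl T u) (P @ dbl T v) \<Longrightarrow>
    (\<And>z. z \<in> T \<Longrightarrow> \<not> before z z (P @ dbl T u)) \<Longrightarrow> P = [] \<or> last P \<in> T \<Longrightarrow>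
    D (P @ dbl T u) (P @ dbl T v)"
proof (induction "length u" arbitrary: u v P rule: less_induct)
  case less
  note Th = less.prems(1) and simple = less.prems(2)
  have simple': "\<not> before z z (P @ dbl T v)" if "z \<in> T" for z
    using simple[OF that] unfolding Th.R_dest_simple[OF nt ni Th] .
  have sets: "set P \<union> set u = set P \<union> set v"
    using Th.R_dest_content[OF nt Th] by simp
  have inT: "t \<in> set v \<longleftrightarrow> t \<in> set u" if "t \<in> T" for t
    using simple[OF that] simple'[OF that] sets by (auto dest: before_in_set)
  have split: "\<exists>a r. w = a @ r \<and> set a \<inter> T = {} \<and> (r = [] \<or> (\<exists>t r'. t \<in> T \<and> r = t # r'))" for w
  proof (cases "\<exists>t\<in>set w. t \<in> T")
    case True
    then obtain a t r where "w = a @ t # r" "t \<in> T" "\<forall>z\<in>set a. z \<notin> T"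
      using split_list_first_prop[of w "\<lambda>z. z \<in> T"] by blast
    then show ?thesis
      by (intro exI[of _ a] exI[of _ "t # r"]) auto
  next
    case False
    then show ?thesis
      by (intro exI[of _ w] exI[of _ "[]"]) auto
  qed
  obtain a r where u: "u = a @ r" "set a \<inter> T = {}" "r = [] \<or> (\<exists>t r'. t \<in> T \<and> r = t # r')"
    using split by blast
  obtain b q where v: "v = b @ q" "set b \<inter> T = {}" "q = [] \<or> (\<exists>t r'. t \<in> T \<and> q = t # r')"
    using split by blast
  show ?case
  proof (cases "r = []")
    case True
    have "q = []"
    proof (rule ccontr)
      assume "q \<noteq> []"
      then obtain t q' where "t \<in> T" "q = t # q'"
        using v by blast
      then show False
        using inT[of t] u v True by auto
    qed
    then show ?thesis
      using eq_block[OF nt nmu, of P T a "[]" b "[]"] Th simple simple' less.prems(3) u v True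
      by simp
  next
    case False
    then obtain t u' where t: "t \<in> T" "r = t # u'"
      using u by blast
    have "q \<noteq> []"
      using inT[OF t(1)] t u v by auto
    then obtain t' v' where t': "t' \<in> T" "q = t' # v'"
      using v by blast
    have "t' = t"
    proof (rule ccontr)
      assume ne: "t' \<noteq> t"
      have "t \<in> set v'"
        using inT[OF t(1)] t t' u v ne by auto
      moreover have "t' \<in> set u'"
        using inT[OF t'(1)] t t' u v ne by auto
      ultimately have "before t t' (P @ dbl T u)" "before t' t (P @ dbl T v)"
        using t t' u v by auto
      then show False
        using Th.R_dest_order[OF nc Th, of t t'] ne simple simple' t t' by blast
    qed
    have eqs: "P @ dbl T u = P @ dbl T a @ t # dbl T u'" "P @ dbl T v = P @ dbl T b @ t # dbl T v'"
      using t t' \<open>t' = t\<close> u v by auto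
    have 1: "D (P @ dbl T a @ t # dbl T u') (P @ dbl T b @ t # dbl T u')"
      using eq_block[OF nt nmu, of P T a "t # dbl T u'" b "t # dbl T v'"] Th simple simple' less.prems(3)
        t(1) u(2) v(2) unfolding eqs by blast
    \<comment> \<open>As \<open>D\<close> lies inside \<open>Th\<close>, the left word with its new
      block is still related to the right one, and the common prefix has grown by a block and a
      simple letter.\<close>
    have Th': "Th ((P @ dbl T b @ [t]) @ dbl T u') ((P @ dbl T b @ [t]) @ dbl T v')"
      using Th.trans[OF Th.sym[OF D_Th[OF 1]]] Th unfolding eqs by simp
    have "D ((P @ dbl T b @ [t]) @ dbl T u') ((P @ dbl T b @ [t]) @ dbl T v')"
    proof (rule less.hyps[OF _ Th'])
      show "length u' < length u"
        using u t by simp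
      show "\<not> before z z ((P @ dbl T b @ [t]) @ dbl T u')" if "z \<in> T" for z
        using simple'[OF that] unfolding eqs Th.R_dest_simple[OF nt ni Th'] by simp
      show "P @ dbl T b @ [t] = [] \<or> last (P @ dbl T b @ [t]) \<in> T"
        using t by simp
    qed
    then show ?thesis
      using D.trans[OF 1] unfolding eqs by simp
  qed
qed

theorem extension_eq:
  assumes "Th u v" shows "D u v"
proof -
  consider (triv) "Th (fst id_triv) (snd id_triv)"
    | (idem) "\<not> Th (fst id_triv) (snd id_triv)" "Th (fst id_idem) (snd id_idem)"
    | (comm) "\<not> Th (fst id_triv) (snd id_triv)" "\<not> Th (fst id_idem) (snd id_idem)"
        "Th (fst id_comm) (snd id_comm)"
    | (mu) "\<not> Th (fst id_triv) (snd id_triv)" "\<not> Th (fst id_idem) (snd id_idem)"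
        "\<not> Th (fst id_comm) (snd id_comm)" "Th (fst id_mu) (snd id_mu)"
    | (not_mu) "\<not> Th (fst id_triv) (snd id_triv)" "\<not> Th (fst id_idem) (snd id_idem)"
        "\<not> Th (fst id_comm) (snd id_comm)" "\<not> Th (fst id_mu) (snd id_mu)"
    by blast
  then show ?thesis
  proof cases
    case triv
    have "D (fst id_triv) (snd id_triv)"
      using triv by (rule extraI[rotated]) (simp add: A_extra_def)
    then show ?thesis
      by (rule D.eq_of_triv)
  next
    case idem
    have "D (fst id_idem) (snd id_idem)"
      using idem(2) by (rule extraI[rotated]) (simp add: A_extra_def)
    then show ?thesis
      using Th.R_dest_content[OF idem(1) assms] by (rule D.eq_of_idem)
  next
    case comm
    have "D (fst id_comm) (snd id_comm)"
      using comm(3) by (rule extraI[rotated]) (simp add: A_extra_def)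
    then show ?thesis
      using Th.R_dest_content[OF comm(1) assms] Th.R_dest_simple[OF comm(1,2) assms]
      by (rule D.eq_of_comm)
  next
    case mu
    then show ?thesis
      using eq_of_mu assms by blast
  next
    case not_mu
    define T where "T = {z. \<not> before z z u}"
    have multi: "before z z u = before z z v" for z
      using Th.R_dest_simple[OF not_mu(1,2) assms] .
    have "D ([] @ u) ([] @ dbl T u)"
      by (rule D.R_dbl) (simp add: T_def)
    moreover have "D ([] @ v) ([] @ dbl T v)"
      by (rule D.R_dbl) (simp add: T_def multi)
    ultimately have uv: "D u (dbl T u)" "D v (dbl T v)"
      by simp_all
    have Th: "Th (dbl T u) (dbl T v)"
      using Th.trans[OF Th.trans[OF Th.sym[OF D_Th[OF uv(1)]] assms] D_Th[OF uv(2)]] .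
    have "\<not> before z z (dbl T u)" if "z \<in> T" for z
      using Th.R_dest_simple[OF not_mu(1,2) D_Th[OF uv(1)], of z] that by (simp add: T_def)
    then have "D ([] @ dbl T u) ([] @ dbl T v)"
      using Th by (intro eq_of_not_mu_dbl not_mu) auto
    then show ?thesis
      using D.trans[OF D.trans[OF uv(1)] D.sym[OF uv(2)]] by simp
  qed
qed

end

section \<open>Finite bases of A-congruences\<close>

lemma fully_invariant_congruence_deducible: "fully_invariant_congruence (deducible \<Sigma>)"
  by unfold_locales (auto intro: deducible.intros)

lemma deducible_in_congruence:
  assumes "fully_invariant_congruence R" "\<And>p q. (p, q) \<in> \<Sigma> \<Longrightarrow> R p q" "deducible \<Sigma> u v"
  shows "R u v"
proof -
  interpret fully_invariant_congruence R by fact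
  show ?thesis
    using assms(3) by induction (auto intro: assms(2) sym trans mult subst)
qed

theorem A_congruence_finite_basis:
  assumes "A_congruence R"
  shows "\<exists>\<Sigma>. finite \<Sigma> \<and> (\<forall>(u, v)\<in>\<Sigma>. R u v) \<and> (\<forall>u v. R u v \<longrightarrow> deducible \<Sigma> u v)"
proof -
  interpret R: A_congruence R by fact
  define \<Sigma> where "\<Sigma> = {e \<in> A_basis \<union> A_extra. R (fst e) (snd e)}"
  have fin: "finite \<Sigma>"
    unfolding \<Sigma>_def by (rule finite_subset[of _ "A_basis \<union> A_extra"]) (auto simp: A_basis_def A_extra_def)
  have sub: "R p q" if "(p, q) \<in> \<Sigma>" for p q
    using that by (simp add: \<Sigma>_def)
  interpret D: fully_invariant_congruence "deducible \<Sigma>"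
    by (rule fully_invariant_congruence_deducible)
  have ax: "deducible \<Sigma> (fst e) (snd e)" if "e \<in> A_basis \<union> A_extra" "R (fst e) (snd e)" for e
    using that by (intro deducible.axiom) (simp add: \<Sigma>_def)
  have "A_congruence_extension R (deducible \<Sigma>)"
  proof unfold_locales
    show "R u v" if "deducible \<Sigma> u v" for u v
      using deducible_in_congruence[OF R.fully_invariant_congruence_axioms sub that] .
    show "deducible \<Sigma> u v" if "(u, v) \<in> A_extra" "R u v" for u v
      using ax[of "(u, v)"] that by simp
  qed (use ax R.R_commute R.R_absorb_right R.R_absorb_left R.R_copy R.R_alternate R.R_swap in \<open>auto simp: A_basis_def\<close>)
  from A_congruence_extension.extension_eq[OF this] show ?thesis
    using fin sub by (intro exI[of _ \<Sigma>]) auto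
qed


section \<open>Evaluation in \<open>A\<^sup>1\<close> and \<open>B\<^sup>1\<close>\<close>

lemma word_value_simps [simp]:
  "word_value M \<phi> [] = \<one>\<^bsub>M\<^esub>" "word_value M \<phi> (x # w) = \<phi> x \<otimes>\<^bsub>M\<^esub> word_value M \<phi> w"
  by (simp_all add: word_value_def)

lemma word_value_closed:
  "monoid M \<Longrightarrow> range \<phi> \<subseteq> carrier M \<Longrightarrow> word_value M \<phi> w \<in> carrier M"
  by (induction w) (auto intro: monoid.m_closed)

lemma word_value_append:
  assumes "monoid M" "range \<phi> \<subseteq> carrier M"
  shows "word_value M \<phi> (u @ v) = word_value M \<phi> u \<otimes>\<^bsub>M\<^esub> word_value M \<phi> v"
proof -
  interpret monoid M by fact
  have c: "\<phi> x \<in> carrier M" for x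
    using assms by auto
  show ?thesis
    by (induction u) (simp_all add: c word_value_closed assms m_assoc)
qed

lemma word_value_subst:
  assumes "monoid M" "range \<phi> \<subseteq> carrier M"
  shows "word_value M \<phi> (concat (map \<sigma> w)) = word_value M (\<lambda>x. word_value M \<phi> (\<sigma> x)) w"
  by (induction w) (simp_all add: word_value_append assms)

abbreviation A_times :: "A_elt option \<Rightarrow> A_elt option \<Rightarrow> A_elt option" where
  "A_times \<equiv> adjoin_identity_mult A_mult"

abbreviation A_value :: "(nat \<Rightarrow> A_elt option) \<Rightarrow> mword \<Rightarrow> A_elt option" where
  "A_value \<equiv> word_value A1"

lemma A1_simps [simp]: "carrier A1 = UNIV" "\<one>\<^bsub>A1\<^esub> = None" "x \<otimes>\<^bsub>A1\<^esub> y = A_times x y"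
  by (simp_all add: A1_def adjoin_identity_def)

lemma B1_simps [simp]: "carrier B1 = UNIV" "\<one>\<^bsub>B1\<^esub> = None" "x \<otimes>\<^bsub>B1\<^esub> y = A_times y x"
  by (cases x; cases y; simp add: B1_def adjoin_identity_def B_mult_def)+

lemma A_times_None [simp]: "A_times x None = x"
  by (cases x) auto

lemma A_times_zero [simp]: "A_times (Some A_0) x = Some A_0" "A_times x (Some A_0) = Some A_0"
proof -
  have "A_mult A_0 y = A_0" "A_mult y A_0 = A_0" for y
    by (cases y; simp)+
  then show "A_times (Some A_0) x = Some A_0" "A_times x (Some A_0) = Some A_0"
    by (cases x; simp)+
qed

lemma A_times_assoc: "A_times (A_times x y) z = A_times x (A_times y z)"
  using monoid.m_assoc[OF monoid_A1, of x y z] by simp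

lemma A_value_append: "A_value \<rho> (u @ v) = A_times (A_value \<rho> u) (A_value \<rho> v)"
  using word_value_append[OF monoid_A1, of \<rho>] by simp

lemma A_value_subst: "A_value \<rho> (concat (map \<sigma> w)) = A_value (\<lambda>x. A_value \<rho> (\<sigma> x)) w"
  using word_value_subst[OF monoid_A1, of \<rho>] by simp

lemma word_value_B1: "word_value B1 \<rho> w = A_value \<rho> (rev w)"
  by (induction w) (simp_all add: A_value_append)

definition A_equiv :: "mword \<Rightarrow> mword \<Rightarrow> bool" where
  "A_equiv u v \<longleftrightarrow> (\<forall>\<rho>. A_value \<rho> u = A_value \<rho> v)"

text \<open>Evaluation in the dual \<open>B^1\<close> is evaluation of the reversed word in
  \<open>A^1\<close>, so this is the equational theory of the product, and it is closed under
  reversal.\<close>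

definition AB_equiv :: "mword \<Rightarrow> mword \<Rightarrow> bool" where
  "AB_equiv u v \<longleftrightarrow> A_equiv u v \<and> A_equiv (rev u) (rev v)"

lemma AB_equiv_rev: "AB_equiv (rev u) (rev v) \<longleftrightarrow> AB_equiv u v"
  by (auto simp: AB_equiv_def)

text \<open>For \<open>g\<close> other than the identity, \<open>d\<close> and \<open>e\<close>,
  every product \<open>g s g\<close> is zero. Identities therefore need testing only with repeated
  letters evaluated in these three elements, while simple letters range over all of
  \<open>A^1\<close>.\<close>

lemma multi_zero:
  assumes "before x x w" "\<rho> x \<notin> {None, Some A_d, Some A_e}"
  shows "A_value \<rho> w = Some A_0"
proof -
  have z: "A_times g (A_times s (A_times g r)) = Some A_0" if "g \<notin> {None, Some A_d, Some A_e}" for g s r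
  proof -
    have "A_mult p (A_mult q p) = A_0 \<and> A_mult p p = A_0" if "p \<notin> {A_d, A_e}" for p q
      using that by (cases p; cases q; simp)
    then have "A_times g (A_times s g) = Some A_0"
      using that by (cases g; cases s) auto
    then show ?thesis
      by (metis A_times_assoc A_times_zero(1))
  qed
  obtain a b where "w = a @ x # b" "x \<in> set b"
    using before_split[OF assms(1)] by blast
  then obtain c d where "w = a @ x # c @ x # d"
    using split_list by metis
  then show ?thesis
    using z[OF assms(2)] by (simp add: A_value_append)
qed

lemma A_value_idempotent:
  assumes "g \<in> {None, Some A_d, Some A_e}" "\<rho> ` set w \<subseteq> {None, g}"
  shows "A_value \<rho> w = (if g \<in> \<rho> ` set w then g else None)"
  using assms(2)
proof (induction w)
  case (Cons x w)
  have "\<rho> x = None \<or> \<rho> x = g"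
    using Cons.prems by simp
  moreover have "A_value \<rho> w = (if g \<in> \<rho> ` set w then g else None)"
    using Cons.prems by (intro Cons.IH) simp
  moreover have "A_times g g = g"
    using assms(1) by auto
  ultimately show ?case
    by (elim disjE) (auto split: if_splits)
qed simp

text \<open>A product of factors \<open>d\<close> and \<open>e\<close> that involves
  \<open>e\<close> is \<open>0\<close>, \<open>e\<close> or \<open>c\<close>, and \<open>d\<close>
  annihilates these three from the left.\<close>

lemma A_value_zero:
  assumes "\<rho> ` set w \<subseteq> {None, Some A_d, Some A_e}" "before x y w" "\<rho> x = Some A_d" "\<rho> y = Some A_e"
  shows "A_value \<rho> w = Some A_0"
proof -
  have val: "A_value \<rho> w \<in> {Some A_0, Some A_e, Some A_c}"
    if "\<rho> ` set w \<subseteq> {None, Some A_d, Some A_e}" "y \<in> set w" for w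
    using that
  proof (induction w)
    case (Cons z w)
    show ?case
    proof (cases "y \<in> set w")
      case True
      then have "A_value \<rho> w \<in> {Some A_0, Some A_e, Some A_c}"
        using Cons by simp
      moreover have "\<rho> z \<in> {None, Some A_d, Some A_e}"
        using Cons.prems(1) by simp
      ultimately show ?thesis
        by auto
    next
      case False
      then have "z = y"
        using Cons.prems by simp
      moreover have "A_value \<rho> w \<in> {None, Some A_0, Some A_d, Some A_e, Some A_c}"
        using Cons.prems(1)
      proof (induction w)
        case (Cons z' w)
        then have "A_value \<rho> w \<in> {None, Some A_0, Some A_d, Some A_e, Some A_c}"
          "\<rho> z' \<in> {None, Some A_d, Some A_e}"
          by auto
        then show ?case by auto
      qed simp
      ultimately show ?thesis
        using assms(4) by auto
    qed
  qed simp
  obtain a b where w: "w = a @ x # b" "y \<in> set b"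
    using before_split[OF assms(2)] by blast
  have "\<rho> ` set b \<subseteq> {None, Some A_d, Some A_e}"
    using assms(1) unfolding w by auto
  then have "A_value \<rho> b \<in> {Some A_0, Some A_e, Some A_c}"
    using w(2) by (rule val)
  then have "A_times (Some A_d) (A_value \<rho> b) = Some A_0"
    by auto
  then show ?thesis
    using assms(3) by (simp add: w A_value_append)
qed

lemma A_equivI:
  assumes "\<And>x. before x x u = before x x v"
    and "\<And>\<rho>. (\<And>x. before x x u \<Longrightarrow> \<rho> x \<in> {None, Some A_d, Some A_e}) \<Longrightarrow> A_value \<rho> u = A_value \<rho> v"
  shows "A_equiv u v"
  unfolding A_equiv_def
proof
  fix \<rho>
  show "A_value \<rho> u = A_value \<rho> v"
  proof (cases "\<forall>x. before x x u \<longrightarrow> \<rho> x \<in> {None, Some A_d, Some A_e}")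
    case True
    then show ?thesis using assms(2) by blast
  next
    case False
    then obtain x where "before x x u" "\<rho> x \<notin> {None, Some A_d, Some A_e}"
      by blast
    then show ?thesis
      using multi_zero[of x u \<rho>] multi_zero[of x v \<rho>] assms(1) by simp
  qed
qed

lemma all_A_elt_option:
  "(\<forall>x. P x) \<longleftrightarrow> P None \<and> P (Some A_0) \<and> P (Some A_a) \<and> P (Some A_b) \<and> P (Some A_c) \<and>
    P (Some A_d) \<and> P (Some A_e)"
proof -
  have "P x" if "P None" "P (Some A_0)" "P (Some A_a)" "P (Some A_b)" "P (Some A_c)" "P (Some A_d)"
    "P (Some A_e)" for x
  proof (cases x)
    case (Some y)
    then show ?thesis
      using that by (cases y) auto
  qed (use that in simp)
  then show ?thesis
    by blast
qed

lemma A_value_cong: "(\<And>z. z \<in> set w \<Longrightarrow> \<rho> z = \<rho>' z) \<Longrightarrow> A_value \<rho> w = A_value \<rho>' w"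
  by (induction w) auto

lemma A_equivI_cases:
  assumes "\<forall>x. before x x u = before x x v" "before 0 0 u \<and> before 1 1 u"
    and sub: "set u \<union> set v \<subseteq> {0, 1, 2, 3, 4}"
    and val: "\<forall>y\<in>{None, Some A_d, Some A_e}. \<forall>x\<in>{None, Some A_d, Some A_e}. \<forall>r s t.
      A_value ((!) [y, x, r, s, t]) u = A_value ((!) [y, x, r, s, t]) v"
  shows "A_equiv u v"
proof (rule A_equivI)
  show "before x x u = before x x v" for x
    using assms(1) by simp
  fix \<rho> :: "nat \<Rightarrow> A_elt option"
  assume *: "\<And>x. before x x u \<Longrightarrow> \<rho> x \<in> {None, Some A_d, Some A_e}"
  let ?\<rho> = "(!) [\<rho> 0, \<rho> 1, \<rho> 2, \<rho> 3, \<rho> 4]"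
  have c: "\<rho> z = ?\<rho> z" if "z \<in> {0, 1, 2, 3, 4}" for z
    using that by auto
  have "A_value \<rho> u = A_value ?\<rho> u"
    by (rule A_value_cong, rule c) (use sub in auto)
  also have "\<dots> = A_value ?\<rho> v"
    using val * assms(2) by blast
  also have "\<dots> = A_value \<rho> v"
    by (rule A_value_cong, rule c[symmetric]) (use sub in auto)
  finally show "A_value \<rho> u = A_value \<rho> v" .
qed

lemma A_equiv_id_copy: "A_equiv [0, 2, 1, 0, 3, 1] [0, 2, 0, 1, 0, 3, 1]"
  by (rule A_equivI_cases, (auto)[3], simp add: all_A_elt_option)

lemma A_equiv_id_copy_rev: "A_equiv [1, 3, 0, 1, 2, 0] [1, 3, 0, 1, 0, 2, 0]"
  by (rule A_equivI_cases, (auto)[3], simp add: all_A_elt_option)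

lemma A_equiv_id_alternate: "A_equiv [0, 1, 0, 1] [1, 0, 1, 0]"
  by (rule A_equivI_cases, (auto)[3], simp add: all_A_elt_option)

text \<open>A variant of \<open>id_commute\<close> with one more \<open>1\<close> on the left side,
  which holds in \<open>A^1\<close> and in its dual. The reverse of \<open>id_commute\<close> itself
  fails in \<open>A^1\<close>, for instance for \<open>e\<close>, \<open>d\<close>, \<open>b\<close>
  and the identity in place of \<open>0\<close>, \<open>1\<close>, \<open>2\<close>,
  \<open>3\<close>.\<close>

lemma A_equiv_id_commute: "A_equiv [0, 2, 1, 3, 1, 0, 1] [0, 2, 1, 3, 0, 1]"
  by (rule A_equivI_cases, (auto)[3], simp add: all_A_elt_option)

lemma A_equiv_id_commute_rev: "A_equiv [1, 0, 1, 3, 1, 2, 0] [1, 0, 3, 1, 2, 0]"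
  by (rule A_equivI_cases, (auto)[3], simp add: all_A_elt_option)

lemma A_equiv_id_swap: "A_equiv [0, 2, 0, 1, 3, 0, 4, 1] [0, 2, 1, 0, 3, 0, 4, 1]"
  by (rule A_equivI_cases, (auto)[3], simp add: all_A_elt_option)

lemma A_equiv_id_swap_rev: "A_equiv [1, 4, 0, 3, 1, 0, 2, 0] [1, 4, 0, 3, 0, 1, 2, 0]"
  by (rule A_equivI_cases, (auto)[3], simp add: all_A_elt_option)

text \<open>This is \<open>id_phi\<close> with the separator doubled: a repeated \<open>2\<close> no
  longer separates, and all letters lie in one block.\<close>

lemma A_equiv_phi: "A_equiv [0, 1, 1, 2, 2, 0] [1, 0, 1, 2, 2, 0]"
  by (rule A_equivI_cases, (auto)[3], simp add: all_A_elt_option)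

lemma A_equiv_phi_rev: "A_equiv [0, 2, 2, 1, 1, 0] [0, 2, 2, 1, 0, 1]"
  by (rule A_equivI_cases, (auto)[3], simp add: all_A_elt_option)

lemma A_equiv_id_absorb_right: "A_equiv [0, 2, 0, 0] [0, 2, 0]" and A_equiv_id_absorb_left: "A_equiv [0, 0, 2, 0] [0, 2, 0]"
proof -
  have *: "\<forall>y\<in>{None, Some A_d, Some A_e}. \<forall>r. A_times y (A_times r (A_times y y)) = A_times y (A_times r y) \<and>
      A_times y (A_times y (A_times r y)) = A_times y (A_times r y)"
    by (simp add: all_A_elt_option)
  show "A_equiv [0, 2, 0, 0] [0, 2, 0]"
  proof (rule A_equivI)
    fix \<rho> :: "nat \<Rightarrow> A_elt option"
    assume "\<And>x. before x x [0::nat, 2, 0, 0] \<Longrightarrow> \<rho> x \<in> {None, Some A_d, Some A_e}"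
    then have "\<rho> 0 \<in> {None, Some A_d, Some A_e}"
      by simp
    from bspec[OF * this] show "A_value \<rho> [0, 2, 0, 0] = A_value \<rho> [0, 2, 0]"
      by simp
  qed auto
  show "A_equiv [0, 0, 2, 0] [0, 2, 0]"
  proof (rule A_equivI)
    fix \<rho> :: "nat \<Rightarrow> A_elt option"
    assume "\<And>x. before x x [0::nat, 0, 2, 0] \<Longrightarrow> \<rho> x \<in> {None, Some A_d, Some A_e}"
    then have "\<rho> 0 \<in> {None, Some A_d, Some A_e}"
      by simp
    from bspec[OF * this] show "A_value \<rho> [0, 0, 2, 0] = A_value \<rho> [0, 2, 0]"
      by simp
  qed auto
qed

text \<open>The letters \<open>0\<close> and \<open>1\<close> take only the values
  \<open>None\<close>, \<open>d\<close>, \<open>e\<close>. If at most one of \<open>d\<close>,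
  \<open>e\<close> is involved, the part before \<open>2\<close> depends on its content alone.
  Otherwise that part is zero on both sides and in both directions, because \<open>0\<close> and
  \<open>1\<close> occur in it in either order.\<close>

lemma AB_equiv_overlap:
  assumes "set w \<subseteq> {0, 1}" "before 1 0 w" "before 1 1 w"
  shows "AB_equiv (0 # w @ 2 # replicate (Suc c) 0) [1, 0, 1, 2, 0]"
proof -
  let ?u = "0 # w @ 2 # replicate (Suc c) 0" and ?v = "[1, 0, 1, 2, 0] :: mword"
  have in_w: "0 \<in> set w" "1 \<in> set w"
    using assms(2) by (auto dest: before_in_set)
  have nw: "\<not> before z z w" if "z \<notin> {0, 1}" for z
    using that assms(1) by (auto dest: before_in_set)
  have multi: "before z z ?u \<longleftrightarrow> z \<in> {0, 1}" for z
  proof (cases "z \<in> {0, 1}")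
    case False
    then have "z \<notin> set w" "\<not> before z z (replicate (Suc c) 0)"
      using assms(1) by (auto dest: before_in_set)
    then show ?thesis
      using False nw[OF False] by (auto simp del: replicate_Suc)
  qed (use assms in_w in auto)
  have multi': "before z z ?v \<longleftrightarrow> z \<in> {0, 1}" for z
    by auto
  have eq: "A_value \<rho> ?u = A_value \<rho> ?v" "A_value \<rho> (rev ?u) = A_value \<rho> (rev ?v)"
    if \<rho>: "\<rho> 0 \<in> {None, Some A_d, Some A_e}" "\<rho> 1 \<in> {None, Some A_d, Some A_e}" for \<rho>
  proof -
    have V: "\<rho> ` set (0 # w) \<subseteq> {None, Some A_d, Some A_e}"
      using \<rho> assms(1) by auto
    have l: "A_value \<rho> (0 # w) = A_value \<rho> [1, 0, 1]"
      and r: "A_value \<rho> (rev w @ [0]) = A_value \<rho> [1, 0, 1]"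
    proof -
      consider g where "g \<in> {None, Some A_d, Some A_e}" "\<rho> 0 \<in> {None, g}" "\<rho> 1 \<in> {None, g}"
        | "\<rho> 0 = Some A_d" "\<rho> 1 = Some A_e" | "\<rho> 0 = Some A_e" "\<rho> 1 = Some A_d"
        using \<rho> by (metis (no_types, lifting) insert_iff singletonD)
      then have "A_value \<rho> (0 # w) = A_value \<rho> [1, 0, 1] \<and> A_value \<rho> (rev w @ [0]) = A_value \<rho> [1, 0, 1]"
      proof cases
        case 1
        have s: "set (0 # w) = {0, 1}" "set (rev w @ [0]) = {0, 1}" "set [1, 0, 1::nat] = {0, 1}"
          using assms(1) in_w by auto
        then have sub: "\<rho> ` set (0 # w) \<subseteq> {None, g}" "\<rho> ` set (rev w @ [0]) \<subseteq> {None, g}"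
          "\<rho> ` set [1, 0, 1::nat] \<subseteq> {None, g}"
          unfolding s using 1 by auto
        show ?thesis
          unfolding A_value_idempotent[OF 1(1) sub(1)] A_value_idempotent[OF 1(1) sub(2)]
            A_value_idempotent[OF 1(1) sub(3)] s by simp
      next
        case 2
        have "A_value \<rho> (0 # w) = Some A_0"
          using A_value_zero[OF V, of 0 1] 2 in_w by simp
        moreover have "A_value \<rho> (rev w @ [0]) = Some A_0"
          using A_value_zero[of \<rho> "rev w @ [0]" 0 1] 2 V assms(2) by simp
        ultimately show ?thesis
          using 2 by simp
      next
        case 3
        have "A_value \<rho> (0 # w) = Some A_0"
          using A_value_zero[OF V, of 1 0] 3 assms(2) by simp
        moreover have "A_value \<rho> (rev w @ [0]) = Some A_0"
          using A_value_zero[of \<rho> "rev w @ [0]" 1 0] 3 V in_w by simp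
        ultimately show ?thesis
          using 3 by simp
      qed
      then show "A_value \<rho> (0 # w) = A_value \<rho> [1, 0, 1]" "A_value \<rho> (rev w @ [0]) = A_value \<rho> [1, 0, 1]"
        by auto
    qed
    have rep: "A_value \<rho> (replicate (Suc c) 0) = \<rho> 0"
      using A_value_idempotent[OF \<rho>(1), of \<rho> "replicate (Suc c) 0"]
      by (simp add: set_replicate_Suc del: replicate_Suc)
    have "A_value \<rho> ?u = A_times (A_value \<rho> (0 # w)) (A_times (\<rho> 2) (A_value \<rho> (replicate (Suc c) 0)))"
      using A_value_append[of \<rho> "0 # w" "2 # replicate (Suc c) 0"] by simp
    then show "A_value \<rho> ?u = A_value \<rho> ?v"
      unfolding l rep by (simp add: A_times_assoc)
    have "A_value \<rho> (rev ?u) = A_times (A_value \<rho> (replicate (Suc c) 0)) (A_times (\<rho> 2) (A_value \<rho> (rev w @ [0])))"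
      using A_value_append[of \<rho> "replicate (Suc c) 0" "2 # rev w @ [0]"] by (simp del: replicate_Suc)
    then show "A_value \<rho> (rev ?u) = A_value \<rho> (rev ?v)"
      unfolding r rep by simp
  qed
  have "A_equiv ?u ?v"
    by (rule A_equivI) (use eq(1) multi multi' in blast)+
  moreover have "A_equiv (rev ?u) (rev ?v)"
    by (rule A_equivI; unfold before_rev) (use eq(2) multi multi' in blast)+
  ultimately show ?thesis
    by (simp add: AB_equiv_def)
qed

section \<open>Congruences that contain the theory of the product\<close>

locale AB_congruence = fully_invariant_congruence +
  assumes AB: "AB_equiv u v \<Longrightarrow> R u v"
begin

sublocale square_congruence
proof
  show "R (fst id_absorb_right) (snd id_absorb_right)" "R (fst id_absorb_left) (snd id_absorb_left)"
    using A_equiv_id_absorb_right A_equiv_id_absorb_left by (auto intro!: AB simp: AB_equiv_def id_absorb_right_def id_absorb_left_def)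
qed

text \<open>The assumption serves to derive \<open>id_commute\<close>, the other axioms being
  identities of the product. In this derivation the separator of the reversed \<open>id_phi\<close>
  is replaced by the word \<open>213\<close>.\<close>

lemma A_congruence_of_phi_rev:
  assumes phi: "R (rev (fst id_phi)) (rev (snd id_phi))"
  shows "A_congruence R"
proof
  have "R [0, 2, 1, 3, 1, 0] [0, 2, 1, 3, 1, 1, 0]"
    using sym[OF dup_right[of 1 "[0, 2, 1, 3]" "[0]"]] by simp
  also have "R \<dots> [0, 2, 1, 3, 1, 0, 1]"
    using subst[OF phi, of "(!) [[0], [1], [2, 1, 3]]"] by (simp add: id_phi_def)
  also have "R \<dots> [0, 2, 1, 3, 0, 1]"
    using A_equiv_id_commute A_equiv_id_commute_rev by (intro AB) (simp add: AB_equiv_def)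
  finally show "R (fst id_commute) (snd id_commute)"
    by (simp add: id_commute_def sym)
  show "R (fst id_copy) (snd id_copy)" "R (fst id_alternate) (snd id_alternate)" "R (fst id_swap) (snd id_swap)"
    using A_equiv_id_copy A_equiv_id_copy_rev A_equiv_id_alternate A_equiv_id_swap A_equiv_id_swap_rev
    by (auto intro!: AB simp: AB_equiv_def id_copy_def id_alternate_def id_swap_def A_equiv_def)
qed

end


section \<open>Congruences larger than the theory of \<open>A\<^sup>1 \<times> B\<^sup>1\<close>\<close>

text \<open>The valuation that refutes \<open>id_phi\<close> in \<open>A^1\<close>: the left side
  becomes \<open>e d d b e = a\<close>, the right side begins with \<open>d e = 0\<close>.\<close>

definition bde :: "nat \<Rightarrow> A_elt option" where
  "bde z = (if z = 0 then Some A_e else if z = 1 then Some A_d else if z = 2 then Some A_b else None)"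

lemma bde_simps [simp]: "bde 0 = Some A_e" "bde (Suc 0) = Some A_d" "bde 2 = Some A_b"
  by (simp_all add: bde_def)

lemma bde_replicate:
  "A_value bde (replicate i 0) = (if i = 0 then None else Some A_e)"
  "A_value bde (replicate i (Suc 0)) = (if i = 0 then None else Some A_d)"
  by (induction i) auto

lemma bde_value:
  "A_value bde (replicate i 0 @ replicate j (Suc 0)) =
    (if i = 0 then if j = 0 then None else Some A_d else if j = 0 then Some A_e else Some A_c)"
  "A_value bde (replicate i 0 @ replicate j (Suc 0) @ 2 # replicate k 0) =
    (if i = 0 then Some A_b else Some A_a)"
  by (simp_all add: A_value_append bde_replicate)

text \<open>Prepending \<open>e\<close> always extends the pattern. Prepending \<open>d\<close> to a
  value \<open>e\<close>, \<open>c\<close>, \<open>a\<close>, or \<open>b\<close> to a value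
  \<open>d\<close>, \<open>c\<close>, \<open>b\<close>, \<open>a\<close>, gives zero.\<close>

lemma bde_nonzero:
  assumes "set w \<subseteq> {0, 1, 2}" "A_value bde w \<noteq> Some A_0"
  shows "(\<exists>i j. w = replicate i 0 @ replicate j (Suc 0)) \<or>
    (\<exists>i j k. w = replicate i 0 @ replicate j (Suc 0) @ 2 # replicate k 0)"
  using assms
proof (induction w)
  case (Cons z w)
  have nz: "A_value bde w \<noteq> Some A_0"
    using Cons.prems(2) by auto
  consider i j where "w = replicate i 0 @ replicate j (Suc 0)"
    | i j k where "w = replicate i 0 @ replicate j (Suc 0) @ 2 # replicate k 0"
    using Cons.IH Cons.prems(1) nz by auto
  note w = this
  consider "z = 0" | "z = Suc 0" | "z = 2"
    using Cons.prems(1) by auto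
  then show ?case
  proof cases
    case 1
    from w show ?thesis
    proof cases
      case (1 i j)
      then have "z # w = replicate (Suc i) 0 @ replicate j (Suc 0)"
        using \<open>z = 0\<close> by simp
      then show ?thesis by blast
    next
      case (2 i j k)
      then have "z # w = replicate (Suc i) 0 @ replicate j (Suc 0) @ 2 # replicate k 0"
        using \<open>z = 0\<close> by simp
      then show ?thesis by blast
    qed
  next
    case 2
    from w show ?thesis
    proof cases
      case (1 i j)
      then have "i = 0"
        using Cons.prems(2) \<open>z = Suc 0\<close> by (auto simp: bde_value split: if_splits)
      then have "z # w = replicate 0 0 @ replicate (Suc j) (Suc 0)"
        using 1 \<open>z = Suc 0\<close> by simp
      then show ?thesis by blast
    next
      case (2 i j k)
      then have "i = 0"
        using Cons.prems(2) \<open>z = Suc 0\<close> by (auto simp: bde_value split: if_splits)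
      then have "z # w = replicate 0 0 @ replicate (Suc j) (Suc 0) @ 2 # replicate k 0"
        using 2 \<open>z = Suc 0\<close> by simp
      then show ?thesis by blast
    qed
  next
    case 3
    from w show ?thesis
    proof cases
      case (1 i j)
      then have "j = 0"
        using Cons.prems(2) \<open>z = 2\<close> by (auto simp: bde_value split: if_splits)
      then have "z # w = replicate 0 0 @ replicate 0 (Suc 0) @ 2 # replicate i 0"
        using 1 \<open>z = 2\<close> by simp
      then show ?thesis by blast
    next
      case (2 i j k)
      then show ?thesis
        using Cons.prems(2) \<open>z = 2\<close> by (auto simp: bde_value split: if_splits)
    qed
  qed
qed (auto intro!: exI[of _ 0])

lemma replicates_of_not_before:
  assumes "set w \<subseteq> {0, 1}" "\<not> before 1 0 w"
  shows "\<exists>i j. w = replicate i 0 @ replicate j (Suc 0)"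
  using assms
proof (induction w)
  case (Cons z w)
  then obtain i j where w: "w = replicate i 0 @ replicate j (Suc 0)"
    by auto
  show ?case
  proof (cases "z = 0")
    case True
    then have "z # w = replicate (Suc i) 0 @ replicate j (Suc 0)"
      using w by simp
    then show ?thesis by blast
  next
    case False
    then have "i = 0"
      using Cons.prems w by auto
    then have "z # w = replicate 0 0 @ replicate (Suc j) (Suc 0)"
      using w False Cons.prems by auto
    then show ?thesis by blast
  qed
qed auto

text \<open>Writes the elements of \<open>A^1\<close> in the generators, zero as \<open>d e\<close>
  and \<open>c\<close> as \<open>e d\<close>, so that an arbitrary valuation becomes a substitution
  followed by \<open>bde\<close>.\<close>

primrec bde_code :: "A_elt option \<Rightarrow> mword" where
  "bde_code None = []"
| "bde_code (Some g) = (case g of A_0 \<Rightarrow> [1, 0] | A_a \<Rightarrow> [0, 2] | A_b \<Rightarrow> [2] | A_c \<Rightarrow> [0, 1]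
    | A_d \<Rightarrow> [1] | A_e \<Rightarrow> [0])"

lemma bde_code: "A_value bde (bde_code g) = g" "set (bde_code g) \<subseteq> {0, 1, 2}"
  by (cases g; simp split: A_elt.split)+

context AB_congruence
begin

lemma phi_of_triv:
  assumes "R (fst id_triv) (snd id_triv)" shows "R (fst id_phi) (snd id_phi)"
proof -
  have "R w []" for w
  proof (induction w)
    case (Cons x w)
    have "R [x] []"
      using R_map[OF assms, of "\<lambda>_. x"] by (simp add: id_triv_def)
    then show ?case
      using mult[OF _ Cons, of "[x]" "[]"] by simp
  qed simp
  then show ?thesis
    using sym trans by blast
qed

lemma phi_of_idem:
  assumes "R (fst id_idem) (snd id_idem)" shows "R (fst id_phi) (snd id_phi)"
proof -
  have sq: "R [2] [2, 2]"
    using R_map[OF assms, of "\<lambda>_. 2"] by (simp add: id_idem_def)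
  have "R [0, 1, 1, 2, 0] [0, 1, 1, 2, 2, 0]"
    using ctx[OF sq, of "[0, 1, 1]" "[0]"] by simp
  also have "R \<dots> [1, 0, 1, 2, 2, 0]"
    using A_equiv_phi A_equiv_phi_rev by (intro AB) (simp add: AB_equiv_def)
  also have "R \<dots> [1, 0, 1, 2, 0]"
    using ctx[OF sym[OF sq], of "[1, 0, 1]" "[0]"] by simp
  finally show ?thesis
    by (simp add: id_phi_def)
qed

text \<open>A middle \<open>0\<close> inserted behind \<open>11\<close> produces both orders of
  \<open>0\<close> and \<open>1\<close> in front of \<open>2\<close>, so
  \<open>AB_equiv_overlap\<close> applies.\<close>

lemma phi_of_mu:
  assumes "R (fst id_mu) (snd id_mu)" shows "R (fst id_phi) (snd id_phi)"
proof -
  have "R [0, 1, 1, 2, 0] [0, 1, 1, 0, 2, 0]"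
    using sym[OF subst[OF assms, of "(!) [[0], [], [1, 1], [2]]"]] by (simp add: id_mu_def)
  also have "R \<dots> [1, 0, 1, 2, 0]"
    using AB_equiv_overlap[of "[1, 1, 0]" 0] by (intro AB) simp
  finally show ?thesis
    by (simp add: id_phi_def)
qed

text \<open>
  \<open>A\<^sup>1\<close> is generated by \<open>b\<close>, \<open>d\<close> and \<open>e\<close>, so an identity fails in it only if it fails
  for words in three letters; \<open>e\<^sup>i d\<^sup>j\<close> and \<open>e\<^sup>i d\<^sup>j b e\<^sup>k\<close> are the only words with nonzero value.
\<close>

lemma form_preserved:
  assumes nphi: "\<not> R (fst id_phi) (snd id_phi)"
    and R: "R (replicate i 0 @ replicate j (Suc 0) @ 2 # replicate k 0) q"
  shows "\<exists>i' j' k'. q = replicate i' 0 @ replicate j' (Suc 0) @ 2 # replicate k' 0 \<and> (i = 0 \<longleftrightarrow> i' = 0)"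
proof -
  let ?p = "replicate i 0 @ replicate j (Suc 0) @ 2 # replicate k (0::nat)"
  have nt: "\<not> R (fst id_triv) (snd id_triv)" and ni: "\<not> R (fst id_idem) (snd id_idem)"
    and nmu: "\<not> R (fst id_mu) (snd id_mu)"
    using nphi phi_of_triv phi_of_idem phi_of_mu by blast+
  have sets: "set ?p = set q"
    using R_dest_content[OF nt R] .
  have "\<not> before 2 2 ?p"
    by (auto dest: before_in_set)
  then have "\<not> before 2 2 q"
    unfolding R_dest_simple[OF nt ni R] .
  moreover have "2 \<in> set q"
    using sets by auto
  ultimately obtain w v where q: "q = w @ 2 # v" "2 \<notin> set w" "2 \<notin> set v"
    using simple_split by metis
  have sub: "set q \<subseteq> {0, 1, 2}"
    using sets by auto
  have "set (replicate k 0) = set v"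
  proof (rule R_dest_block[OF nmu, of "replicate i 0 @ replicate j (Suc 0) @ [2]" _ "[]" "w @ [2]" _ "[]"])
    show "R ((replicate i 0 @ replicate j (Suc 0) @ [2]) @ replicate k 0 @ []) ((w @ [2]) @ v @ [])"
      using R q by simp
    show "replicate i 0 @ replicate j (Suc 0) @ [2] = [] \<and> w @ [2] = [] \<or>
      (\<exists>U U' t. replicate i 0 @ replicate j (Suc 0) @ [2] = U @ [t] \<and> w @ [2] = U' @ [t] \<and>
        t \<notin> set (U @ replicate k 0 @ [] @ U' @ v @ []))"
      using q by (intro disjI2 exI[of _ "replicate i 0 @ replicate j (Suc 0)"] exI[of _ w] exI[of _ 2]) auto
  qed simp
  then have "v = replicate (length v) 0"
    by (intro replicate_eqI) auto
  then obtain n where v: "v = replicate n 0"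
    by blast
  have w_set: "set (replicate i 0 @ replicate j (Suc 0)) = set w"
  proof (rule R_dest_block[OF nmu, of "[]" _ "2 # replicate k 0" "[]" _ "2 # v"])
    show "R ([] @ (replicate i 0 @ replicate j (Suc 0)) @ 2 # replicate k 0) ([] @ w @ 2 # v)"
      using R q by simp
    show "2 # replicate k 0 = [] \<and> 2 # v = [] \<or> (\<exists>U U' t. 2 # replicate k 0 = t # U \<and> 2 # v = t # U' \<and>
        t \<notin> set ([] @ (replicate i 0 @ replicate j (Suc 0)) @ U @ [] @ w @ U'))"
      using q by auto
  qed simp
  have "\<not> before 1 0 w"
  proof
    assume b: "before 1 0 w"
    \<comment> \<open>Doubling makes the letter \<open>1\<close> repeated on both sides, as it is in
      \<open>id_phi\<close>; the number of its copies can then be absorbed.\<close>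
    let ?\<sigma> = "\<lambda>z::nat. if z = 1 then [1, 1] else [z]"
    let ?w = "concat (map ?\<sigma> w)"
    have "1 \<in> set w"
      using b by (auto dest: before_in_set)
    then obtain j' where j: "j = Suc j'"
      using w_set by (cases j) auto
    have 1: "concat (replicate m [1, 1]) = replicate (m + m) (Suc 0)" for m
      by (induction m) auto
    have 0: "concat (map ?\<sigma> (replicate m 0)) = replicate m 0" for m
      by (induction m) auto
    have "R (replicate i 0 @ replicate (j + j) (Suc 0) @ 2 # replicate k 0) (?w @ 2 # replicate n 0)"
      using subst[OF R, of ?\<sigma>] by (simp add: q(1) v 1 0 del: One_nat_def)
    \<comment> \<open>The added letters provide the outer occurrences of \<open>0\<close> even if
      \<open>i\<close> or \<open>k\<close> vanishes; on the right side the leading one is the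
      initial \<open>0\<close> that \<open>AB_equiv_overlap\<close> expects.\<close>
    from ctx[OF this, of "[0]" "[0]"]
    have R': "R (replicate (Suc i) 0 @ replicate (Suc (Suc (j' + j'))) (Suc 0) @ 2 # replicate (Suc k) 0)
        (0 # ?w @ 2 # replicate (Suc n) 0)"
      by (simp add: j replicate_append_same)
    have "R [0, 1, 1, 2, 0] (replicate (Suc i) 0 @ [Suc 0, Suc 0, 2, 0])"
      using sym[OF replicate_in[of 0 "[]" "[1, 1, 2, 0]" i]] by simp
    also have "R \<dots> (replicate (Suc i) 0 @ replicate (Suc (Suc (j' + j'))) (Suc 0) @ [2, 0])"
      using sym[OF replicate_square[of "replicate (Suc i) 0" "j' + j'" "Suc 0" "[2, 0]"]] by simp
    also have "R \<dots> (replicate (Suc i) 0 @ replicate (Suc (Suc (j' + j'))) (Suc 0) @ 2 # replicate (Suc k) 0)"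
      using sym[OF replicate_in[of 0 "replicate (Suc i) 0 @ replicate (Suc (Suc (j' + j'))) (Suc 0) @ [2]" "[]" k]]
      by simp
    also note R'
    also have "R (0 # ?w @ 2 # replicate (Suc n) 0) [1, 0, 1, 2, 0]"
    proof (rule AB, rule AB_equiv_overlap)
      show "set ?w \<subseteq> {0, 1}"
        using sub q by auto
      have "before z 0 (concat (map ?\<sigma> u))" if "before z 0 u" for u and z :: nat
        using that by (induction u) auto
      then show "before 1 0 ?w"
        using b by blast
      have "before 1 1 (concat (map ?\<sigma> u))" if "1 \<in> set u" for u
        using that by (induction u) auto
      then show "before 1 1 ?w"
        using \<open>1 \<in> set w\<close> by blast
    qed
    finally show False
      using nphi by (simp add: id_phi_def)
  qed
  moreover have "set w \<subseteq> {0, 1}"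
    using sub q by auto
  ultimately obtain i' j' where w: "w = replicate i' 0 @ replicate j' (Suc 0)"
    using replicates_of_not_before by blast
  have "0 \<in> set w \<longleftrightarrow> i' \<noteq> 0"
    by (auto simp: w)
  moreover have "0 \<in> set w \<longleftrightarrow> i \<noteq> 0"
    unfolding w_set[symmetric] by auto
  ultimately have "i = 0 \<longleftrightarrow> i' = 0"
    by blast
  moreover have "q = replicate i' 0 @ replicate j' (Suc 0) @ 2 # replicate n 0"
    using q(1) w v by simp
  ultimately show ?thesis
    by blast
qed

lemma bde_value_eq:
  assumes nphi: "\<not> R (fst id_phi) (snd id_phi)" and R: "R p q" and p: "set p \<subseteq> {0, 1, 2}"
    and nz: "A_value bde p \<noteq> Some A_0"
  shows "A_value bde q = A_value bde p"
proof -
  have sets: "set p = set q"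
    using R_dest_content[OF _ R] nphi phi_of_triv by blast
  consider i j where "p = replicate i 0 @ replicate j (Suc 0)"
    | i j k where "p = replicate i 0 @ replicate j (Suc 0) @ 2 # replicate k 0"
    using bde_nonzero[OF p nz] by blast
  then show ?thesis
  proof cases
    case (1 i j)
    \<comment> \<open>Appending the letter \<open>2\<close> brings a word without it into the form
      that is preserved; since \<open>q @ [2]\<close> ends with \<open>2\<close>, no
      \<open>0\<close> can follow there.\<close>
    have "R (replicate i 0 @ replicate j (Suc 0) @ 2 # replicate 0 0) (q @ [2])"
      using right[OF R, of "[2]"] 1 by simp
    then obtain i' j' k' where q: "q @ [2] = replicate i' 0 @ replicate j' (Suc 0) @ 2 # replicate k' 0"
      using form_preserved[OF nphi] by blast
    have "k' = 0"
    proof (rule ccontr)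
      assume "k' \<noteq> 0"
      then have "last (q @ [2]) = 0"
        unfolding q by simp
      then show False by simp
    qed
    then have q': "q = replicate i' 0 @ replicate j' (Suc 0)"
      using q by simp
    have "i = 0 \<longleftrightarrow> 0 \<notin> set p" "j = 0 \<longleftrightarrow> 1 \<notin> set p" "i' = 0 \<longleftrightarrow> 0 \<notin> set q" "j' = 0 \<longleftrightarrow> 1 \<notin> set q"
      using 1 q' by auto
    then have "i = 0 \<longleftrightarrow> i' = 0" "j = 0 \<longleftrightarrow> j' = 0"
      using sets by blast+
    then show ?thesis
      unfolding 1 q' bde_value by simp
  next
    case (2 i j k)
    then obtain i' j' k' where "q = replicate i' 0 @ replicate j' (Suc 0) @ 2 # replicate k' 0" "i = 0 \<longleftrightarrow> i' = 0"
      using form_preserved[OF nphi, of i j k q] R by blast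
    then show ?thesis
      using 2 by (simp add: bde_value)
  qed
qed

lemma A_equiv_of_not_phi:
  assumes nphi: "\<not> R (fst id_phi) (snd id_phi)" and R: "R u v"
  shows "A_equiv u v"
  unfolding A_equiv_def
proof
  fix \<rho> :: "nat \<Rightarrow> A_elt option"
  let ?\<sigma> = "\<lambda>x. bde_code (\<rho> x)"
  let ?u = "concat (map ?\<sigma> u)" and ?v = "concat (map ?\<sigma> v)"
  have val: "A_value bde (concat (map ?\<sigma> w)) = A_value \<rho> w" for w
    by (simp add: A_value_subst bde_code)
  have "R ?u ?v"
    using R by (rule subst)
  moreover have "set (concat (map ?\<sigma> w)) \<subseteq> {0, 1, 2}" for w
    using bde_code(2) by auto
  \<comment> \<open>\<open>bde_value_eq\<close> assumes a nonzero value; used in both directions it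
    leaves only the case that both values are zero.\<close>
  ultimately have "A_value bde ?u = A_value bde ?v"
    using bde_value_eq[OF nphi, of ?u ?v] bde_value_eq[OF nphi, of ?v ?u] sym by metis
  then show "A_value \<rho> u = A_value \<rho> v"
    by (simp only: val)
qed

lemma reverse: "AB_congruence (\<lambda>u v. R (rev u) (rev v))"
proof
  show "R (rev (concat (map \<sigma> u))) (rev (concat (map \<sigma> v)))" if "R (rev u) (rev v)" for u v \<sigma>
    using subst[OF that, of "\<lambda>x. rev (\<sigma> x)"] by (simp add: rev_concat rev_map comp_def)
  show "R (rev u) (rev v)" if "AB_equiv u v" for u v
    using that AB AB_equiv_rev by blast
  show "R (rev v) (rev u)" if "R (rev u) (rev v)" for u v
    using that by (rule sym)
  show "R (rev u) (rev w)" if "R (rev u) (rev v)" "R (rev v) (rev w)" for u v w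
    using that by (rule trans)
  show "R (rev (u @ u')) (rev (v @ v'))" if "R (rev u) (rev v)" "R (rev u') (rev v')" for u v u' v'
    using mult[OF that(2,1)] by simp
qed simp

end

lemma rev_concat_map: "rev (concat (map \<sigma> w)) = concat (map (\<lambda>x. rev (\<sigma> x)) (rev w))"
  by (simp add: rev_concat rev_map comp_def)

lemma deducible_rev:
  assumes "deducible \<Sigma> u v"
  shows "deducible ((\<lambda>(u, v). (rev u, rev v)) ` \<Sigma>) (rev u) (rev v)"
  using assms
proof induction
  case (axiom u v)
  then show ?case
    by (intro deducible.axiom) force
next
  case (subst u v \<sigma>)
  then show ?case
    unfolding rev_concat_map by (intro deducible.subst)
qed (auto intro: deducible.intros)

text \<open>If the reverse of \<open>id_phi\<close> is in \<open>R\<close>, then \<open>R\<close> is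
  an A-congruence. If not, the reversed words agree in \<open>A^1\<close>, so \<open>u\<close> and
  \<open>v\<close> differ there and force \<open>id_phi\<close> into \<open>R\<close>; then the
  mirror image of \<open>R\<close> is an A-congruence, and its basis is reversed.\<close>

theorem AB_congruence_finite_basis:
  assumes "AB_congruence R" "R u v" "\<not> AB_equiv u v"
  shows "\<exists>\<Sigma>. finite \<Sigma> \<and> (\<forall>(u, v)\<in>\<Sigma>. R u v) \<and> (\<forall>u v. R u v \<longrightarrow> deducible \<Sigma> u v)"
proof -
  let ?R = "\<lambda>u v. R (rev u) (rev v)"
  have rev: "AB_congruence ?R"
    using assms(1) by (rule AB_congruence.reverse)
  show ?thesis
  proof (cases "R (rev (fst id_phi)) (rev (snd id_phi))")
    case True
    then show ?thesis
      by (intro A_congruence_finite_basis AB_congruence.A_congruence_of_phi_rev assms(1))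
  next
    case False
    then have "A_equiv (rev u) (rev v)"
      using AB_congruence.A_equiv_of_not_phi[OF rev, of "rev u" "rev v"] assms(2) by simp
    then have "\<not> A_equiv u v"
      using assms(3) by (simp add: AB_equiv_def)
    then have "R (fst id_phi) (snd id_phi)"
      using AB_congruence.A_equiv_of_not_phi[OF assms(1) _ assms(2)] by blast
    then have "A_congruence ?R"
      by (intro AB_congruence.A_congruence_of_phi_rev[OF rev]) simp
    from A_congruence_finite_basis[OF this] obtain \<Sigma> where \<Sigma>: "finite \<Sigma>" "\<forall>(u, v)\<in>\<Sigma>. R (rev u) (rev v)"
      "\<forall>u v. R (rev u) (rev v) \<longrightarrow> deducible \<Sigma> u v"
      by (elim exE conjE)
    let ?S = "(\<lambda>(u, v). (rev u, rev v)) ` \<Sigma>"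
    have "deducible ?S u v" if "R u v" for u v
      using deducible_rev[of \<Sigma> "rev u" "rev v"] \<Sigma>(3) that by simp
    moreover have "\<forall>(u, v)\<in>?S. R u v"
      using \<Sigma>(2) by auto
    ultimately show ?thesis
      using \<Sigma>(1) by (intro exI[of _ ?S]) simp
  qed
qed


section \<open>No finite basis\<close>

lemma before_split_last: "before a b w \<Longrightarrow> \<exists>c d. w = c @ b # d \<and> a \<in> set c"
proof -
  assume "before a b w"
  then obtain us vs where "w = us @ a # vs" "b \<in> set vs"
    using before_split by metis
  moreover then obtain c d where "vs = c @ b # d"
    using split_list by metis
  ultimately have "w = (us @ a # c) @ b # d \<and> a \<in> set (us @ a # c)"
    by simp
  then show ?thesis by blast
qed

lemma concat_map_split:
  assumes "concat (map \<theta> q) = A @ y # B"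
  shows "\<exists>Q x Q' X X'. q = Q @ x # Q' \<and> \<theta> x = X @ y # X' \<and>
    A = concat (map \<theta> Q) @ X \<and> B = X' @ concat (map \<theta> Q')"
  using assms
proof (induction q arbitrary: A)
  case (Cons z q)
  then have "\<theta> z @ concat (map \<theta> q) = A @ y # B"
    by simp
  then obtain us where "\<theta> z = A @ us \<and> us @ concat (map \<theta> q) = y # B \<or>
      \<theta> z @ us = A \<and> concat (map \<theta> q) = us @ y # B"
    by (auto simp: append_eq_append_conv2)
  then consider us' where "\<theta> z = A @ y # us'" "us' @ concat (map \<theta> q) = B"
    | us where "\<theta> z @ us = A" "concat (map \<theta> q) = us @ y # B"
    by (cases us) auto
  then show ?case
  proof cases
    case 1
    then show ?thesis
      by (intro exI[of _ "[]"] exI[of _ z] exI[of _ q] exI[of _ A] exI[of _ us']) simp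
  next
    case 2
    from Cons.IH[OF 2(2)] obtain Q x Q' X X' where "q = Q @ x # Q'" "\<theta> x = X @ y # X'"
      "us = concat (map \<theta> Q) @ X" "B = X' @ concat (map \<theta> Q')"
      by blast
    then show ?thesis
      using 2(1) by (intro exI[of _ "z # Q"] exI[of _ x] exI[of _ Q'] exI[of _ X] exI[of _ X']) simp
  qed
qed simp

lemma before_concat_map:
  "before a b w \<Longrightarrow> i \<in> set (\<theta> a) \<Longrightarrow> j \<in> set (\<theta> b) \<Longrightarrow> before i j (concat (map \<theta> w))"
  by (induction w) auto

context AB_congruence
begin

text \<open>With \<open>x\<close>, \<open>b\<close>, \<open>t\<close> renamed to \<open>0\<close>,
  \<open>1\<close>, \<open>2\<close> and all else deleted, the left word has the shape
  \<open>0^i 1^j 2 0^k\<close> that \<open>form_preserved\<close> protects.\<close>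

lemma no_overlap:
  assumes nphi: "\<not> R (fst id_phi) (snd id_phi)"
    and R: "R (p1 @ t # p2) (q1 @ t # q2)" and t: "t \<notin> set (p1 @ p2 @ q1 @ q2)"
    and bx: "b \<noteq> x" "b \<noteq> t" "x \<noteq> t" and b: "b \<notin> set p2" "\<not> before b x p1"
  shows "\<not> before b x q1"
proof
  assume bq: "before b x q1"
  let ?F = "filter (\<lambda>z. z = x \<or> z = b \<or> z = t)" and ?g = "\<lambda>z. if z = x then 0 else if z = b then 1 else 2 :: nat"
  let ?G = "\<lambda>w. map ?g (?F w)"
  have R': "R (?G p1 @ 2 # ?G p2) (?G q1 @ 2 # ?G q2)"
    using R_map[OF R_filter[OF R, of "\<lambda>z. z = x \<or> z = b \<or> z = t"], of ?g] bx by auto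
  have sub: "set (?G w) \<subseteq> {0, 1}" if "t \<notin> set w" for w
    using that by auto
  have before: "before 1 0 (?G w) = before b x w" for w
    using bx by (induction w) auto
  have "\<not> before 1 0 (?G p1)"
    unfolding before by (rule b(2))
  then obtain i j where 1: "?G p1 = replicate i 0 @ replicate j (Suc 0)"
    using replicates_of_not_before[OF sub[of p1]] t by auto
  have "?G p2 = replicate (length (?G p2)) 0"
    using b(1) t by (intro replicate_eqI) auto
  then obtain k where 2: "?G p2 = replicate k 0"
    by blast
  obtain i' j' k' where q: "?G q1 @ 2 # ?G q2 = replicate i' 0 @ replicate j' (Suc 0) @ 2 # replicate k' 0"
    using form_preserved[OF nphi, of i j k] R' unfolding 1 2 by fastforce
  have n2: "2 \<notin> set (?G q1)" "2 \<notin> set (?G q2)"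
    using t by auto
  have "?G q1 @ 2 # ?G q2 = (replicate i' 0 @ replicate j' (Suc 0)) @ 2 # replicate k' 0"
    using q by (simp only: append_assoc)
  then have "?G q1 = replicate i' 0 @ replicate j' (Suc 0)"
    unfolding append_Cons_eq_iff[OF n2] by (rule conjunct1)
  moreover have "\<not> before 1 0 (replicate i' (0::nat) @ replicate j' (Suc 0))"
    by (auto dest: before_in_set)
  ultimately show False
    using bq unfolding before[symmetric] by simp
qed

text \<open>In \<open>p\<close>, letters behind \<open>t\<close> do not produce \<open>lo\<close>
  and letters before \<open>t\<close> do not produce \<open>hi\<close>, as their images would be on
  the wrong side of \<open>i\<close>. So in \<open>p\<close> no \<open>lo\<close> may precede the
  \<open>y\<close> produced by an \<open>x\<close> before \<open>t\<close>. In \<open>q\<close> some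
  letter \<open>b\<close> producing \<open>lo\<close> does precede \<open>x\<close>, and
  \<open>no_overlap\<close> carries this order back to \<open>p\<close>. The names \<open>lo\<close>
  and \<open>hi\<close> leave room for the mirror image.\<close>

lemma no_gap_left:
  fixes lo hi i y :: nat
  defines "W \<equiv> \<lambda>\<theta>. \<lambda>p. concat (map \<theta> p)"
  assumes nphi: "\<not> R (fst id_phi) (snd id_phi)" and R: "R p q"
    and lo: "\<not> before i lo (W \<theta> p)" and hi: "\<not> before hi i (W \<theta> p)" "hi \<in> set (W \<theta> p)"
    and gap: "\<And>A B. W \<theta> p = A @ y # B \<Longrightarrow> lo \<in> set A \<Longrightarrow> hi \<in> set B \<Longrightarrow> False" and "y \<noteq> hi"
    and t: "t \<in> set p" "\<not> before t t p" "i \<in> set (\<theta> t)"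
    and q: "q = Q @ x # Q'" "t \<in> set Q'" "\<theta> x = X @ y # X'" "lo \<in> set (W \<theta> Q @ X)"
  shows False
proof -
  have nt: "\<not> R (fst id_triv) (snd id_triv)" and ni: "\<not> R (fst id_idem) (snd id_idem)"
    and nmu: "\<not> R (fst id_mu) (snd id_mu)"
    using nphi phi_of_triv phi_of_idem phi_of_mu by blast+
  have multi: "before z z p = before z z q" for z
    using R_dest_simple[OF nt ni R] .
  obtain p1 p2 where p: "p = p1 @ t # p2" "t \<notin> set p1" "t \<notin> set p2"
    using simple_split[OF t(1,2)] .
  obtain Q1 Q2 where Q': "Q' = Q1 @ t # Q2"
    using split_list[OF q(2)] by blast
  define q1 where "q1 = Q @ x # Q1"
  have q': "q = q1 @ t # Q2"
    by (simp add: q1_def q(1) Q')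
  have tq: "t \<notin> set q1" "t \<notin> set Q2"
    using multi[of t] t(2) unfolding q' by auto
  have R': "R (p1 @ t # p2) (q1 @ t # Q2)"
    using R unfolding p(1) q' .
  have set1: "set p1 = set q1"
  proof (rule R_dest_block[OF nmu, of "[]" p1 "t # p2" "[]" q1 "t # Q2"])
    show "t # p2 = [] \<and> t # Q2 = [] \<or> (\<exists>U U' s. t # p2 = s # U \<and> t # Q2 = s # U' \<and>
        s \<notin> set ([] @ p1 @ U @ [] @ q1 @ U'))"
      using p tq by auto
  qed (use R' in simp_all)
  have after: "lo \<notin> set (\<theta> z)" if "z \<in> set p2" for z
  proof
    assume "lo \<in> set (\<theta> z)"
    then have "before i lo (W \<theta> p)"
      unfolding W_def using that t(3) p(1) by (intro before_concat_map[of t z]) auto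
    with lo show False ..
  qed
  have left: "lo \<notin> set (W \<theta> c @ X)" if "p1 = c @ x # d" for c d
  proof
    assume l: "lo \<in> set (W \<theta> c @ X)"
    have Wp: "W \<theta> p = (W \<theta> c @ X) @ y # X' @ W \<theta> d @ \<theta> t @ W \<theta> p2"
      by (simp add: W_def p(1) that q(3))
    have "hi \<notin> set (W \<theta> c @ X)"
      using hi(1) t(3) unfolding Wp by auto
    then have "hi \<in> set (X' @ W \<theta> d @ \<theta> t @ W \<theta> p2)"
      using hi(2) \<open>y \<noteq> hi\<close> unfolding Wp by auto
    with gap[OF Wp l] show False .
  qed
  have x: "x \<in> set p1"
    using set1 by (simp add: q1_def)
  then obtain c d where "p1 = c @ x # d"
    using split_list by metis
  then have "lo \<notin> set X"
    using left by auto
  then obtain b where b: "b \<in> set Q" "lo \<in> set (\<theta> b)"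
    using q(4) by (auto simp: W_def)
  \<comment> \<open>If \<open>b\<close> and \<open>x\<close> coincide, the repetition of
    \<open>x\<close> carries over from \<open>q\<close> to \<open>p\<close>, and all its occurrences
    there lie before \<open>t\<close>.\<close>
  have "before b x p1"
  proof (cases "b = x")
    case True
    then have "before x x q"
      using b(1) q(1) by auto
    then have "before x x p"
      using multi by simp
    moreover have "x \<noteq> t"
      using x p by auto
    moreover have "x \<notin> set p2"
      using after b True by blast
    ultimately show ?thesis
      using True p(1) by (auto dest: before_in_set)
  next
    case False
    have "before b x q1"
      using b(1) by (auto simp: q1_def)
    moreover have "b \<noteq> t" "x \<noteq> t"
      using b(1) tq by (auto simp: q1_def)
    ultimately show ?thesis
      using no_overlap[OF nphi R', of b x] p tq after b(2) False by auto
  qed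
  then obtain c d where "p1 = c @ x # d" "b \<in> set c"
    using before_split_last by metis
  then show False
    using left[of c d] b(2) by (auto simp: W_def)
qed

end

section \<open>An invariant of deductions from identities in few letters\<close>

lemma A_equiv_AB_congruence: "AB_congruence A_equiv"
proof
  show "A_equiv (concat (map \<sigma> u)) (concat (map \<sigma> v))" if "A_equiv u v" for u v \<sigma>
    using that by (simp add: A_equiv_def A_value_subst)
qed (auto simp: A_equiv_def A_value_append AB_equiv_def)

lemma not_A_equiv_phi: "\<not> A_equiv (fst id_phi) (snd id_phi)"
  unfolding A_equiv_def id_phi_def
  by (auto intro!: exI[of _ bde])

text \<open>The letter \<open>0\<close> plays the role of \<open>y\<close>, and \<open>i > 0\<close> that of \<open>z\<^sub>i\<close>.\<close>

definition gap_free :: "nat \<Rightarrow> mword \<Rightarrow> bool" where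
  "gap_free n w \<longleftrightarrow> set w = {..n} \<and> (\<forall>i j. 0 < i \<longrightarrow> i < j \<longrightarrow> j \<le> n \<longrightarrow> \<not> before j i w) \<and>
     (\<forall>A B. w = A @ 0 # B \<longrightarrow> 1 \<in> set A \<longrightarrow> n \<in> set B \<longrightarrow> False)"

lemma gap_free_step:
  assumes eq: "AB_equiv p q" and n: "card (set p) + 2 < n"
    and w: "gap_free n (concat (map \<theta> p))"
  shows "gap_free n (concat (map \<theta> q))"
proof -
  interpret A: AB_congruence A_equiv
    by (rule A_equiv_AB_congruence)
  let ?W = "\<lambda>p. concat (map \<theta> p)"
  note nphi = not_A_equiv_phi
  have nt: "\<not> A_equiv (fst id_triv) (snd id_triv)" and ni: "\<not> A_equiv (fst id_idem) (snd id_idem)"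
    and nmu: "\<not> A_equiv (fst id_mu) (snd id_mu)"
    using nphi A.phi_of_triv A.phi_of_idem A.phi_of_mu by blast+
  have pq: "A_equiv p q" "A_equiv (rev p) (rev q)"
    using eq by (simp_all add: AB_equiv_def)
  have set_pq: "set p = set q"
    using A.R_dest_content[OF nt pq(1)] .
  have multi: "before z z p = before z z q" for z
    using A.R_dest_simple[OF nt ni pq(1)] .
  have Wpq: "A_equiv (?W p) (?W q)"
    using pq(1) by (rule A.subst)
  have sets: "set (?W p) = {..n}" "set (?W q) = {..n}"
    using w A.R_dest_content[OF nt Wpq] by (auto simp: gap_free_def)
  have sorted: "\<not> before j i (?W p)" if "0 < i" "i < j" "j \<le> n" for i j
    using w that by (auto simp: gap_free_def)
  have gap: False if "?W p = A @ 0 # B" "1 \<in> set A" "n \<in> set B" for A B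
    using w that unfolding gap_free_def by blast
  \<comment> \<open>A fresh letter \<open>Suc n\<close> at the end plays the simple letter of
    \<open>no_overlap\<close>.\<close>
  have "\<not> before j i (?W q)" if ij: "0 < i" "i < j" "j \<le> n" for i j
  proof (rule A.no_overlap[OF nphi, of "?W p" "Suc n" "[]" "?W q" "[]"])
    show "A_equiv (?W p @ [Suc n]) (?W q @ [Suc n])"
      using Wpq by (rule A.right)
    show "Suc n \<notin> set (?W p @ [] @ ?W q @ [])"
      using sets by simp
    show "\<not> before j i (?W p)"
      using sorted ij .
  qed (use ij in auto)
  moreover have False if q: "?W q = A @ 0 # B" "1 \<in> set A" "n \<in> set B" for A B
  proof -
    \<comment> \<open>Otherwise \<open>2, ..., n - 1\<close> all come from repeated letters of
      \<open>p\<close>. The image of a repeated letter contains at most one of them, since two would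
      also appear in the wrong order; so \<open>p\<close> would have at least \<open>n - 2\<close>
      letters.\<close>
    have "\<exists>i t. t \<in> set p \<and> \<not> before t t p \<and> i \<in> set (\<theta> t) \<and> 1 < i \<and> i < n"
    proof (rule ccontr)
      assume "\<nexists>i t. t \<in> set p \<and> \<not> before t t p \<and> i \<in> set (\<theta> t) \<and> 1 < i \<and> i < n"
      then have *: "before t t p" if "t \<in> set p" "i \<in> set (\<theta> t)" "1 < i" "i < n" for t i
        using that by blast
      have "\<exists>t\<in>set p. i \<in> set (\<theta> t)" if "i < n" for i
      proof -
        have "i \<in> set (?W p)"
          unfolding sets using that by simp
        then show ?thesis
          by auto
      qed
      then obtain f where f: "\<And>i. i < n \<Longrightarrow> f i \<in> set p \<and> i \<in> set (\<theta> (f i))"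
        by metis
      have ne: "f i \<noteq> f j" if "i < j" "1 < i" "j < n" for i j
      proof
        assume e: "f i = f j"
        have "before (f j) (f j) p"
          using *[of "f j" j] f[of j] that by simp
        then have "before j i (?W p)"
          using f[of i] f[of j] that e by (intro before_concat_map[of "f j" "f j"]) auto
        then show False
          using sorted[of i j] that by simp
      qed
      have "inj_on f {2..<n}"
      proof (rule inj_onI)
        fix i j assume "i \<in> {2..<n}" "j \<in> {2..<n}" "f i = f j"
        then show "i = j"
          using ne[of i j] ne[of j i] by (cases i j rule: linorder_cases) auto
      qed
      then have "card {2..<n} \<le> card (set p)"
        using f by (intro card_inj_on_le[of f]) auto
      then show False
        using n by simp
    qed
    then obtain i t where t: "t \<in> set p" "\<not> before t t p" "i \<in> set (\<theta> t)" and i: "1 < i" "i < n"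
      by blast
    obtain Q x Q' X X' where Q: "q = Q @ x # Q'" "\<theta> x = X @ 0 # X'" "A = ?W Q @ X" "B = X' @ ?W Q'"
      using concat_map_split[OF q(1)] by blast
    have n0: "0 \<noteq> n" "1 < n"
      using n by auto
    consider "t \<in> set Q'" | "t \<in> set Q" | "t = x" "t \<notin> set Q" "t \<notin> set Q'"
      using t(1) set_pq Q(1) by auto
    then show False
    proof cases
      case 1
      show False
      proof (rule A.no_gap_left[OF nphi pq(1), of i 1 \<theta> n 0 t Q x Q' X X'])
        show "\<not> before i 1 (?W p)" "\<not> before n i (?W p)"
          using sorted[of 1 i] sorted[of i n] i by auto
      qed (use gap sets n0 t Q q 1 in auto)
    next
      case 2
      \<comment> \<open>The mirror image, with \<open>1\<close> and \<open>n\<close> exchanged. It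
        is available because the reversed words are equivalent in \<open>A^1\<close> too.\<close>
      let ?\<theta> = "\<lambda>z. rev (\<theta> z)"
      have W: "concat (map ?\<theta> (rev w)) = rev (?W w)" for w
        by (simp add: rev_concat_map)
      show False
      proof (rule A.no_gap_left[OF nphi pq(2), of i n ?\<theta> 1 0 t "rev Q'" x "rev Q" "rev X'" "rev X"])
        show "\<not> before i n (concat (map ?\<theta> (rev p)))" "\<not> before 1 i (concat (map ?\<theta> (rev p)))"
          using sorted[of 1 i] sorted[of i n] i unfolding W by auto
        show "1 \<in> set (concat (map ?\<theta> (rev p)))"
          unfolding W using sets n0 by simp
        show False if "concat (map ?\<theta> (rev p)) = C @ 0 # D" "n \<in> set C" "1 \<in> set D" for C D
        proof -
          have "?W p = rev D @ 0 # rev C"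
            using that(1) unfolding W by (metis rev.simps(2) rev_append rev_rev_ident append.assoc append_Cons append_Nil)
          from gap[OF this] that(2,3) show False
            by simp
        qed
        show "n \<in> set (concat (map ?\<theta> (rev Q')) @ rev X')"
          unfolding W using q(3) Q(4) by auto
      qed (use t Q 2 in auto)
    next
      case 3
      \<comment> \<open>The new \<open>0\<close> comes from the simple letter \<open>t\<close>
        itself. The contents before and after \<open>t\<close> agree in \<open>p\<close> and
        \<open>q\<close>, so the image of \<open>p\<close> would already have a \<open>0\<close>
        between \<open>1\<close> and \<open>n\<close>.\<close>
      obtain p1 p2 where p: "p = p1 @ t # p2" "t \<notin> set p1" "t \<notin> set p2"
        using simple_split[OF t(1,2)] .
      have R: "A_equiv (p1 @ t # p2) (Q @ t # Q')"
        using pq(1) p(1) Q(1) 3(1) by simp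
      have "set p1 = set Q"
      proof (rule A.R_dest_block[OF nmu, of "[]" p1 "t # p2" "[]" Q "t # Q'"])
        show "t # p2 = [] \<and> t # Q' = [] \<or> (\<exists>U U' s. t # p2 = s # U \<and> t # Q' = s # U' \<and>
            s \<notin> set ([] @ p1 @ U @ [] @ Q @ U'))"
          using p 3 by auto
      qed (use R in simp_all)
      moreover have "set p2 = set Q'"
      proof (rule A.R_dest_block[OF nmu, of "p1 @ [t]" p2 "[]" "Q @ [t]" Q' "[]"])
        show "p1 @ [t] = [] \<and> Q @ [t] = [] \<or> (\<exists>U U' s. p1 @ [t] = U @ [s] \<and> Q @ [t] = U' @ [s] \<and>
            s \<notin> set (U @ p2 @ [] @ U' @ Q' @ []))"
          using p 3 by auto
      qed (use R in simp_all)
      moreover have "?W p = (?W p1 @ X) @ 0 # X' @ ?W p2"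
        using p(1) Q(2) 3(1) by simp
      ultimately show False
        using gap[of "?W p1 @ X" "X' @ ?W p2"] q(2,3) Q(3,4) by auto
    qed
  qed
  ultimately show ?thesis
    using sets(2) unfolding gap_free_def by blast
qed

text \<open>Two fresh letters at the ends of \<open>p\<close> and \<open>q\<close> absorb the
  context into the substitution, which raises the bound from \<open>2\<close> to
  \<open>4\<close>.\<close>

lemma gap_free_context:
  assumes eq: "AB_equiv p q" and n: "card (set p) + 4 < n"
    and w: "gap_free n (\<alpha> @ concat (map \<theta> p) @ \<beta>)"
  shows "gap_free n (\<alpha> @ concat (map \<theta> q) @ \<beta>)"
proof -
  interpret A: AB_congruence A_equiv
    by (rule A_equiv_AB_congruence)
  define m where "m = Suc (Max (insert 0 (set (p @ q))))"
  have less: "z < m" if "z \<in> set (p @ q)" for z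
    using that by (simp add: m_def le_imp_less_Suc)
  define \<theta>' where "\<theta>' = \<theta>(m := \<alpha>, Suc m := \<beta>)"
  have \<theta>': "concat (map \<theta>' (m # u @ [Suc m])) = \<alpha> @ concat (map \<theta> u) @ \<beta>" if "set u \<subseteq> set (p @ q)" for u
  proof -
    have "\<theta>' z = \<theta> z" if "z \<in> set u" for z
      using less[of z] that \<open>set u \<subseteq> _\<close> by (auto simp: \<theta>'_def)
    then have "concat (map \<theta>' u) = concat (map \<theta> u)"
      by (intro arg_cong[of _ _ concat]) simp
    moreover have "\<theta>' m = \<alpha>" "\<theta>' (Suc m) = \<beta>"
      by (simp_all add: \<theta>'_def)
    ultimately show ?thesis
      by simp
  qed
  have "A_equiv ([m] @ p @ [Suc m]) ([m] @ q @ [Suc m])"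
    using eq by (intro A.ctx) (simp add: AB_equiv_def)
  moreover have "A_equiv ([Suc m] @ rev p @ [m]) ([Suc m] @ rev q @ [m])"
    using eq by (intro A.ctx) (simp add: AB_equiv_def)
  ultimately have "AB_equiv (m # p @ [Suc m]) (m # q @ [Suc m])"
    by (simp add: AB_equiv_def)
  moreover have "card (set (m # p @ [Suc m])) + 2 < n"
  proof -
    have "card (set (m # p @ [Suc m])) \<le> card (set p) + 2"
      using card_insert_le_m1[of _ "insert (Suc m) (set p)" m] by (simp add: card_insert_if)
    then show ?thesis
      using n by linarith
  qed
  moreover have "gap_free n (concat (map \<theta>' (m # p @ [Suc m])))"
    using w \<theta>'[of p] by simp
  ultimately have "gap_free n (concat (map \<theta>' (m # q @ [Suc m])))"
    by (rule gap_free_step)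
  then show ?thesis
    using \<theta>'[of q] by simp
qed

text \<open>Generality in the substitution and the context makes the rules \<open>subst\<close> and
  \<open>mult\<close> instances of the induction hypothesis; the equivalence takes care of
  \<open>sym\<close>.\<close>

lemma gap_free_deducible:
  assumes "deducible \<Sigma> u v" and \<Sigma>: "\<And>p q. (p, q) \<in> \<Sigma> \<Longrightarrow> AB_equiv p q \<and> card (set p) + 4 < n"
  shows "gap_free n (\<alpha> @ concat (map \<theta> u) @ \<beta>) \<longleftrightarrow> gap_free n (\<alpha> @ concat (map \<theta> v) @ \<beta>)"
  using assms(1)
proof (induction arbitrary: \<alpha> \<beta> \<theta>)
  case (axiom p q)
  interpret A: AB_congruence A_equiv
    by (rule A_equiv_AB_congruence)
  have "AB_equiv p q" "AB_equiv q p" "card (set p) + 4 < n"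
    using \<Sigma>[OF axiom] by (auto simp: AB_equiv_def A_equiv_def)
  moreover have "set p = set q"
    using A.R_dest_content[of p q] A.phi_of_triv not_A_equiv_phi calculation(1) by (auto simp: AB_equiv_def)
  ultimately show ?case
    using gap_free_context by metis
next
  case (mult u v u' v')
  from mult.IH(1)[of \<alpha> \<theta> "concat (map \<theta> u') @ \<beta>"] mult.IH(2)[of "\<alpha> @ concat (map \<theta> v)" \<theta> \<beta>]
  show ?case
    by simp
next
  case subst
  have *: "concat (map \<theta> (concat (map \<sigma> w))) = concat (map (\<lambda>x. concat (map \<theta> (\<sigma> x))) w)"
    for w and \<sigma> :: "nat \<Rightarrow> mword"
    by (induction w) auto
  show ?case
    unfolding * by (rule subst.IH)
qed auto

lemma A_value_no_b:
  assumes "\<rho> ` set w \<subseteq> {None, Some A_d, Some A_e}"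
  shows "A_value \<rho> w \<in> {None, Some A_0, Some A_d, Some A_e, Some A_c}"
  using assms
proof (induction w)
  case (Cons z w)
  then have "A_value \<rho> w \<in> {None, Some A_0, Some A_d, Some A_e, Some A_c}"
    "\<rho> z \<in> {None, Some A_d, Some A_e}"
    by auto
  then show ?case by auto
qed simp

theorem AB_not_finitely_based:
  assumes "finite \<Sigma>" "\<And>p q. (p, q) \<in> \<Sigma> \<Longrightarrow> AB_equiv p q"
  shows "\<exists>u v. AB_equiv u v \<and> \<not> deducible \<Sigma> u v"
proof -
  define n where "n = Suc (Max (insert 0 ((\<lambda>(p, q). card (set p)) ` \<Sigma>))) + 4"
  have n: "card (set p) + 4 < n" if "(p, q) \<in> \<Sigma>" for p q
  proof -
    have "card (set p) \<le> Max (insert 0 ((\<lambda>(p, q). card (set p)) ` \<Sigma>))"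
      using assms(1) that by (intro Max_ge) force+
    then show ?thesis
      by (simp add: n_def)
  qed
  define s where "s = concat (map (\<lambda>k. [k, k]) [2..<Suc n])"
  define u where "u = [0, 1, 1] @ s @ [0::nat]"
  define v where "v = [0, 1, 1, 0] @ s @ [0::nat]"
  have s: "set s = {2..n}"
    by (auto simp: s_def)
  have sorted: "\<not> before j i (concat (map (\<lambda>k. [k, k]) [a..<b]))" if "i < j" for i j a b :: nat
    using that by (induction b) (auto dest: before_in_set)
  have n2: "2 < n"
    by (simp add: n_def)
  have multi_s: "before z z s" if "z \<in> set s" for z
  proof -
    have "z \<in> set [2..<Suc n]"
      using that s by (auto simp del: upt_Suc)
    then obtain A B where "[2..<Suc n] = A @ z # B"
      by (meson split_list)
    then show ?thesis
      by (simp add: s_def del: upt_Suc)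
  qed
  \<comment> \<open>All letters are repeated, hence evaluated in \<open>None\<close>,
    \<open>d\<close>, \<open>e\<close>; by \<open>A_value_no_b\<close> the value of \<open>s\<close>
    avoids \<open>a\<close> and \<open>b\<close>, which leaves finitely many products to
    compare.\<close>
  have "AB_equiv u v"
  proof -
    have val: "A_value \<rho> u = A_value \<rho> v" "A_value \<rho> (rev u) = A_value \<rho> (rev v)"
      if \<rho>: "\<And>x. x \<le> n \<Longrightarrow> \<rho> x \<in> {None, Some A_d, Some A_e}" for \<rho>
    proof -
      have "\<rho> ` set s \<subseteq> {None, Some A_d, Some A_e}" "\<rho> ` set (rev s) \<subseteq> {None, Some A_d, Some A_e}"
        unfolding set_rev s image_subset_iff using \<rho> by simp_all
      note this[THEN A_value_no_b]
      moreover have "\<rho> 0 \<in> {None, Some A_d, Some A_e}" "\<rho> (Suc 0) \<in> {None, Some A_d, Some A_e}"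
        using \<rho> n2 by auto
      ultimately show "A_value \<rho> u = A_value \<rho> v" "A_value \<rho> (rev u) = A_value \<rho> (rev v)"
        by (auto simp: u_def v_def A_value_append)
    qed
    have mu: "before x x u \<longleftrightarrow> x \<le> n" and mv: "before x x v \<longleftrightarrow> x \<le> n" for x
    proof -
      have "before x x s \<longleftrightarrow> 2 \<le> x \<and> x \<le> n"
        using multi_s[of x] s by (auto dest: before_in_set)
      then show "before x x u \<longleftrightarrow> x \<le> n" "before x x v \<longleftrightarrow> x \<le> n"
        using n2 s by (auto simp: u_def v_def)
    qed
    have "A_equiv u v"
      by (rule A_equivI) (use val(1) mu mv in blast)+
    moreover have "A_equiv (rev u) (rev v)"
      by (rule A_equivI; unfold before_rev) (use val(2) mu mv in blast)+
    ultimately show ?thesis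
      by (simp add: AB_equiv_def)
  qed
  moreover have "\<not> deducible \<Sigma> u v"
  proof
    assume "deducible \<Sigma> u v"
    then have "gap_free n ([] @ concat (map (\<lambda>x. [x]) u) @ []) \<longleftrightarrow> gap_free n ([] @ concat (map (\<lambda>x. [x]) v) @ [])"
      by (rule gap_free_deducible) (use assms(2) n in blast)
    then have "gap_free n u \<longleftrightarrow> gap_free n v"
      by (simp add: concat_singleton)
    moreover have "gap_free n u"
      unfolding gap_free_def
    proof (intro conjI allI impI)
      show "set u = {..n}"
        using s n2 by (auto simp: u_def)
      show "\<not> before j i u" if "0 < i" "i < j" for i j
      proof -
        have "\<not> before j i s"
          unfolding s_def using that(2) by (rule sorted)
        then show ?thesis
          using that s by (auto simp: u_def)
      qed
      show False if u: "u = A @ 0 # B" "1 \<in> set A" "n \<in> set B" for A B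
      proof -
        \<comment> \<open>The only letters \<open>0\<close> of \<open>u\<close> are the first and
          the last one; a \<open>1\<close> on the left excludes the former, an \<open>n\<close> on
          the right the latter.\<close>
        obtain A' where A: "A = 0 # A'"
          using u(1,2) by (cases A) (auto simp: u_def)
        obtain B' b where B: "B = B' @ [b]"
          using u(3) by (cases B rule: rev_cases) auto
        have "0 # ([1, 1] @ s) @ [0] = 0 # (A' @ 0 # B') @ [b]"
          using u(1) by (simp add: u_def A B)
        then have "[1, 1] @ s = A' @ 0 # B'"
          by (simp only: list.inject append1_eq_conv)
        then have "0 \<in> set ([1, 1] @ s)"
          by (simp only: set_append list.set) blast
        then show False
          using s by simp
      qed
    qed
    moreover have "\<not> gap_free n v"
    proof
      assume "gap_free n v"
      moreover have "v = [0, 1, 1] @ 0 # s @ [0]" "1 \<in> set [0, 1, 1::nat]" "n \<in> set (s @ [0])"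
        using s n2 by (auto simp: v_def)
      ultimately show False
        unfolding gap_free_def by blast
    qed
    ultimately show False
      by blast
  qed
  ultimately show ?thesis
    by blast
qed


section \<open>Varieties and their identities\<close>

lemma word_value_epi:
  assumes "monoid M" "monoid N" "h \<in> epi M N" "range \<phi> \<subseteq> carrier M"
  shows "h (word_value M \<phi> w) = word_value N (h \<circ> \<phi>) w"
proof -
  interpret M: monoid M by fact
  interpret N: monoid N by fact
  have h: "h \<in> hom M N" "h ` carrier M = carrier N"
    using assms(3) unfolding epi_def by simp_all
  \<comment> \<open>By surjectivity some \<open>x\<close> is mapped to the identity of
    \<open>N\<close>, and then \<open>h \<one> = h (\<one> x) = h x\<close>.\<close>
  have "h \<one>\<^bsub>M\<^esub> = \<one>\<^bsub>N\<^esub>"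
  proof -
    have "\<one>\<^bsub>N\<^esub> \<in> h ` carrier M"
      unfolding h(2) by (rule N.one_closed)
    then obtain x where x: "x \<in> carrier M" "h x = \<one>\<^bsub>N\<^esub>"
      by (rule imageE) simp
    have "h \<one>\<^bsub>M\<^esub> = h \<one>\<^bsub>M\<^esub> \<otimes>\<^bsub>N\<^esub> h x"
      using hom_in_carrier[OF h(1) M.one_closed] x(2) by simp
    also have "\<dots> = h x"
      using hom_mult[OF h(1) M.one_closed x(1)] x(1) by simp
    finally show ?thesis
      using x(2) by simp
  qed
  moreover have "\<phi> x \<in> carrier M" for x
    using assms(4) by auto
  ultimately show ?thesis
    by (induction w) (simp_all add: hom_mult[OF h(1)] word_value_closed[OF assms(1,4)])
qed

lemma satisfies_epi:
  assumes "monoid M" "monoid N" "h \<in> epi M N" "satisfies M e"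
  shows "satisfies N e"
  unfolding satisfies_def
proof (intro allI impI)
  fix \<psi> :: "nat \<Rightarrow> 'b" assume \<psi>: "range \<psi> \<subseteq> carrier N"
  have "\<exists>y. y \<in> carrier M \<and> h y = \<psi> x" for x
  proof -
    have "\<psi> x \<in> h ` carrier M"
      using \<psi> assms(3) by (auto simp: epi_def)
    then show ?thesis by auto
  qed
  then obtain \<phi> where "\<And>x. \<phi> x \<in> carrier M \<and> h (\<phi> x) = \<psi> x"
    by metis
  then have \<phi>: "range \<phi> \<subseteq> carrier M" "\<psi> = h \<circ> \<phi>"
    by auto
  have "word_value M \<phi> (fst e) = word_value M \<phi> (snd e)"
    using assms(4) \<phi>(1) by (simp add: satisfies_def)
  then show "word_value N \<psi> (fst e) = word_value N \<psi> (snd e)"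
    unfolding \<phi>(2) word_value_epi[OF assms(1-3) \<phi>(1), symmetric] by simp
qed

lemma word_value_submonoid: "word_value (M\<lparr>carrier := S\<rparr>) \<phi> w = word_value M \<phi> w"
  by (simp add: word_value_def)

lemma satisfies_submonoid:
  assumes "submonoid S M" "satisfies M e" shows "satisfies (M\<lparr>carrier := S\<rparr>) e"
  using assms submonoid.subset[OF assms(1)] by (auto simp: satisfies_def word_value_submonoid)

lemma monoid_product_group:
  assumes "\<And>i. i \<in> I \<Longrightarrow> monoid (M i)" shows "monoid (product_group I M)"
proof (rule monoidI)
  have mem: "x i \<in> carrier (M i)" if "x \<in> carrier (product_group I M)" "i \<in> I" for x i
    using that PiE_mem[of x I "\<lambda>i. carrier (M i)" i] by simp
  have arb: "x i = undefined" if "x \<in> carrier (product_group I M)" "i \<notin> I" for x i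
    using that PiE_arb[of x I "\<lambda>i. carrier (M i)" i] by simp
  note ax = assms[THEN monoid.m_closed] assms[THEN monoid.m_assoc] assms[THEN monoid.one_closed]
    assms[THEN monoid.l_one] assms[THEN monoid.r_one]
  show "\<one>\<^bsub>product_group I M\<^esub> \<in> carrier (product_group I M)"
    by (simp add: ax)
  fix x y z
  assume x: "x \<in> carrier (product_group I M)"
  show "\<one>\<^bsub>product_group I M\<^esub> \<otimes>\<^bsub>product_group I M\<^esub> x = x"
    and "x \<otimes>\<^bsub>product_group I M\<^esub> \<one>\<^bsub>product_group I M\<^esub> = x"
    by (rule ext; use mem[OF x] arb[OF x] in \<open>simp add: product_group_def ax restrict_def\<close>)+
  assume y: "y \<in> carrier (product_group I M)"
  show "x \<otimes>\<^bsub>product_group I M\<^esub> y \<in> carrier (product_group I M)"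
    using mem[OF x] mem[OF y] by (simp add: product_group_def ax)
  assume z: "z \<in> carrier (product_group I M)"
  show "x \<otimes>\<^bsub>product_group I M\<^esub> y \<otimes>\<^bsub>product_group I M\<^esub> z =
      x \<otimes>\<^bsub>product_group I M\<^esub> (y \<otimes>\<^bsub>product_group I M\<^esub> z)"
    using mem[OF x] mem[OF y] mem[OF z] by (intro ext) (simp add: product_group_def ax restrict_def)
qed

lemma word_value_product_group:
  assumes "\<And>x. \<phi> x \<in> carrier (product_group I M)"
  shows "word_value (product_group I M) \<phi> w = (\<lambda>i\<in>I. word_value (M i) (\<lambda>x. \<phi> x i) w)"
  by (induction w) (auto simp: product_group_def restrict_def)

lemma satisfies_product_group:
  assumes "\<And>i. i \<in> I \<Longrightarrow> satisfies (M i) e"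
  shows "satisfies (product_group I M) e"
  unfolding satisfies_def
proof (intro allI impI)
  fix \<phi> :: "nat \<Rightarrow> 'a \<Rightarrow> 'b" assume "range \<phi> \<subseteq> carrier (product_group I M)"
  then have \<phi>: "\<phi> x \<in> carrier (product_group I M)" for x
    by blast
  have "word_value (M i) (\<lambda>x. \<phi> x i) (fst e) = word_value (M i) (\<lambda>x. \<phi> x i) (snd e)" if "i \<in> I" for i
  proof -
    have "range (\<lambda>x. \<phi> x i) \<subseteq> carrier (M i)"
      using \<phi> that by (auto simp: product_group_def PiE_def)
    then show ?thesis
      using assms[OF that] by (simp add: satisfies_def)
  qed
  then show "word_value (product_group I M) \<phi> (fst e) = word_value (product_group I M) \<phi> (snd e)"
    unfolding word_value_product_group[of \<phi>, OF \<phi>] by (auto simp: restrict_def)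
qed

lemma submonoid_monoid: "submonoid S M \<Longrightarrow> monoid M \<Longrightarrow> monoid (M\<lparr>carrier := S\<rparr>)"
  using submonoid.submonoid_is_monoid by blast

lemma monoid_variety_models: "monoid_variety {M :: 'u monoid. monoid M \<and> satisfies M e}"
proof -
  have "satisfies N e"
    if "monoid N" and i: "\<forall>i\<in>I. monoid (M i) \<and> satisfies (M i) e" and S: "submonoid S (product_group I M)"
      and h: "h \<in> epi ((product_group I M)\<lparr>carrier := S\<rparr>) N"
    for N :: "'u monoid" and I :: "'u set" and M :: "'u \<Rightarrow> 'u monoid" and S h
  proof (rule satisfies_epi[OF _ that(1) h])
    have P: "monoid (product_group I M)"
      using i by (intro monoid_product_group) blast
    show "monoid ((product_group I M)\<lparr>carrier := S\<rparr>)"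
      using S P by (rule submonoid_monoid)
    have "satisfies (product_group I M) e"
      using i by (intro satisfies_product_group) blast
    then show "satisfies ((product_group I M)\<lparr>carrier := S\<rparr>) e"
      using S by (rule satisfies_submonoid[rotated])
  qed
  then show ?thesis
    by (auto simp: monoid_variety_def HSP_def)
qed

section \<open>The product and its copies in the universe\<close>

lemma word_value_DirProd:
  "word_value (G \<times>\<times> H) \<phi> w = (word_value G (fst \<circ> \<phi>) w, word_value H (snd \<circ> \<phi>) w)"
  by (induction w) (auto simp: DirProd_def case_prod_beta)

lemma carrier_A1_B1: "carrier (A1 \<times>\<times> B1) = UNIV"
  by (simp add: DirProd_def)

lemma satisfies_A1_B1: "satisfies (A1 \<times>\<times> B1) (u, v) \<longleftrightarrow> AB_equiv u v"
proof
  assume s: "satisfies (A1 \<times>\<times> B1) (u, v)"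
  have "A_value \<rho> u = A_value \<rho> v \<and> A_value \<rho> (rev u) = A_value \<rho> (rev v)" for \<rho>
    using s[unfolded satisfies_def, rule_format, of "\<lambda>x. (\<rho> x, \<rho> x)"]
    by (simp add: word_value_DirProd word_value_B1 comp_def carrier_A1_B1)
  then show "AB_equiv u v"
    by (simp add: AB_equiv_def A_equiv_def)
next
  assume "AB_equiv u v"
  then show "satisfies (A1 \<times>\<times> B1) (u, v)"
    by (simp add: satisfies_def AB_equiv_def A_equiv_def word_value_DirProd word_value_B1)
qed

lemma monoid_A1_B1: "monoid (A1 \<times>\<times> B1)"
  using monoid_A1 monoid_B1 by (rule DirProd_monoid)

lemma finite_A_elt: "finite (UNIV :: A_elt set)"
proof -
  have "x \<in> {A_0, A_a, A_b, A_c, A_d, A_e}" for x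
    by (cases x) auto
  then have "UNIV = {A_0, A_a, A_b, A_c, A_d, A_e}"
    by blast
  then show ?thesis
    by (metis finite.emptyI finite_insert)
qed

lemma finite_A1_B1: "finite (carrier (A1 \<times>\<times> B1))"
proof -
  have "UNIV = insert None (Some ` (UNIV :: A_elt set))"
    using UNIV_option_conv .
  then have "finite (UNIV :: A_elt option set)"
    using finite_A_elt by (metis finite_imageI finite_insert)
  from finite_Prod_UNIV[OF this this] show ?thesis
    unfolding carrier_A1_B1 .
qed

lemma monoid_iso_sym:
  assumes "monoid N" "N \<cong> M" shows "M \<cong> N"
proof -
  interpret N: monoid N by fact
  obtain h where h: "h \<in> hom N M" "bij_betw h (carrier N) (carrier M)"
    using assms(2) unfolding is_iso_def iso_def by blast
  let ?g = "inv_into (carrier N) h"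
  have g: "?g (h a) = a" if "a \<in> carrier N" for a
    using h(2) that by (auto simp: bij_betw_def)
  have im: "h ` carrier N = carrier M"
    using h(2) by (simp add: bij_betw_def)
  have "?g \<in> hom M N"
  proof (rule homI)
    show "?g x \<in> carrier N" if "x \<in> carrier M" for x
      using that g unfolding im[symmetric] by auto
    show "?g (x \<otimes>\<^bsub>M\<^esub> y) = ?g x \<otimes>\<^bsub>N\<^esub> ?g y" if xy: "x \<in> carrier M" "y \<in> carrier M" for x y
    proof -
      obtain a b where ab: "a \<in> carrier N" "b \<in> carrier N" "x = h a" "y = h b"
      proof -
        have "x \<in> h ` carrier N" "y \<in> h ` carrier N"
          using xy unfolding im by simp_all
        then show thesis
          using that by (auto elim!: imageE)
      qed
      have "?g (h (a \<otimes>\<^bsub>N\<^esub> b)) = a \<otimes>\<^bsub>N\<^esub> b"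
        using ab by (intro g N.m_closed)
      then show ?thesis
        unfolding ab(3,4) g[OF ab(1)] g[OF ab(2)] hom_mult[OF h(1) ab(1,2)] .
    qed
  qed
  then have "?g \<in> iso M N"
    using bij_betw_inv_into[OF h(2)] by (rule isoI)
  then show ?thesis
    by (rule is_isoI)
qed

lemma iso_imp_epi: "N \<cong> M \<Longrightarrow> \<exists>h. h \<in> epi N M"
  unfolding is_iso_def iso_def epi_def bij_betw_def by blast

lemma satisfies_iso:
  assumes "monoid M" "monoid N" "N \<cong> M"
  shows "satisfies N e \<longleftrightarrow> satisfies M e"
proof -
  obtain h where h: "h \<in> epi M N"
    using iso_imp_epi[OF monoid_iso_sym[OF assms(2,3)]] by blast
  obtain g where g: "g \<in> epi N M"
    using iso_imp_epi[OF assms(3)] by blast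
  show ?thesis
    using satisfies_epi[OF assms(1,2) h] satisfies_epi[OF assms(2,1) g] by blast
qed

text \<open>Ensures that the generated variety really contains a copy of the finite product, so that
  its identities hold in the product.\<close>

lemma copy_exists:
  fixes M :: "'a monoid"
  assumes "infinite (UNIV :: 'u set)" "monoid M" "finite (carrier M)"
  shows "\<exists>N :: 'u monoid. monoid N \<and> N \<cong> M"
proof -
  interpret M: monoid M by fact
  obtain f :: "nat \<Rightarrow> 'u" where f: "inj f"
    using infinite_countable_subset[OF assms(1)] by blast
  obtain k :: "'a \<Rightarrow> nat" where k: "inj_on k (carrier M)"
    using finite_imp_inj_to_nat_seg[OF assms(3)] by (elim exE conjE)
  define g where "g = f \<circ> k"
  have g: "inj_on g (carrier M)"
    using f k by (auto simp: g_def intro: comp_inj_on inj_on_subset)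
  define i where "i = inv_into (carrier M) g"
  have i: "i (g x) = x" if "x \<in> carrier M" for x
    using g that by (simp add: i_def)
  define N where "N = \<lparr>carrier = g ` carrier M, mult = (\<lambda>x y. g (i x \<otimes>\<^bsub>M\<^esub> i y)), one = g \<one>\<^bsub>M\<^esub>\<rparr>"
  have "monoid N"
    by (rule monoidI) (auto simp: N_def i M.m_assoc)
  moreover have "g \<in> iso M N"
    using g by (auto simp: iso_def hom_def N_def i bij_betw_def)
  then have "N \<cong> M"
    by (intro monoid_iso_sym[OF assms(2)] is_isoI)
  ultimately show ?thesis
    by blast
qed

text \<open>In one direction a copy of the product is tested; in the other, the models of a single
  identity form a variety that contains all these copies.\<close>

lemma identities_generated:
  assumes "infinite (UNIV :: 'u set)"
  shows "(u, v) \<in> identities_of (variety_generated_by {A1 \<times>\<times> B1} :: 'u monoid set) \<longleftrightarrow> AB_equiv u v"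
proof
  obtain N :: "'u monoid" where N: "monoid N" "N \<cong> A1 \<times>\<times> B1"
    using copy_exists[OF assms monoid_A1_B1 finite_A1_B1] by blast
  assume "(u, v) \<in> identities_of (variety_generated_by {A1 \<times>\<times> B1} :: 'u monoid set)"
  moreover have "N \<in> variety_generated_by {A1 \<times>\<times> B1}"
    using N by (auto simp: variety_generated_by_def)
  ultimately have "satisfies N (u, v)"
    by (auto simp: identities_of_def)
  then show "AB_equiv u v"
    using satisfies_iso[OF monoid_A1_B1 N] satisfies_A1_B1 by blast
next
  assume "AB_equiv u v"
  then have s: "satisfies (A1 \<times>\<times> B1) (u, v)"
    by (simp add: satisfies_A1_B1)
  let ?K = "{M :: 'u monoid. monoid M \<and> satisfies M (u, v)}"
  have "variety_generated_by {A1 \<times>\<times> B1} \<subseteq> ?K"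
    unfolding variety_generated_by_def
  proof (intro Inter_lower CollectI conjI ballI allI impI)
    show "monoid_variety ?K"
      by (rule monoid_variety_models)
    show "monoid N" "satisfies N (u, v)" if "M \<in> {A1 \<times>\<times> B1}" "monoid N \<and> N \<cong> M" for M and N :: "'u monoid"
      using that satisfies_iso[OF monoid_A1_B1, of N] s by auto
  qed
  then show "(u, v) \<in> identities_of (variety_generated_by {A1 \<times>\<times> B1} :: 'u monoid set)"
    by (auto simp: identities_of_def)
qed

text \<open>
  Birkhoff's argument for a countable monoid: words modulo the identities of \<open>W\<close> embed into a
  product of members of \<open>W\<close> that has one factor for each identity failing in \<open>W\<close>.
\<close>

lemma countable_model_in_variety:
  fixes W :: "'u monoid set"
  assumes inf: "infinite (UNIV :: 'u set)" and W: "monoid_variety W"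
    and N: "monoid N" "countable (carrier N)" and sat: "\<And>e. e \<in> identities_of W \<Longrightarrow> satisfies N e"
  shows "N \<in> W"
proof -
  interpret N: monoid N by fact
  obtain f :: "nat \<Rightarrow> 'u" where f: "inj f"
    using infinite_countable_subset[OF inf] by (elim exE conjE)
  \<comment> \<open>Index sets are subsets of the universe; as there are only countably many
    identities, the failing ones can be encoded there.\<close>
  define enc :: "midentity \<Rightarrow> 'u" where "enc = f \<circ> to_nat"
  have enc: "inj enc"
    unfolding enc_def by (intro inj_compose f inj_to_nat)
  define I where "I = enc ` (- identities_of W)"
  have "\<forall>e. \<exists>M \<phi>. e \<notin> identities_of W \<longrightarrow> M \<in> W \<and> range \<phi> \<subseteq> carrier M \<and>
      word_value M \<phi> (fst e) \<noteq> word_value M \<phi> (snd e)"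
    by (auto simp: identities_of_def satisfies_def)
  then obtain Me \<phi>e where Me: "\<And>e. e \<notin> identities_of W \<Longrightarrow> Me e \<in> W \<and> range (\<phi>e e) \<subseteq> carrier (Me e) \<and>
      word_value (Me e) (\<phi>e e) (fst e) \<noteq> word_value (Me e) (\<phi>e e) (snd e)"
    by metis
  define M where "M i = Me (inv_into UNIV enc i)" for i
  define \<phi> where "\<phi> i = \<phi>e (inv_into UNIV enc i)" for i
  have M: "M i \<in> W" "range (\<phi> i) \<subseteq> carrier (M i)" if "i \<in> I" for i
  proof -
    obtain e where "i = enc e" "e \<notin> identities_of W"
      using \<open>i \<in> I\<close> by (auto simp: I_def)
    then show "M i \<in> W" "range (\<phi> i) \<subseteq> carrier (M i)"
      using Me[of e] enc by (simp_all add: M_def \<phi>_def)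
  qed
  have mon: "monoid (M i)" if "i \<in> I" for i
    using M(1)[OF that] W by (auto simp: monoid_variety_def)
  define el where "el w = (\<lambda>i\<in>I. word_value (M i) (\<phi> i) w)" for w
  let ?P = "product_group I M"
  have el_append: "el u \<otimes>\<^bsub>?P\<^esub> el v = el (u @ v)" for u v
    by (auto simp: el_def product_group_def restrict_def word_value_append mon M)
  have S: "submonoid (range el) ?P"
  proof
    show "range el \<subseteq> carrier ?P"
      using word_value_closed[OF mon M(2)] by (auto simp: el_def)
    show "\<one>\<^bsub>?P\<^esub> \<in> range el"
      by (rule range_eqI[of _ _ "[]"]) (simp add: el_def)
    show "x \<otimes>\<^bsub>?P\<^esub> y \<in> range el" if "x \<in> range el" "y \<in> range el" for x y
      using that el_append by auto
  qed
  have el_eq: "(u, v) \<in> identities_of W" if "el u = el v" for u v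
  proof (rule ccontr)
    assume n: "(u, v) \<notin> identities_of W"
    then have "enc (u, v) \<in> I"
      by (simp add: I_def)
    moreover from this have "el u (enc (u, v)) = el v (enc (u, v))"
      using that by simp
    ultimately show False
      using Me[OF n] enc by (simp add: el_def M_def \<phi>_def)
  qed
  define \<gamma> where "\<gamma> = from_nat_into (carrier N)"
  have \<gamma>: "range \<gamma> = carrier N"
    unfolding \<gamma>_def using N(2) N.one_closed by (intro range_from_nat_into) auto
  \<comment> \<open>The choice of \<open>w\<close> does not matter: words with the same
    \<open>el\<close> form an identity of \<open>W\<close>, which holds in \<open>N\<close>. As
    \<open>\<gamma>\<close> enumerates the carrier, \<open>h\<close> is onto.\<close>
  define h where "h s = word_value N \<gamma> (SOME w. el w = s)" for s
  have h: "h (el w) = word_value N \<gamma> w" for w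
  proof -
    have "el (SOME v. el v = el w) = el w"
      by (rule someI) (rule HOL.refl)
    from sat[OF el_eq[OF this]] show ?thesis
      using \<gamma> by (simp add: h_def satisfies_def)
  qed
  have "h \<in> epi (?P\<lparr>carrier := range el\<rparr>) N"
  proof -
    have "h \<in> hom (?P\<lparr>carrier := range el\<rparr>) N"
    proof (rule homI)
      show "h x \<in> carrier N" if "x \<in> carrier (?P\<lparr>carrier := range el\<rparr>)" for x
        using that h word_value_closed[OF N(1), of \<gamma>] \<gamma> by auto
      show "h (x \<otimes>\<^bsub>?P\<lparr>carrier := range el\<rparr>\<^esub> y) = h x \<otimes>\<^bsub>N\<^esub> h y"
        if "x \<in> carrier (?P\<lparr>carrier := range el\<rparr>)" "y \<in> carrier (?P\<lparr>carrier := range el\<rparr>)" for x y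
        using that h el_append word_value_append[OF N(1), of \<gamma>] \<gamma> by auto
    qed
    moreover have "h ` range el = carrier N"
    proof
      show "h ` range el \<subseteq> carrier N"
        using h word_value_closed[OF N(1), of \<gamma>] \<gamma> by auto
      show "carrier N \<subseteq> h ` range el"
      proof
        fix x assume x: "x \<in> carrier N"
        then obtain k where "x = \<gamma> k"
          using \<gamma> by blast
        then have "h (el [k]) = x"
          using h[of "[k]"] x by simp
        then show "x \<in> h ` range el"
          by blast
      qed
    qed
    ultimately show ?thesis
      by (simp add: epi_def)
  qed
  then have "N \<in> HSP W"
    using N(1) S M(1) unfolding HSP_def by blast
  then show ?thesis
    using W by (auto simp: monoid_variety_def)
qed

lemma identities_AB_congruence:
  fixes W :: "'u monoid set"
  assumes W: "\<forall>M\<in>W. monoid M" and AB: "\<And>u v. AB_equiv u v \<Longrightarrow> (u, v) \<in> identities_of W"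
  shows "AB_congruence (\<lambda>u v. (u, v) \<in> identities_of W)"
proof
  show "(u @ u', v @ v') \<in> identities_of W" if "(u, v) \<in> identities_of W" "(u', v') \<in> identities_of W" for u v u' v'
    using that W by (auto simp: identities_of_def satisfies_def word_value_append)
  show "(concat (map \<sigma> u), concat (map \<sigma> v)) \<in> identities_of W" if uv: "(u, v) \<in> identities_of W" for u v \<sigma>
    unfolding identities_of_def satisfies_def mem_Collect_eq fst_conv snd_conv
  proof (intro ballI allI impI)
    fix M and \<phi> :: "nat \<Rightarrow> 'u" assume M: "M \<in> W" and \<phi>: "range \<phi> \<subseteq> carrier M"
    have m: "monoid M"
      using W M by blast
    have "range (\<lambda>x. word_value M \<phi> (\<sigma> x)) \<subseteq> carrier M"
      using word_value_closed[OF m \<phi>] by blast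
    then show "word_value M \<phi> (concat (map \<sigma> u)) = word_value M \<phi> (concat (map \<sigma> v))"
      using uv M by (simp add: word_value_subst[OF m \<phi>] identities_of_def satisfies_def)
  qed
qed (use AB in \<open>auto simp: identities_of_def satisfies_def\<close>)

theorem mainTheorem1:
  assumes "infinite (UNIV :: 'u set)"
  shows "limit_variety (variety_generated_by {A1 \<times>\<times> B1} :: 'u monoid set)"
proof -
  let ?V = "variety_generated_by {A1 \<times>\<times> B1} :: 'u monoid set"
  note ids = identities_generated[OF assms]
  have "\<not> finitely_based ?V"
  proof
    assume "finitely_based ?V"
    then obtain \<Sigma> where \<Sigma>: "finite \<Sigma>" "\<Sigma> \<subseteq> identities_of ?V" "\<forall>(u, v)\<in>identities_of ?V. deducible \<Sigma> u v"
      by (auto simp: finitely_based_def)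
    have "AB_equiv p q" if "(p, q) \<in> \<Sigma>" for p q
      using \<Sigma>(2) that ids by blast
    from AB_not_finitely_based[OF \<Sigma>(1) this] obtain u v where "AB_equiv u v" "\<not> deducible \<Sigma> u v"
      by blast
    then show False
      using \<Sigma>(3) ids by blast
  qed
  moreover have "finitely_based W" if W: "monoid_variety W" "W \<subset> ?V" for W
  proof -
    have "AB_congruence (\<lambda>u v. (u, v) \<in> identities_of W)"
    proof (rule identities_AB_congruence)
      show "\<forall>M\<in>W. monoid M"
        using W(1) by (simp add: monoid_variety_def)
      show "(u, v) \<in> identities_of W" if "AB_equiv u v" for u v
        using that W(2) by (auto simp: ids[symmetric] identities_of_def)
    qed
    \<comment> \<open>If all identities of \<open>W\<close> held in the product, its copies, being
      finite, would lie in \<open>W\<close>, and \<open>W\<close> would contain the generated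
      variety.\<close>
    moreover obtain u v where "(u, v) \<in> identities_of W" "\<not> AB_equiv u v"
    proof (rule ccontr)
      assume "\<not> thesis"
      then have AB: "AB_equiv u v" if "(u, v) \<in> identities_of W" for u v
        using that \<open>\<And>u v. \<lbrakk>(u, v) \<in> identities_of W; \<not> AB_equiv u v\<rbrakk> \<Longrightarrow> thesis\<close> by blast
      have "N \<in> W" if N: "monoid N" "N \<cong> A1 \<times>\<times> B1" for N
      proof (rule countable_model_in_variety[OF assms W(1) N(1)])
        obtain h where "bij_betw h (carrier N) (carrier (A1 \<times>\<times> B1))"
          using N(2) by (auto simp: is_iso_def iso_def)
        then show "countable (carrier N)"
          using finite_A1_B1 by (auto intro: countable_finite dest: bij_betw_finite)
        show "satisfies N e" if "e \<in> identities_of W" for e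
          using AB[of "fst e" "snd e"] that satisfies_A1_B1[of "fst e" "snd e"]
            satisfies_iso[OF monoid_A1_B1 N] by simp
      qed
      then have "?V \<subseteq> W"
        unfolding variety_generated_by_def using W(1) by (intro Inter_lower) simp
      then show False
        using W(2) by blast
    qed
    ultimately obtain \<Sigma> where "finite \<Sigma>" "\<forall>(u, v)\<in>\<Sigma>. (u, v) \<in> identities_of W"
      "\<forall>u v. (u, v) \<in> identities_of W \<longrightarrow> deducible \<Sigma> u v"
      using AB_congruence_finite_basis[of "\<lambda>u v. (u, v) \<in> identities_of W" u v] by blast
    then show ?thesis
      unfolding finitely_based_def by (intro exI[of _ \<Sigma>]) auto
  qed
  ultimately show ?thesis
    unfolding limit_variety_def using monoid_variety_generated by blast
qed

end
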